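(* The statement ``$\langle \mathbb{R},<\rangle \not\rightarrow (\tau)^\tau$ for all uncountable order types $\tau$" holds if and only if every infinite set of reals is inexact. Moreover, this is implied by the statement that every set of reals has the Perfect Set Property.
   Context: Work in ZF. For an order type $\tau$, $\langle \mathbb{R},<\rangle \rightarrow (\tau)^\tau$ means: for every colouring $F:[\mathbb{R}]^\tau\to 2$ of the subsets of $\mathbb{R}$ of order type $\tau$ (in the induced order) there is $H\in[\mathbb{R}]^\tau$ with $F$ constant on $[H]^\tau$; $\not\rightarrow$ denotes its negation. A linear order is exact if the only order-preserving map from it to itself is the identity (equivalently, it has no proper subset order-isomorphic to itself), and inexact otherwise. A set $P\subseteq\mathbb{R}$ is perfect if it is closed with no isolated points; $A\subseteq\mathbb{R}$ has the Perfect Set Property if $A$ is countable or contains a non-empty perfect subset. *)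

theory Defs
  imports Main
begin

text \<open>
  HOL has the axiom of choice, and with choice both sides of the equivalence are refutable for the
  HOL type of reals. Being a theorem of ZF is therefore expressed as truth in every model of
  first-order ZF (by completeness this is the same as provability): a type \<^typ>\<open>'a\<close> with an
  arbitrary binary relation satisfying the axioms, the two schemas ranging over first-order
  formulas with parameters only. All set-theoretic notions below are internal to the model:
  they quantify over elements of the model and never over HOL sets, functions or predicates.
\<close>

datatype fm =
    Member nat nat
  | Equal nat nat
  | Neg fm
  | Conj fm fm
  | Exists nat fm

primrec sat :: "('a \<Rightarrow> 'a \<Rightarrow> bool) \<Rightarrow> (nat \<Rightarrow> 'a) \<Rightarrow> fm \<Rightarrow> bool" where
  "sat mem \<rho> (Member i j) \<longleftrightarrow> mem (\<rho> i) (\<rho> j)"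
| "sat mem \<rho> (Equal i j) \<longleftrightarrow> \<rho> i = \<rho> j"
| "sat mem \<rho> (Neg \<phi>) \<longleftrightarrow> \<not> sat mem \<rho> \<phi>"
| "sat mem \<rho> (Conj \<phi> \<psi>) \<longleftrightarrow> sat mem \<rho> \<phi> \<and> sat mem \<rho> \<psi>"
| "sat mem \<rho> (Exists i \<phi>) \<longleftrightarrow> (\<exists>x. sat mem (\<rho>(i := x)) \<phi>)"

locale ZF_model =
  fixes mem :: "'a \<Rightarrow> 'a \<Rightarrow> bool"  (infix \<open>\<in>\<^sub>M\<close> 50)
  assumes extensionality: "(\<forall>z. z \<in>\<^sub>M x \<longleftrightarrow> z \<in>\<^sub>M y) \<Longrightarrow> x = y"
    and foundation: "(\<exists>y. y \<in>\<^sub>M x) \<Longrightarrow> \<exists>y. y \<in>\<^sub>M x \<and> \<not> (\<exists>z. z \<in>\<^sub>M x \<and> z \<in>\<^sub>M y)"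
    and pairing: "\<exists>z. \<forall>w. w \<in>\<^sub>M z \<longleftrightarrow> w = x \<or> w = y"
    and union: "\<exists>u. \<forall>w. w \<in>\<^sub>M u \<longleftrightarrow> (\<exists>y. y \<in>\<^sub>M x \<and> w \<in>\<^sub>M y)"
    and powerset: "\<exists>p. \<forall>w. w \<in>\<^sub>M p \<longleftrightarrow> (\<forall>z. z \<in>\<^sub>M w \<longrightarrow> z \<in>\<^sub>M x)"
    and infinity: "\<exists>x. (\<exists>e. e \<in>\<^sub>M x \<and> (\<forall>w. \<not> w \<in>\<^sub>M e)) \<and>
          (\<forall>y. y \<in>\<^sub>M x \<longrightarrow> (\<exists>s. s \<in>\<^sub>M x \<and> (\<forall>w. w \<in>\<^sub>M s \<longleftrightarrow> w \<in>\<^sub>M y \<or> w = y)))"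
    and separation: "\<exists>b. \<forall>x. x \<in>\<^sub>M b \<longleftrightarrow> x \<in>\<^sub>M a \<and> sat mem (\<rho>(i := x)) \<phi>"
    and replacement: "i \<noteq> j \<Longrightarrow>
          (\<forall>x. x \<in>\<^sub>M a \<longrightarrow> (\<exists>!y. sat mem (\<rho>(i := x, j := y)) \<phi>)) \<Longrightarrow>
          \<exists>b. \<forall>y. y \<in>\<^sub>M b \<longleftrightarrow> (\<exists>x. x \<in>\<^sub>M a \<and> sat mem (\<rho>(i := x, j := y)) \<phi>)"
begin

text \<open>
  \<open>setof P\<close> is the element of the model with extension \<open>P\<close>. It is a junk value when there is none;
  every use below is at a predicate for which ZF proves that the set exists.
\<close>

definition setof :: "('a \<Rightarrow> bool) \<Rightarrow> 'a" where
  "setof P = (THE s. \<forall>x. x \<in>\<^sub>M s \<longleftrightarrow> P x)"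

definition subset_of :: "'a \<Rightarrow> 'a \<Rightarrow> bool"  (infix \<open>\<subseteq>\<^sub>M\<close> 50) where
  "x \<subseteq>\<^sub>M y \<longleftrightarrow> (\<forall>z. z \<in>\<^sub>M x \<longrightarrow> z \<in>\<^sub>M y)"

definition empty_set :: 'a where
  "empty_set = setof (\<lambda>x. False)"

definition succ :: "'a \<Rightarrow> 'a" where
  "succ x = setof (\<lambda>w. w \<in>\<^sub>M x \<or> w = x)"

definition upair :: "'a \<Rightarrow> 'a \<Rightarrow> 'a" where
  "upair x y = setof (\<lambda>w. w = x \<or> w = y)"

definition opair :: "'a \<Rightarrow> 'a \<Rightarrow> 'a" where
  "opair x y = upair (upair x x) (upair x y)"

definition cprod :: "'a \<Rightarrow> 'a \<Rightarrow> 'a" where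
  "cprod A B = setof (\<lambda>p. \<exists>x y. x \<in>\<^sub>M A \<and> y \<in>\<^sub>M B \<and> p = opair x y)"

definition is_inductive :: "'a \<Rightarrow> bool" where
  "is_inductive I \<longleftrightarrow> empty_set \<in>\<^sub>M I \<and> (\<forall>n. n \<in>\<^sub>M I \<longrightarrow> succ n \<in>\<^sub>M I)"

definition omega :: 'a where
  "omega = setof (\<lambda>n. \<forall>I. is_inductive I \<longrightarrow> n \<in>\<^sub>M I)"

definition is_function :: "'a \<Rightarrow> 'a \<Rightarrow> 'a \<Rightarrow> bool" where
  "is_function f A B \<longleftrightarrow> f \<subseteq>\<^sub>M cprod A B \<and> (\<forall>x. x \<in>\<^sub>M A \<longrightarrow> (\<exists>!y. opair x y \<in>\<^sub>M f))"

definition app :: "'a \<Rightarrow> 'a \<Rightarrow> 'a" where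
  "app f x = (THE y. opair x y \<in>\<^sub>M f)"

definition injection :: "'a \<Rightarrow> 'a \<Rightarrow> 'a \<Rightarrow> bool" where
  "injection f A B \<longleftrightarrow> is_function f A B \<and>
     (\<forall>x y. x \<in>\<^sub>M A \<longrightarrow> y \<in>\<^sub>M A \<longrightarrow> app f x = app f y \<longrightarrow> x = y)"

definition bijection :: "'a \<Rightarrow> 'a \<Rightarrow> 'a \<Rightarrow> bool" where
  "bijection f A B \<longleftrightarrow> injection f A B \<and> (\<forall>y. y \<in>\<^sub>M B \<longrightarrow> (\<exists>x. x \<in>\<^sub>M A \<and> app f x = y))"

definition finite_set :: "'a \<Rightarrow> bool" where
  "finite_set A \<longleftrightarrow> (\<exists>n f. n \<in>\<^sub>M omega \<and> bijection f A n)"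

definition countable_set :: "'a \<Rightarrow> bool" where
  "countable_set A \<longleftrightarrow> (\<exists>f. injection f A omega)"

text \<open>
  A relation is a set of ordered pairs. Only its restriction to the domain under consideration
  matters, so a subset of an ordered set is ordered by the same relation.
\<close>

definition rel :: "'a \<Rightarrow> 'a \<Rightarrow> 'a \<Rightarrow> bool" where
  "rel r x y \<longleftrightarrow> opair x y \<in>\<^sub>M r"

definition strict_linear_order :: "'a \<Rightarrow> 'a \<Rightarrow> bool" where
  "strict_linear_order L r \<longleftrightarrow>
     (\<forall>x. x \<in>\<^sub>M L \<longrightarrow> \<not> rel r x x) \<and>
     (\<forall>x y z. x \<in>\<^sub>M L \<longrightarrow> y \<in>\<^sub>M L \<longrightarrow> z \<in>\<^sub>M L \<longrightarrow> rel r x y \<longrightarrow> rel r y z \<longrightarrow> rel r x z) \<and>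
     (\<forall>x y. x \<in>\<^sub>M L \<longrightarrow> y \<in>\<^sub>M L \<longrightarrow> rel r x y \<or> x = y \<or> rel r y x)"

definition order_isomorphic :: "'a \<Rightarrow> 'a \<Rightarrow> 'a \<Rightarrow> 'a \<Rightarrow> bool" where
  "order_isomorphic X r Y s \<longleftrightarrow> (\<exists>f. bijection f X Y \<and>
     (\<forall>x y. x \<in>\<^sub>M X \<longrightarrow> y \<in>\<^sub>M X \<longrightarrow> (rel r x y \<longleftrightarrow> rel s (app f x) (app f y))))"

definition order_preserving :: "'a \<Rightarrow> 'a \<Rightarrow> 'a \<Rightarrow> bool" where
  "order_preserving f X r \<longleftrightarrow> is_function f X X \<and>
     (\<forall>x y. x \<in>\<^sub>M X \<longrightarrow> y \<in>\<^sub>M X \<longrightarrow> rel r x y \<longrightarrow> rel r (app f x) (app f y))"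

definition exact :: "'a \<Rightarrow> 'a \<Rightarrow> bool" where
  "exact X r \<longleftrightarrow> (\<forall>f. order_preserving f X r \<longrightarrow> (\<forall>x. x \<in>\<^sub>M X \<longrightarrow> app f x = x))"

definition inexact :: "'a \<Rightarrow> 'a \<Rightarrow> bool" where
  "inexact X r \<longleftrightarrow> \<not> exact X r"

text \<open>
  An order type is given by a linear order \<open>(L, s)\<close> representing it.
  \<open>subsets_of_type A r L s\<close> is \<open>[A]\<^sup>\<tau>\<close> for \<open>\<tau>\<close> the type of \<open>(L, s)\<close>, and
  \<open>arrows A r L s\<close> is \<open>(A, r) \<rightarrow> (\<tau>)\<^sup>\<tau>\<close>.
\<close>

definition subsets_of_type :: "'a \<Rightarrow> 'a \<Rightarrow> 'a \<Rightarrow> 'a \<Rightarrow> 'a" where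
  "subsets_of_type A r L s = setof (\<lambda>X. X \<subseteq>\<^sub>M A \<and> order_isomorphic X r L s)"

definition arrows :: "'a \<Rightarrow> 'a \<Rightarrow> 'a \<Rightarrow> 'a \<Rightarrow> bool" where
  "arrows A r L s \<longleftrightarrow>
     (\<forall>F. is_function F (subsets_of_type A r L s) (succ (succ empty_set)) \<longrightarrow>
        (\<exists>H. H \<in>\<^sub>M subsets_of_type A r L s \<and>
           (\<exists>c. \<forall>X. X \<in>\<^sub>M subsets_of_type H r L s \<longrightarrow> app F X = c)))"

definition app2 :: "'a \<Rightarrow> 'a \<Rightarrow> 'a \<Rightarrow> 'a" where
  "app2 f x y = app f (opair x y)"

definition complete_ordered_field ::
  "'a \<Rightarrow> 'a \<Rightarrow> 'a \<Rightarrow> 'a \<Rightarrow> 'a \<Rightarrow> 'a \<Rightarrow> bool" where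
  "complete_ordered_field R lt pl ml z e \<longleftrightarrow>
     is_function pl (cprod R R) R \<and> is_function ml (cprod R R) R \<and> z \<in>\<^sub>M R \<and> e \<in>\<^sub>M R \<and> z \<noteq> e \<and>
     (\<forall>x y w. x \<in>\<^sub>M R \<longrightarrow> y \<in>\<^sub>M R \<longrightarrow> w \<in>\<^sub>M R \<longrightarrow>
        app2 pl (app2 pl x y) w = app2 pl x (app2 pl y w) \<and>
        app2 ml (app2 ml x y) w = app2 ml x (app2 ml y w) \<and>
        app2 ml x (app2 pl y w) = app2 pl (app2 ml x y) (app2 ml x w)) \<and>
     (\<forall>x y. x \<in>\<^sub>M R \<longrightarrow> y \<in>\<^sub>M R \<longrightarrow>
        app2 pl x y = app2 pl y x \<and> app2 ml x y = app2 ml y x) \<and>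
     (\<forall>x. x \<in>\<^sub>M R \<longrightarrow> app2 pl x z = x \<and> app2 ml x e = x) \<and>
     (\<forall>x. x \<in>\<^sub>M R \<longrightarrow> (\<exists>y. y \<in>\<^sub>M R \<and> app2 pl x y = z)) \<and>
     (\<forall>x. x \<in>\<^sub>M R \<longrightarrow> x \<noteq> z \<longrightarrow> (\<exists>y. y \<in>\<^sub>M R \<and> app2 ml x y = e)) \<and>
     strict_linear_order R lt \<and>
     (\<forall>x y w. x \<in>\<^sub>M R \<longrightarrow> y \<in>\<^sub>M R \<longrightarrow> w \<in>\<^sub>M R \<longrightarrow>
        rel lt x y \<longrightarrow> rel lt (app2 pl x w) (app2 pl y w)) \<and>
     (\<forall>x y. x \<in>\<^sub>M R \<longrightarrow> y \<in>\<^sub>M R \<longrightarrow> rel lt z x \<longrightarrow> rel lt z y \<longrightarrow> rel lt z (app2 ml x y)) \<and>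
     (\<forall>S. S \<subseteq>\<^sub>M R \<longrightarrow> (\<exists>x. x \<in>\<^sub>M S) \<longrightarrow>
        (\<exists>b. b \<in>\<^sub>M R \<and> (\<forall>x. x \<in>\<^sub>M S \<longrightarrow> \<not> rel lt b x)) \<longrightarrow>
        (\<exists>l. l \<in>\<^sub>M R \<and> (\<forall>x. x \<in>\<^sub>M S \<longrightarrow> \<not> rel lt l x) \<and>
           (\<forall>b. b \<in>\<^sub>M R \<longrightarrow> (\<forall>x. x \<in>\<^sub>M S \<longrightarrow> \<not> rel lt b x) \<longrightarrow> \<not> rel lt b l)))"

text \<open>The ordered set of reals of the model, as usual determined up to isomorphism.\<close>

definition real_line :: "'a \<Rightarrow> 'a \<Rightarrow> bool" where
  "real_line R lt \<longleftrightarrow> (\<exists>pl ml z e. complete_ordered_field R lt pl ml z e)"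

text \<open>Topological notions refer to the base of open intervals.\<close>

definition in_interval :: "'a \<Rightarrow> 'a \<Rightarrow> 'a \<Rightarrow> 'a \<Rightarrow> bool" where
  "in_interval lt a b x \<longleftrightarrow> rel lt a x \<and> rel lt x b"

definition closed_set :: "'a \<Rightarrow> 'a \<Rightarrow> 'a \<Rightarrow> bool" where
  "closed_set R lt C \<longleftrightarrow> C \<subseteq>\<^sub>M R \<and>
     (\<forall>x. x \<in>\<^sub>M R \<longrightarrow> \<not> x \<in>\<^sub>M C \<longrightarrow>
        (\<exists>a b. a \<in>\<^sub>M R \<and> b \<in>\<^sub>M R \<and> in_interval lt a b x \<and>
           (\<forall>y. y \<in>\<^sub>M C \<longrightarrow> \<not> in_interval lt a b y)))"

definition isolated_point :: "'a \<Rightarrow> 'a \<Rightarrow> 'a \<Rightarrow> 'a \<Rightarrow> bool" where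
  "isolated_point R lt P x \<longleftrightarrow> x \<in>\<^sub>M P \<and>
     (\<exists>a b. a \<in>\<^sub>M R \<and> b \<in>\<^sub>M R \<and> in_interval lt a b x \<and>
        (\<forall>y. y \<in>\<^sub>M P \<longrightarrow> in_interval lt a b y \<longrightarrow> y = x))"

definition perfect_set :: "'a \<Rightarrow> 'a \<Rightarrow> 'a \<Rightarrow> bool" where
  "perfect_set R lt P \<longleftrightarrow> closed_set R lt P \<and> \<not> (\<exists>x. isolated_point R lt P x)"

definition perfect_set_property :: "'a \<Rightarrow> 'a \<Rightarrow> 'a \<Rightarrow> bool" where
  "perfect_set_property R lt A \<longleftrightarrow> countable_set A \<or>
     (\<exists>P. perfect_set R lt P \<and> (\<exists>x. x \<in>\<^sub>M P) \<and> P \<subseteq>\<^sub>M A)"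

text \<open>The three statements about the reals that are compared.\<close>

definition no_uncountable_partition :: "'a \<Rightarrow> 'a \<Rightarrow> bool" where
  "no_uncountable_partition R lt \<longleftrightarrow>
     (\<forall>L s. strict_linear_order L s \<longrightarrow> \<not> countable_set L \<longrightarrow> \<not> arrows R lt L s)"

definition all_infinite_inexact :: "'a \<Rightarrow> 'a \<Rightarrow> bool" where
  "all_infinite_inexact R lt \<longleftrightarrow>
     (\<forall>X. X \<subseteq>\<^sub>M R \<longrightarrow> \<not> finite_set X \<longrightarrow> inexact X lt)"

definition all_perfect_set_property :: "'a \<Rightarrow> 'a \<Rightarrow> bool" where
  "all_perfect_set_property R lt \<longleftrightarrow> (\<forall>A. A \<subseteq>\<^sub>M R \<longrightarrow> perfect_set_property R lt A)"

end

end

theory Submission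
  imports Defs
begin

text \<open>
  If \<open>X\<close> is exact, then \<open>X\<close> is the only subset of \<open>X\<close> of the type of \<open>X\<close>, so the partition
  relation holds trivially for that type. An infinite exact set of reals would have such a type, and
  an uncountable one, because a countable infinite linear order either can be shifted along a set of
  immediate successors or predecessors, or embeds into a densely ordered part of itself.

  Conversely, let all infinite sets of reals be inexact. A nontrivial order-preserving map of \<open>Z\<close> to
  itself yields a copy of \<open>Z\<close> inside \<open>Z\<close> that vacates a rational interval which meets \<open>Z\<close>. Let
  \<open>i(Z)\<close> be the first interval, in a fixed enumeration, that can be vacated in this way. Passing to a
  copy that vacates it strictly increases \<open>i\<close>. An uncountable \<open>Y\<close> is cut by some rational into two
  infinite parts; take the first such rational and colour \<open>Y\<close> according to whether the index of the
  left part is smaller than that of the right part. Inside any \<open>H\<close>, each of the two indices can be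
  raised above the other one, so both colours occur.

  If \<open>X\<close> contains a nonempty perfect set, then the whole line embeds into a proper part of that set.
\<close>

section \<open>Definable predicates\<close>

text \<open>Two constraints shape the proof. The separation schema covers only first-order formulas,
  and the numbers of the model may be nonstandard; so an induction, a least element or a
  comprehension is available only for a predicate shown to be definable, and every construction
  comes with such a proof. And there is no choice: whatever has to be collected into one function is
  made unique by taking the first candidate in an enumeration, while arbitrary copies of a set are
  picked only inside existential statements, one at a time.

  The index \<open>i(Z)\<close> never drops on passing to a copy, because a copy inside a copy of
  \<open>Z\<close> is again a copy of \<open>Z\<close>; and it cannot stay, because the copy no
  longer meets the vacated interval. How far it jumps is beyond control, so no colour can be read
  off its value alone. Two indices that can be raised independently avoid this: only their
  comparison matters, and either one can be made to overtake the other. The two infinite parts of a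
  set serve to provide these two indices.\<close>

primrec rename :: "(nat \<Rightarrow> nat) \<Rightarrow> fm \<Rightarrow> fm" where
  "rename r (Member i j) = Member (r i) (r j)"
| "rename r (Equal i j) = Equal (r i) (r j)"
| "rename r (Neg \<phi>) = Neg (rename r \<phi>)"
| "rename r (Conj \<phi> \<psi>) = Conj (rename r \<phi>) (rename r \<psi>)"
| "rename r (Exists i \<phi>) = Exists (r i) (rename r \<phi>)"

text \<open>Injectivity of \<open>r\<close> keeps distinct variables distinct, so an update at a
  bound variable commutes with the renaming and nothing is captured.\<close>

lemma sat_rename:
  assumes "inj r"
  shows "sat mem \<rho> (rename r \<phi>) \<longleftrightarrow> sat mem (\<lambda>n. \<rho> (r n)) \<phi>"
proof (induction \<phi> arbitrary: \<rho>)
  case (Exists i \<phi>)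
  have "(\<lambda>n. (\<rho>(r i := x)) (r n)) = (\<lambda>n. \<rho> (r n))(i := x)" for x
    using assms by (auto simp: fun_eq_iff inj_eq)
  then show ?case using Exists by simp
qed auto

text \<open>Even positions carry the variables and odd positions the parameters, so both supplies
  stay infinite and either can be renumbered without touching the other.\<close>

definition mix :: "(nat \<Rightarrow> 'a) \<Rightarrow> (nat \<Rightarrow> 'a) \<Rightarrow> nat \<Rightarrow> 'a" where
  "mix \<rho> \<sigma> n = (if even n then \<rho> (n div 2) else \<sigma> (n div 2))"

context ZF_model
begin

text \<open>
  Environments are read as de Bruijn stacks, and \<open>\<sigma>\<close> holds the parameters. The closure rules are
  stated so that they apply to a goal by higher-order pattern unification; proving that a predicate
  is definable then amounts to resolving with them.
\<close>

definition dfn :: "((nat \<Rightarrow> 'a) \<Rightarrow> bool) \<Rightarrow> bool" where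
  "dfn P \<longleftrightarrow> (\<exists>\<phi> \<sigma>. \<forall>\<rho>. P \<rho> \<longleftrightarrow> sat mem (mix \<rho> \<sigma>) \<phi>)"

text \<open>Formulas have no function symbols, so a term is definable through its graph: slot 0
  holds the value and the arguments move up by one.\<close>

definition dft :: "((nat \<Rightarrow> 'a) \<Rightarrow> 'a) \<Rightarrow> bool" where
  "dft t \<longleftrightarrow> dfn (\<lambda>\<rho>. \<rho> 0 = t (\<lambda>i. \<rho> (Suc i)))"

lemma dfn_reindex:
  assumes "dfn P" and r: "inj r"
  shows "dfn (\<lambda>\<rho>. P (\<lambda>i. \<rho> (r i)))"
proof -
  obtain \<phi> \<sigma> where *: "\<And>\<rho>. P \<rho> \<longleftrightarrow> sat mem (mix \<rho> \<sigma>) \<phi>"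
    using assms(1) unfolding dfn_def by blast
  \<comment> \<open>\<open>q\<close> acts as \<open>r\<close> on the variable positions and fixes
    the parameter positions.\<close>
  define q where "q n = (if even n then 2 * r (n div 2) else n)" for n
  have "inj q"
  proof (rule injI)
    fix m n assume *: "q m = q n"
    have "even m \<longleftrightarrow> even n"
      using arg_cong[OF *, of even] by (simp add: q_def split: if_splits)
    moreover have "m div 2 = n div 2" if "even m" "even n"
      using * that r by (simp add: q_def inj_eq)
    ultimately show "m = n"
      using * by (cases "even m") (auto simp: q_def dest: dvd_div_eq_cancel)
  qed
  moreover have "mix (\<lambda>i. \<rho> (r i)) \<sigma> = (\<lambda>n. mix \<rho> \<sigma> (q n))" for \<rho>
    by (auto simp: fun_eq_iff mix_def q_def)
  ultimately have "P (\<lambda>i. \<rho> (r i)) \<longleftrightarrow> sat mem (mix \<rho> \<sigma>) (rename q \<phi>)" for \<rho>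
    by (simp add: * sat_rename)
  then show ?thesis unfolding dfn_def by blast
qed

lemma dfn_const: "dfn (\<lambda>\<rho>. b)"
proof (cases b)
  case True
  then show ?thesis unfolding dfn_def
    by (intro exI[of _ "Equal 0 0"] exI[of _ undefined]) simp
next
  case False
  then show ?thesis unfolding dfn_def
    by (intro exI[of _ "Neg (Equal 0 0)"] exI[of _ undefined]) simp
qed

lemma dfn_mem_var: "dfn (\<lambda>\<rho>. \<rho> i \<in>\<^sub>M \<rho> j)"
  unfolding dfn_def
  by (intro exI[of _ "Member (2 * i) (2 * j)"] exI[of _ undefined]) (simp add: mix_def)

lemma dft_const: "dft (\<lambda>\<rho>. c)"
  unfolding dft_def dfn_def
  by (intro exI[of _ "Equal 0 1"] exI[of _ "\<lambda>_. c"]) (simp add: mix_def)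

lemma dft_var: "dft (\<lambda>\<rho>. \<rho> i)"
  unfolding dft_def dfn_def
  by (intro exI[of _ "Equal 0 (2 * Suc i)"] exI[of _ undefined]) (simp add: mix_def)

lemma dfn_not: "dfn P \<Longrightarrow> dfn (\<lambda>\<rho>. \<not> P \<rho>)"
  unfolding dfn_def by (elim exE, rule_tac x = "Neg \<phi>" in exI, rule_tac x = \<sigma> in exI) simp

lemma dfn_conj:
  assumes "dfn P" "dfn Q"
  shows "dfn (\<lambda>\<rho>. P \<rho> \<and> Q \<rho>)"
proof -
  obtain \<phi> \<sigma> where *: "\<And>\<rho>. P \<rho> \<longleftrightarrow> sat mem (mix \<rho> \<sigma>) \<phi>"
    using assms(1) unfolding dfn_def by blast
  obtain \<psi> \<tau> where **: "\<And>\<rho>. Q \<rho> \<longleftrightarrow> sat mem (mix \<rho> \<tau>) \<psi>"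
    using assms(2) unfolding dfn_def by blast
  \<comment> \<open>In the merged parameter list, parameter \<open>k\<close> of the first formula
    sits in slot \<open>2 * k\<close> and that of the second in slot \<open>2 * k + 1\<close>;
    \<open>p\<close> and \<open>q\<close> express this in positions of the interleaved
    environment.\<close>
  define p :: "nat \<Rightarrow> nat" where "p n = (if even n then n else 2 * n - 1)" for n
  define q :: "nat \<Rightarrow> nat" where "q n = (if even n then n else 2 * n + 1)" for n
  have inj: "inj p" "inj q"
    by (auto intro!: injI simp: p_def q_def split: if_splits elim!: oddE; presburger)+
  have "mix \<rho> \<sigma> n = mix \<rho> (mix \<sigma> \<tau>) (p n) \<and> mix \<rho> \<tau> n = mix \<rho> (mix \<sigma> \<tau>) (q n)" for \<rho> n
  proof (cases "even n")
    case True
    then show ?thesis by (simp add: mix_def p_def q_def)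
  next
    case False
    then obtain k where n: "n = 2 * k + 1" by (elim oddE)
    then have "p n = 2 * (2 * k) + 1" "q n = 2 * (2 * k + 1) + 1" by (simp_all add: p_def q_def)
    then show ?thesis using n by (simp add: mix_def)
  qed
  then have "(\<lambda>n. mix \<rho> (mix \<sigma> \<tau>) (p n)) = mix \<rho> \<sigma>"
    "(\<lambda>n. mix \<rho> (mix \<sigma> \<tau>) (q n)) = mix \<rho> \<tau>" for \<rho>
    by auto
  then have "P \<rho> \<and> Q \<rho> \<longleftrightarrow> sat mem (mix \<rho> (mix \<sigma> \<tau>)) (Conj (rename p \<phi>) (rename q \<psi>))" for \<rho>
    by (simp add: * ** sat_rename inj)
  then show ?thesis unfolding dfn_def by blast
qed

text \<open>The quantified variable is moved to a fresh parameter slot, where it cannot be captured.\<close>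

lemma dfn_ex:
  assumes "dfn (\<lambda>\<rho>. P (\<lambda>i. \<rho> (Suc i)) (\<rho> 0))"
  shows "dfn (\<lambda>\<rho>. \<exists>x. P \<rho> x)"
proof -
  obtain \<phi> \<sigma> where *: "\<And>\<rho>. P (\<lambda>i. \<rho> (Suc i)) (\<rho> 0) \<longleftrightarrow> sat mem (mix \<rho> \<sigma>) \<phi>"
    using assms unfolding dfn_def by blast
  \<comment> \<open>Variable 0 goes to position 1, the fresh slot; the other variables lose one
    index and the old parameters gain one.\<close>
  define q :: "nat \<Rightarrow> nat" where
    "q n = (if n = 0 then 1 else if even n then n - 2 else n + 2)" for n
  have q: "inj q"
    by (rule injI) (auto simp: q_def split: if_splits elim!: evenE oddE; presburger)
  define \<sigma>' where "\<sigma>' = case_nat undefined \<sigma>"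
  have "(\<lambda>n. ((mix \<rho> \<sigma>')(1 := x)) (q n)) = mix (case_nat x \<rho>) \<sigma>" for \<rho> x
  proof
    fix n
    consider "n = 0" | k where "n = 2 * Suc k" | k where "n = 2 * k + 1"
      by (metis evenE oddE not0_implies_Suc mult_0_right)
    then show "((mix \<rho> \<sigma>')(1 := x)) (q n) = mix (case_nat x \<rho>) \<sigma> n"
      by cases (auto simp: mix_def q_def \<sigma>'_def)
  qed
  then have "(\<exists>x. P \<rho> x) \<longleftrightarrow> sat mem (mix \<rho> \<sigma>') (Exists 1 (rename q \<phi>))" for \<rho>
    using *[of "case_nat _ \<rho>"] by (simp add: sat_rename[OF q])
  then show ?thesis unfolding dfn_def by blast
qed

lemma dfn_disj: "dfn P \<Longrightarrow> dfn Q \<Longrightarrow> dfn (\<lambda>\<rho>. P \<rho> \<or> Q \<rho>)"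
  using dfn_not[OF dfn_conj[OF dfn_not dfn_not], of P Q] by simp

lemma dfn_imp: "dfn P \<Longrightarrow> dfn Q \<Longrightarrow> dfn (\<lambda>\<rho>. P \<rho> \<longrightarrow> Q \<rho>)"
  using dfn_disj[OF dfn_not[of P], of Q] by (simp only: imp_conv_disj)

lemma dfn_iff: "dfn P \<Longrightarrow> dfn Q \<Longrightarrow> dfn (\<lambda>\<rho>. P \<rho> \<longleftrightarrow> Q \<rho>)"
  using dfn_conj[OF dfn_imp dfn_imp, of P Q Q P] by (simp only: iff_conv_conj_imp[symmetric])

lemma dfn_all: "dfn (\<lambda>\<rho>. P (\<lambda>i. \<rho> (Suc i)) (\<rho> 0)) \<Longrightarrow> dfn (\<lambda>\<rho>. \<forall>x. P \<rho> x)"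
  using dfn_not[OF dfn_ex[of "\<lambda>\<rho> x. \<not> P \<rho> x"]] dfn_not by simp

text \<open>A term is substituted by quantifying over its value, which stays within
  formulas.\<close>

lemma dfn_subst:
  assumes "dft t" "dfn (\<lambda>\<rho>. P (\<lambda>i. \<rho> (Suc i)) (\<rho> 0))"
  shows "dfn (\<lambda>\<rho>. P \<rho> (t \<rho>))"
proof -
  have "dfn (\<lambda>\<rho>. \<exists>x. x = t \<rho> \<and> P \<rho> x)"
    using assms unfolding dft_def by (intro dfn_ex dfn_conj)
  then show ?thesis by simp
qed

lemma dft_shift: "dft t \<Longrightarrow> dft (\<lambda>\<rho>. t (\<lambda>i. \<rho> (Suc i)))"
  unfolding dft_def
  using dfn_reindex[of "\<lambda>\<rho>. \<rho> 0 = t (\<lambda>i. \<rho> (Suc i))" "case_nat 0 (\<lambda>n. Suc (Suc n))"]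
  by (simp add: inj_def split: nat.split)

lemma dfn1:
  assumes "dfn (\<lambda>\<rho>. P (\<rho> 0))" "dft t"
  shows "dfn (\<lambda>\<rho>. P (t \<rho>))"
  by (rule dfn_subst[OF assms(2)]) (rule assms(1))

text \<open>Terms are substituted from last to first; a term substituted later must skip the slot of
  a value introduced earlier, hence \<open>dft_shift\<close>.\<close>

lemma dfn2:
  assumes "dfn (\<lambda>\<rho>. P (\<rho> 0) (\<rho> 1))" "dft t" "dft u"
  shows "dfn (\<lambda>\<rho>. P (t \<rho>) (u \<rho>))"
proof (rule dfn_subst[OF assms(3)], rule dfn_subst[OF dft_shift[OF assms(2)]])
  show "dfn (\<lambda>\<rho>. P (\<rho> 0) (\<rho> (Suc 0)))" using assms(1) by simp
qed

lemma dfn3: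
  assumes "dfn (\<lambda>\<rho>. P (\<rho> 0) (\<rho> 1) (\<rho> 2))" "dft t" "dft u" "dft v"
  shows "dfn (\<lambda>\<rho>. P (t \<rho>) (u \<rho>) (v \<rho>))"
proof (rule dfn_subst[OF assms(4)], rule dfn_subst[OF dft_shift[OF assms(3)]],
    rule dfn_subst[OF dft_shift[OF dft_shift[OF assms(2)]]])
  show "dfn (\<lambda>\<rho>. P (\<rho> 0) (\<rho> (Suc 0)) (\<rho> (Suc (Suc 0))))" using assms(1) by (simp add: numeral_2_eq_2)
qed

lemma dfn4:
  assumes "dfn (\<lambda>\<rho>. P (\<rho> 0) (\<rho> 1) (\<rho> 2) (\<rho> 3))" "dft t" "dft u" "dft v" "dft w"
  shows "dfn (\<lambda>\<rho>. P (t \<rho>) (u \<rho>) (v \<rho>) (w \<rho>))"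
proof (rule dfn_subst[OF assms(5)], rule dfn_subst[OF dft_shift[OF assms(4)]],
    rule dfn_subst[OF dft_shift[OF dft_shift[OF assms(3)]]],
    rule dfn_subst[OF dft_shift[OF dft_shift[OF dft_shift[OF assms(2)]]]])
  show "dfn (\<lambda>\<rho>. P (\<rho> 0) (\<rho> (Suc 0)) (\<rho> (Suc (Suc 0))) (\<rho> (Suc (Suc (Suc 0)))))"
    using assms(1) by (simp add: numeral_2_eq_2 numeral_3_eq_3)
qed

lemma dfn_mem: "dft t \<Longrightarrow> dft u \<Longrightarrow> dfn (\<lambda>\<rho>. t \<rho> \<in>\<^sub>M u \<rho>)"
  by (rule dfn2) (rule dfn_mem_var)

lemma dfn_eq: "dft t \<Longrightarrow> dft u \<Longrightarrow> dfn (\<lambda>\<rho>. t \<rho> = u \<rho>)"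
proof (rule dfn2)
  have "dfn (\<lambda>\<rho>. \<forall>z. z \<in>\<^sub>M \<rho> 0 \<longleftrightarrow> z \<in>\<^sub>M \<rho> 1)"
    by (intro dfn_all dfn_iff dfn_mem_var)
  moreover have "(\<forall>z. z \<in>\<^sub>M x \<longleftrightarrow> z \<in>\<^sub>M y) \<longleftrightarrow> x = y" for x y
    using extensionality by blast
  ultimately show "dfn (\<lambda>\<rho>. \<rho> 0 = \<rho> 1)" by simp
qed

lemma dfn_ex1:
  assumes "dfn (\<lambda>\<rho>. P (\<lambda>i. \<rho> (Suc i)) (\<rho> 0))"
  shows "dfn (\<lambda>\<rho>. \<exists>!x. P \<rho> x)"
proof -
  have "dfn (\<lambda>\<rho>. P (\<lambda>i. \<rho> (Suc (Suc i))) (\<rho> 0))"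
    using dfn_reindex[OF assms, of "case_nat 0 (\<lambda>n. Suc (Suc n))"]
    by (simp add: inj_def split: nat.split)
  then have "dfn (\<lambda>\<rho>. \<exists>x. P \<rho> x \<and> (\<forall>y. P \<rho> y \<longrightarrow> y = x))"
    by (intro dfn_ex dfn_all dfn_conj dfn_imp dfn_eq dft_var assms)
  then show ?thesis unfolding Ex1_def .
qed

lemmas dfn_basic = dfn_const dft_const dft_var dfn_not dfn_conj dfn_disj dfn_imp dfn_iff dfn_ex
  dfn_all dfn_ex1 dfn_mem dfn_eq

text \<open>By extensionality \<open>t \<rho>\<close> is the only set with these elements, so having
  them is a first-order description of its graph.\<close>

lemma dft_extension:
  assumes "\<And>\<rho> x. x \<in>\<^sub>M t \<rho> \<longleftrightarrow> P \<rho> x"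
    and "dfn (\<lambda>\<rho>. P (\<lambda>i. \<rho> (Suc i)) (\<rho> 0))"
  shows "dft t"
proof -
  have "dfn (\<lambda>\<rho>. P (\<lambda>i. \<rho> (Suc (Suc i))) (\<rho> 0))"
    using dfn_reindex[OF assms(2), of "case_nat 0 (\<lambda>n. Suc (Suc n))"]
    by (simp add: inj_def split: nat.split)
  then have "dfn (\<lambda>\<rho>. \<forall>x. x \<in>\<^sub>M \<rho> 0 \<longleftrightarrow> P (\<lambda>i. \<rho> (Suc i)) x)"
    by (intro dfn_all dfn_iff dfn_mem dft_var)
  moreover have "(\<forall>x. x \<in>\<^sub>M z \<longleftrightarrow> P \<rho> x) \<longleftrightarrow> z = t \<rho>" for z \<rho>
    using extensionality assms(1) by metis
  ultimately show ?thesis unfolding dft_def by simp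
qed

text \<open>Updating variable 0 of an interleaved environment gives an interleaved environment, so
  the schema applies directly.\<close>

lemma separation_dfn:
  assumes "dfn (\<lambda>\<rho>. P (\<rho> 0))"
  shows "\<exists>b. \<forall>x. x \<in>\<^sub>M b \<longleftrightarrow> x \<in>\<^sub>M a \<and> P x"
proof -
  obtain \<phi> \<sigma> where *: "\<And>\<rho>. P (\<rho> 0) \<longleftrightarrow> sat mem (mix \<rho> \<sigma>) \<phi>"
    using assms unfolding dfn_def by blast
  have "(mix undefined \<sigma>)(0 := x) = mix (undefined(0 := x)) \<sigma>" for x
    by (auto simp: mix_def fun_eq_iff elim!: evenE)
  then have "P x \<longleftrightarrow> sat mem ((mix undefined \<sigma>)(0 := x)) \<phi>" for x
    using *[of "undefined(0 := x)"] by simp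
  then show ?thesis using separation by simp
qed

lemma mem_setofI:
  assumes "\<exists>s. \<forall>x. x \<in>\<^sub>M s \<longleftrightarrow> P x"
  shows "x \<in>\<^sub>M setof P \<longleftrightarrow> P x"
proof -
  obtain s where s: "\<forall>x. x \<in>\<^sub>M s \<longleftrightarrow> P x" using assms ..
  then have "setof P = s" unfolding setof_def using extensionality by (intro the_equality) metis+
  then show ?thesis using s by simp
qed

lemma setI: "(\<And>z. z \<in>\<^sub>M x \<longleftrightarrow> z \<in>\<^sub>M y) \<Longrightarrow> x = y"
  using extensionality by blast

text \<open>All variables but one are frozen to the values \<open>\<rho>\<close> and join the
  parameters: apart from position 0, \<open>q\<close> reads the whole old environment from the new
  parameter list. This serves separation by predicates that depend on further variables, as in
  \<open>dft_sep\<close>.\<close>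

lemma dfn_fix:
  assumes "dfn (\<lambda>\<rho>. P (\<lambda>i. \<rho> (Suc i)) (\<rho> 0))"
  shows "dfn (\<lambda>\<tau>. P \<rho> (\<tau> 0))"
proof -
  obtain \<phi> \<sigma> where *: "\<And>\<rho>. P (\<lambda>i. \<rho> (Suc i)) (\<rho> 0) \<longleftrightarrow> sat mem (mix \<rho> \<sigma>) \<phi>"
    using assms unfolding dfn_def by blast
  define q :: "nat \<Rightarrow> nat" where "q n = (if n = 0 then 0 else 2 * n + 1)" for n
  have q: "inj q" by (auto intro!: injI simp: q_def split: if_splits)
  have "(\<lambda>n. mix \<tau> (mix (case_nat undefined \<rho>) \<sigma>) (q n)) = mix (case_nat (\<tau> 0) \<rho>) \<sigma>" for \<tau>
    by (rule ext) (auto simp: mix_def q_def split: nat.split elim!: evenE)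
  then have "P \<rho> (\<tau> 0) \<longleftrightarrow> sat mem (mix \<tau> (mix (case_nat undefined \<rho>) \<sigma>)) (rename q \<phi>)" for \<tau>
    using *[of "case_nat (\<tau> 0) \<rho>"] by (simp add: sat_rename[OF q])
  then show ?thesis unfolding dfn_def by blast
qed

lemma dft1:
  assumes "dft (\<lambda>\<rho>. F (\<rho> 0))" "dft t"
  shows "dft (\<lambda>\<rho>. F (t \<rho>))"
  unfolding dft_def
  by (rule dfn2[of "\<lambda>z x. z = F x"])
    (use assms dft_var dft_shift in \<open>auto simp: dft_def\<close>)

lemma dft2:
  assumes "dft (\<lambda>\<rho>. F (\<rho> 0) (\<rho> 1))" "dft t" "dft u"
  shows "dft (\<lambda>\<rho>. F (t \<rho>) (u \<rho>))"
  unfolding dft_def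
  by (rule dfn3[of "\<lambda>z x y. z = F x y"])
    (use assms dft_var dft_shift in \<open>auto simp: dft_def numeral_2_eq_2\<close>)

lemma dft_if:
  assumes "dfn P" "dft t" "dft u"
  shows "dft (\<lambda>\<rho>. if P \<rho> then t \<rho> else u \<rho>)"
proof -
  have *: "dfn (\<lambda>\<rho>. P (\<lambda>i. \<rho> (Suc i)))"
    using dfn_reindex[OF assms(1), of Suc] by simp
  have "dfn (\<lambda>\<rho>. (P (\<lambda>i. \<rho> (Suc i)) \<and> \<rho> 0 = t (\<lambda>i. \<rho> (Suc i))) \<or>
      (\<not> P (\<lambda>i. \<rho> (Suc i)) \<and> \<rho> 0 = u (\<lambda>i. \<rho> (Suc i))))"
    using assms(2,3) unfolding dft_def by (intro dfn_disj dfn_conj dfn_not *)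
  then show ?thesis unfolding dft_def by (rule back_subst[of dfn]) auto
qed

text \<open>A term for every \<open>P\<close>, so that it can be nested and shown definable; the
  intended elements are guaranteed only for definable \<open>P\<close>.\<close>

definition sep :: "'a \<Rightarrow> ('a \<Rightarrow> bool) \<Rightarrow> 'a" where
  "sep A P = setof (\<lambda>x. x \<in>\<^sub>M A \<and> P x)"

lemma mem_sep: "dfn (\<lambda>\<rho>. P (\<rho> 0)) \<Longrightarrow> x \<in>\<^sub>M sep A P \<longleftrightarrow> x \<in>\<^sub>M A \<and> P x"
  unfolding sep_def by (rule mem_setofI) (rule separation_dfn)

lemma dft_sep:
  assumes "dft t" "dfn (\<lambda>\<rho>. P (\<lambda>i. \<rho> (Suc i)) (\<rho> 0))"
  shows "dft (\<lambda>\<rho>. sep (t \<rho>) (P \<rho>))"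
proof (rule dft_extension)
  show "x \<in>\<^sub>M sep (t \<rho>) (P \<rho>) \<longleftrightarrow> x \<in>\<^sub>M t \<rho> \<and> P \<rho> x" for \<rho> x
    by (rule mem_sep) (rule dfn_fix[OF assms(2)])
  show "dfn (\<lambda>\<rho>. \<rho> 0 \<in>\<^sub>M t (\<lambda>i. \<rho> (Suc i)) \<and> P (\<lambda>i. \<rho> (Suc i)) (\<rho> 0))"
    by (intro dfn_conj dfn_mem dft_var dft_shift assms)
qed

section \<open>Basic set theory\<close>

lemma not_mem_empty [simp]: "\<not> x \<in>\<^sub>M empty_set"
  unfolding empty_set_def using mem_setofI[of "\<lambda>x. False"] separation_dfn[OF dfn_const, of _ False]
  by simp

lemma mem_upair [simp]: "w \<in>\<^sub>M upair x y \<longleftrightarrow> w = x \<or> w = y"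
  unfolding upair_def by (rule mem_setofI) (rule pairing)

definition bigun :: "'a \<Rightarrow> 'a" where
  "bigun x = setof (\<lambda>w. \<exists>y. y \<in>\<^sub>M x \<and> w \<in>\<^sub>M y)"

lemma mem_bigun [simp]: "w \<in>\<^sub>M bigun x \<longleftrightarrow> (\<exists>y. y \<in>\<^sub>M x \<and> w \<in>\<^sub>M y)"
  unfolding bigun_def by (rule mem_setofI) (rule union)

definition un :: "'a \<Rightarrow> 'a \<Rightarrow> 'a" where
  "un x y = bigun (upair x y)"

lemma mem_un [simp]: "w \<in>\<^sub>M un x y \<longleftrightarrow> w \<in>\<^sub>M x \<or> w \<in>\<^sub>M y"
  unfolding un_def by auto

definition pow :: "'a \<Rightarrow> 'a" where
  "pow x = setof (\<lambda>w. w \<subseteq>\<^sub>M x)"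

lemma mem_pow [simp]: "w \<in>\<^sub>M pow x \<longleftrightarrow> w \<subseteq>\<^sub>M x"
  unfolding pow_def by (rule mem_setofI) (use powerset in \<open>simp add: subset_of_def\<close>)

lemma mem_succ [simp]: "w \<in>\<^sub>M succ x \<longleftrightarrow> w \<in>\<^sub>M x \<or> w = x"
  unfolding succ_def by (rule mem_setofI) (rule exI[of _ "un x (upair x x)"], simp)

lemma upair_eq_iff: "upair x y = upair a b \<longleftrightarrow> x = a \<and> y = b \<or> x = b \<and> y = a"
proof
  assume *: "upair x y = upair a b"
  have "w = x \<or> w = y \<longleftrightarrow> w = a \<or> w = b" for w
    using mem_upair[of w x y] mem_upair[of w a b] * by simp
  then show "x = a \<and> y = b \<or> x = b \<and> y = a" by metis
qed (auto intro: setI)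

lemma opair_eq_iff [simp]: "opair x y = opair a b \<longleftrightarrow> x = a \<and> y = b"
  unfolding opair_def by (auto simp: upair_eq_iff)

lemma subset_ofI: "(\<And>x. x \<in>\<^sub>M A \<Longrightarrow> x \<in>\<^sub>M B) \<Longrightarrow> A \<subseteq>\<^sub>M B"
  unfolding subset_of_def by blast

lemma subset_ofD: "A \<subseteq>\<^sub>M B \<Longrightarrow> x \<in>\<^sub>M A \<Longrightarrow> x \<in>\<^sub>M B"
  unfolding subset_of_def by blast

lemma dft_upair: "dft t \<Longrightarrow> dft u \<Longrightarrow> dft (\<lambda>\<rho>. upair (t \<rho>) (u \<rho>))"
  by (rule dft2, rule dft_extension[OF mem_upair]) (intro dfn_basic)

lemma dft_opair: "dft t \<Longrightarrow> dft u \<Longrightarrow> dft (\<lambda>\<rho>. opair (t \<rho>) (u \<rho>))"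
  unfolding opair_def by (intro dft_upair)

lemma dft_bigun: "dft t \<Longrightarrow> dft (\<lambda>\<rho>. bigun (t \<rho>))"
  by (rule dft1, rule dft_extension[OF mem_bigun]) (intro dfn_basic)

lemma dft_un: "dft t \<Longrightarrow> dft u \<Longrightarrow> dft (\<lambda>\<rho>. un (t \<rho>) (u \<rho>))"
  unfolding un_def by (intro dft_upair dft_bigun)

lemma dft_succ: "dft t \<Longrightarrow> dft (\<lambda>\<rho>. succ (t \<rho>))"
  by (rule dft1, rule dft_extension[OF mem_succ]) (intro dfn_basic)

lemma dfn_subset: "dft t \<Longrightarrow> dft u \<Longrightarrow> dfn (\<lambda>\<rho>. t \<rho> \<subseteq>\<^sub>M u \<rho>)"
  by (rule dfn2) (unfold subset_of_def, intro dfn_basic)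

lemma mem_cprod: "p \<in>\<^sub>M cprod A B \<longleftrightarrow> (\<exists>x y. x \<in>\<^sub>M A \<and> y \<in>\<^sub>M B \<and> p = opair x y)"
  unfolding cprod_def
proof (rule mem_setofI)
  let ?P = "\<lambda>p. \<exists>x y. x \<in>\<^sub>M A \<and> y \<in>\<^sub>M B \<and> p = opair x y"
  have "dfn (\<lambda>\<rho>. ?P (\<rho> 0))" by (intro dfn_basic dft_opair)
  \<comment> \<open>A Kuratowski pair is a set of subsets of \<open>un A B\<close>, so two power
    sets bound the product.\<close>
  then have "\<exists>b. \<forall>p. p \<in>\<^sub>M b \<longleftrightarrow> p \<in>\<^sub>M pow (pow (un A B)) \<and> ?P p"
    by (rule separation_dfn)
  moreover have "?P p \<Longrightarrow> p \<in>\<^sub>M pow (pow (un A B))" for p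
    by (auto simp: subset_of_def opair_def)
  ultimately show "\<exists>s. \<forall>p. p \<in>\<^sub>M s \<longleftrightarrow> ?P p" by meson
qed

lemma opair_mem_cprod [simp]: "opair x y \<in>\<^sub>M cprod A B \<longleftrightarrow> x \<in>\<^sub>M A \<and> y \<in>\<^sub>M B"
  by (auto simp: mem_cprod)

lemma mem_irrefl: "\<not> x \<in>\<^sub>M x"
  using foundation[of "upair x x"] by auto

lemma dft_cprod: "dft t \<Longrightarrow> dft u \<Longrightarrow> dft (\<lambda>\<rho>. cprod (t \<rho>) (u \<rho>))"
  by (rule dft2, rule dft_extension[OF mem_cprod]) (intro dfn_basic dft_opair)

lemma dfn_rel: "dft r \<Longrightarrow> dft t \<Longrightarrow> dft u \<Longrightarrow> dfn (\<lambda>\<rho>. rel (r \<rho>) (t \<rho>) (u \<rho>))"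
  unfolding rel_def by (intro dfn_basic dft_opair)

subsection \<open>Functions\<close>

text \<open>
  Unlike \<open>app\<close>, whose value outside the domain is an arbitrary element, this version of application
  is definable.
\<close>

definition ap :: "'a \<Rightarrow> 'a \<Rightarrow> 'a"  (infixl \<open>$\<close> 90) where
  "f $ x = bigun (sep (bigun (bigun f)) (\<lambda>y. opair x y \<in>\<^sub>M f))"

lemma dft_ap: "dft f \<Longrightarrow> dft x \<Longrightarrow> dft (\<lambda>\<rho>. f \<rho> $ x \<rho>)"
  by (rule dft2) (unfold ap_def, intro dft_bigun dft_sep dfn_basic dft_opair)

lemma mem_ap: "z \<in>\<^sub>M f $ x \<longleftrightarrow> (\<exists>y. opair x y \<in>\<^sub>M f \<and> z \<in>\<^sub>M y)"
proof -
  have "dfn (\<lambda>\<rho>. opair x (\<rho> 0) \<in>\<^sub>M f)" by (intro dfn_basic dft_opair)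
  then have "y \<in>\<^sub>M sep (bigun (bigun f)) (\<lambda>y. opair x y \<in>\<^sub>M f) \<longleftrightarrow>
      y \<in>\<^sub>M bigun (bigun f) \<and> opair x y \<in>\<^sub>M f" for y
    by (rule mem_sep)
  \<comment> \<open>The Kuratowski pair contains the unordered pair, which contains
    \<open>y\<close>; hence the bound of the separation in \<open>ap\<close> loses no value.\<close>
  moreover have "y \<in>\<^sub>M bigun (bigun f)" if "opair x y \<in>\<^sub>M f" for y
  proof -
    have "upair x y \<in>\<^sub>M bigun f"
      unfolding mem_bigun by (rule exI[of _ "opair x y"]) (simp add: that, simp add: opair_def)
    then show ?thesis unfolding mem_bigun[of y] by (intro exI[of _ "upair x y"]) (simp del: mem_bigun)
  qed
  ultimately show ?thesis unfolding ap_def mem_bigun[of z] by blast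
qed

lemma ap_eqI:
  assumes "opair x y \<in>\<^sub>M f" "\<And>y'. opair x y' \<in>\<^sub>M f \<Longrightarrow> y' = y"
  shows "f $ x = y"
  by (rule setI) (use assms in \<open>metis mem_ap\<close>)

lemma is_function_iff: "is_function f A B \<longleftrightarrow>
    (\<forall>p. p \<in>\<^sub>M f \<longrightarrow> p \<in>\<^sub>M cprod A B) \<and> (\<forall>x. x \<in>\<^sub>M A \<longrightarrow> (\<exists>!y. opair x y \<in>\<^sub>M f))"
  unfolding is_function_def subset_of_def by blast

lemma opair_mem_function:
  assumes "is_function f A B"
  shows "opair x y \<in>\<^sub>M f \<longleftrightarrow> x \<in>\<^sub>M A \<and> y = f $ x"
proof -
  have cp: "p \<in>\<^sub>M f \<Longrightarrow> p \<in>\<^sub>M cprod A B" and ex1: "x \<in>\<^sub>M A \<Longrightarrow> \<exists>!y. opair x y \<in>\<^sub>M f" for p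
    using assms unfolding is_function_iff by blast+
  have dom: "opair x y \<in>\<^sub>M f \<Longrightarrow> x \<in>\<^sub>M A" for y
    using cp[of "opair x y"] by simp
  have *: "opair x y \<in>\<^sub>M f \<Longrightarrow> f $ x = y" for y
    by (rule ap_eqI) (use ex1 dom in blast)+
  show ?thesis
  proof
    assume "opair x y \<in>\<^sub>M f"
    then show "x \<in>\<^sub>M A \<and> y = f $ x" using * dom by simp
  next
    assume **: "x \<in>\<^sub>M A \<and> y = f $ x"
    then obtain y' where "opair x y' \<in>\<^sub>M f" using ex1 by blast
    then show "opair x y \<in>\<^sub>M f" using * ** by simp
  qed
qed

lemma function_ap_mem:
  assumes "is_function f A B" "x \<in>\<^sub>M A"
  shows "f $ x \<in>\<^sub>M B"
proof -
  have "opair x (f $ x) \<in>\<^sub>M f" using assms by (simp add: opair_mem_function)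
  then have "opair x (f $ x) \<in>\<^sub>M cprod A B" using assms(1) unfolding is_function_iff by blast
  then show ?thesis by simp
qed

lemma app_eq_ap: "is_function f A B \<Longrightarrow> x \<in>\<^sub>M A \<Longrightarrow> app f x = f $ x"
  unfolding app_def by (simp add: opair_mem_function)

lemma injection_iff: "injection f A B \<longleftrightarrow> is_function f A B \<and>
    (\<forall>x y. x \<in>\<^sub>M A \<longrightarrow> y \<in>\<^sub>M A \<longrightarrow> f $ x = f $ y \<longrightarrow> x = y)"
  unfolding injection_def by (auto simp: app_eq_ap cong: conj_cong)

lemma bijection_iff: "bijection f A B \<longleftrightarrow> injection f A B \<and>
    (\<forall>y. y \<in>\<^sub>M B \<longrightarrow> (\<exists>x. x \<in>\<^sub>M A \<and> f $ x = y))"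
  unfolding bijection_def injection_iff by (simp add: app_eq_ap cong: conj_cong)

lemma order_isomorphic_iff: "order_isomorphic X r Y s \<longleftrightarrow> (\<exists>f. bijection f X Y \<and>
    (\<forall>x y. x \<in>\<^sub>M X \<longrightarrow> y \<in>\<^sub>M X \<longrightarrow> (rel r x y \<longleftrightarrow> rel s (f $ x) (f $ y))))"
  unfolding order_isomorphic_def bijection_iff injection_iff by (simp add: app_eq_ap cong: conj_cong)

lemma order_preserving_iff: "order_preserving f X r \<longleftrightarrow> is_function f X X \<and>
    (\<forall>x y. x \<in>\<^sub>M X \<longrightarrow> y \<in>\<^sub>M X \<longrightarrow> rel r x y \<longrightarrow> rel r (f $ x) (f $ y))"
  unfolding order_preserving_def by (simp add: app_eq_ap cong: conj_cong)

lemma exact_iff: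
  "exact X r \<longleftrightarrow> (\<forall>f. order_preserving f X r \<longrightarrow> (\<forall>x. x \<in>\<^sub>M X \<longrightarrow> f $ x = x))"
  unfolding exact_def using app_eq_ap[of _ X X] by (simp add: order_preserving_iff)

lemma dfn_function:
  "dft f \<Longrightarrow> dft A \<Longrightarrow> dft B \<Longrightarrow> dfn (\<lambda>\<rho>. is_function (f \<rho>) (A \<rho>) (B \<rho>))"
  by (rule dfn3) (unfold is_function_iff, intro dfn_basic dft_opair dft_cprod)

lemma dfn_injection:
  "dft f \<Longrightarrow> dft A \<Longrightarrow> dft B \<Longrightarrow> dfn (\<lambda>\<rho>. injection (f \<rho>) (A \<rho>) (B \<rho>))"
  by (rule dfn3) (unfold injection_iff, intro dfn_basic dfn_function dft_ap)

lemma dfn_bijection: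
  "dft f \<Longrightarrow> dft A \<Longrightarrow> dft B \<Longrightarrow> dfn (\<lambda>\<rho>. bijection (f \<rho>) (A \<rho>) (B \<rho>))"
  by (rule dfn3) (unfold bijection_iff, intro dfn_basic dfn_injection dft_ap)

lemma dfn_order_isomorphic: "dft X \<Longrightarrow> dft r \<Longrightarrow> dft Y \<Longrightarrow> dft s \<Longrightarrow>
    dfn (\<lambda>\<rho>. order_isomorphic (X \<rho>) (r \<rho>) (Y \<rho>) (s \<rho>))"
  by (rule dfn4) (unfold order_isomorphic_iff, intro dfn_basic dfn_bijection dft_ap dfn_rel)

lemma dfn_finite: "dft t \<Longrightarrow> dfn (\<lambda>\<rho>. finite_set (t \<rho>))"
  by (rule dfn1) (unfold finite_set_def, intro dfn_basic dfn_bijection)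

lemmas dfn_intros = dfn_basic dft_opair dft_upair dft_bigun dft_un dft_succ dft_cprod dft_ap dft_sep dft_if
  dfn_subset dfn_rel dfn_function dfn_injection dfn_bijection dfn_order_isomorphic dfn_finite

text \<open>The graph is separated from the product. Uniqueness of the value stands in for choice,
  which is why relations are later narrowed to a first candidate.\<close>

lemma function_of_relation:
  assumes "\<And>x. x \<in>\<^sub>M A \<Longrightarrow> \<exists>!y. y \<in>\<^sub>M B \<and> Q x y" and "dfn (\<lambda>\<rho>. Q (\<rho> 0) (\<rho> 1))"
  shows "\<exists>f. is_function f A B \<and> (\<forall>x. x \<in>\<^sub>M A \<longrightarrow> Q x (f $ x))"
proof -
  have "dfn (\<lambda>\<rho>. \<exists>x y. \<rho> 0 = opair x y \<and> Q x y)"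
    by (intro dfn_intros dfn2[OF assms(2)])
  then obtain f where f: "\<And>p. p \<in>\<^sub>M f \<longleftrightarrow> p \<in>\<^sub>M cprod A B \<and> (\<exists>x y. p = opair x y \<and> Q x y)"
    using separation_dfn[of "\<lambda>p. \<exists>x y. p = opair x y \<and> Q x y" "cprod A B"] by blast
  have "opair x y \<in>\<^sub>M f \<longleftrightarrow> x \<in>\<^sub>M A \<and> y \<in>\<^sub>M B \<and> Q x y" for x y
    by (simp add: f)
  then have "is_function f A B" unfolding is_function_iff using assms(1) f by simp
  moreover have "Q x (f $ x)" if "x \<in>\<^sub>M A" for x
    using that opair_mem_function[OF calculation, of x "f $ x"] by (simp add: f)
  ultimately show ?thesis by blast
qed

lemma function_of_term:
  assumes "\<And>x. x \<in>\<^sub>M A \<Longrightarrow> F x \<in>\<^sub>M B" and "dft (\<lambda>\<rho>. F (\<rho> 0))"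
  shows "\<exists>f. is_function f A B \<and> (\<forall>x. x \<in>\<^sub>M A \<longrightarrow> f $ x = F x)"
proof (rule function_of_relation[of A B "\<lambda>x y. y = F x"])
  show "dfn (\<lambda>\<rho>. \<rho> 1 = F (\<rho> 0))" by (intro dfn_basic assms(2))
qed (use assms(1) in auto)

lemma function_compose:
  assumes "is_function f A B" "is_function g B C"
  shows "\<exists>h. is_function h A C \<and> (\<forall>x. x \<in>\<^sub>M A \<longrightarrow> h $ x = g $ (f $ x))"
  by (rule function_of_term) (use assms function_ap_mem in blast, intro dfn_intros)

text \<open>Arguments without a value go to the default \<open>c\<close>. This turns a partial
  decoding, such as that of pair codes, into a function on all of \<open>A\<close>.\<close>

lemma function_extending_relation:
  assumes uniq: "\<And>x y y'. x \<in>\<^sub>M A \<Longrightarrow> y \<in>\<^sub>M B \<Longrightarrow> y' \<in>\<^sub>M B \<Longrightarrow> Q x y \<Longrightarrow> Q x y' \<Longrightarrow> y = y'"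
    and Q: "dfn (\<lambda>\<rho>. Q (\<rho> 0) (\<rho> 1))" and c: "c \<in>\<^sub>M B"
  shows "\<exists>f. is_function f A B \<and> (\<forall>x y. x \<in>\<^sub>M A \<longrightarrow> y \<in>\<^sub>M B \<longrightarrow> Q x y \<longrightarrow> f $ x = y)"
proof -
  let ?Q = "\<lambda>x y. Q x y \<or> (\<forall>y'. y' \<in>\<^sub>M B \<longrightarrow> \<not> Q x y') \<and> y = c"
  have "\<exists>!y. y \<in>\<^sub>M B \<and> ?Q x y" if "x \<in>\<^sub>M A" for x
  proof (cases "\<exists>y. y \<in>\<^sub>M B \<and> Q x y")
    case True
    then show ?thesis using uniq[OF that] by blast
  next
    case False
    then show ?thesis using c by (intro ex1I[of _ c]) blast+
  qed
  moreover have "dfn (\<lambda>\<rho>. ?Q (\<rho> 0) (\<rho> 1))"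
    by (intro dfn_intros dfn2[OF Q])
  ultimately have "\<exists>f. is_function f A B \<and> (\<forall>x. x \<in>\<^sub>M A \<longrightarrow> ?Q x (f $ x))"
    by (rule function_of_relation)
  then obtain f where f: "is_function f A B" "\<And>x. x \<in>\<^sub>M A \<Longrightarrow> ?Q x (f $ x)"
    by blast
  have "f $ x = y" if "x \<in>\<^sub>M A" "y \<in>\<^sub>M B" "Q x y" for x y
    using uniq[OF that(1) function_ap_mem[OF f(1) that(1)] that(2)] f(2)[OF that(1)] that(2,3) by blast
  then show ?thesis using f(1) by blast
qed

lemma function_weaken:
  assumes "is_function f A B" "B \<subseteq>\<^sub>M C"
  shows "is_function f A C"
proof -
  have "p \<in>\<^sub>M cprod A B \<Longrightarrow> p \<in>\<^sub>M cprod A C" for p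
    using assms(2) by (auto simp: mem_cprod subset_of_def)
  then show ?thesis using assms(1) unfolding is_function_iff by blast
qed

lemma injectionD: "injection f A B \<Longrightarrow> f $ x = f $ y \<Longrightarrow> x \<in>\<^sub>M A \<Longrightarrow> y \<in>\<^sub>M A \<Longrightarrow> x = y"
  unfolding injection_iff by blast

lemma injectionI:
  "is_function f A B \<Longrightarrow> (\<And>x y. x \<in>\<^sub>M A \<Longrightarrow> y \<in>\<^sub>M A \<Longrightarrow> f $ x = f $ y \<Longrightarrow> x = y) \<Longrightarrow> injection f A B"
  unfolding injection_iff by simp

lemma bijectionI:
  "injection f A B \<Longrightarrow> (\<And>y. y \<in>\<^sub>M B \<Longrightarrow> \<exists>x. x \<in>\<^sub>M A \<and> f $ x = y) \<Longrightarrow> bijection f A B"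
  unfolding bijection_iff by simp

lemma injection_compose:
  assumes "injection f A B" "injection g B C"
  shows "\<exists>h. injection h A C \<and> (\<forall>x. x \<in>\<^sub>M A \<longrightarrow> h $ x = g $ (f $ x))"
proof -
  have f: "is_function f A B" and g: "is_function g B C"
    using assms unfolding injection_iff by blast+
  obtain h where h: "is_function h A C" "\<And>x. x \<in>\<^sub>M A \<Longrightarrow> h $ x = g $ (f $ x)"
    using function_compose[OF f g] by blast
  have "x = y" if "x \<in>\<^sub>M A" "y \<in>\<^sub>M A" "h $ x = h $ y" for x y
  proof -
    have "g $ (f $ x) = g $ (f $ y)" using that h(2) by simp
    then have "f $ x = f $ y"
      by (rule injectionD[OF assms(2)]) (use that function_ap_mem[OF f] in blast)+
    then show ?thesis using that injectionD[OF assms(1)] by blast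
  qed
  then have "injection h A C" by (rule injectionI[OF h(1)])
  then show ?thesis using h(2) by blast
qed

lemma bijection_compose:
  assumes "bijection f A B" "bijection g B C"
  shows "\<exists>h. bijection h A C \<and> (\<forall>x. x \<in>\<^sub>M A \<longrightarrow> h $ x = g $ (f $ x))"
proof -
  have f: "injection f A B" and g: "injection g B C"
    using assms unfolding bijection_iff by blast+
  obtain h where h: "injection h A C" "\<And>x. x \<in>\<^sub>M A \<Longrightarrow> h $ x = g $ (f $ x)"
    using injection_compose[OF f g] by blast
  have "\<exists>x. x \<in>\<^sub>M A \<and> h $ x = z" if z: "z \<in>\<^sub>M C" for z
  proof -
    obtain y where "y \<in>\<^sub>M B" "g $ y = z" using assms(2) z unfolding bijection_iff by blast
    moreover obtain x where "x \<in>\<^sub>M A" "f $ x = y"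
      using assms(1) \<open>y \<in>\<^sub>M B\<close> unfolding bijection_iff by blast
    ultimately show ?thesis by (intro exI[of _ x]) (simp add: h(2))
  qed
  then have "bijection h A C" by (rule bijectionI[OF h(1)])
  then show ?thesis using h(2) by blast
qed

lemma bijection_inverse:
  assumes "bijection f A B"
  shows "\<exists>g. bijection g B A \<and> (\<forall>x. x \<in>\<^sub>M A \<longrightarrow> g $ (f $ x) = x) \<and>
    (\<forall>y. y \<in>\<^sub>M B \<longrightarrow> f $ (g $ y) = y)"
proof -
  have inj: "injection f A B" and f: "is_function f A B"
    and surj: "\<And>y. y \<in>\<^sub>M B \<Longrightarrow> \<exists>x. x \<in>\<^sub>M A \<and> f $ x = y"
    using assms unfolding bijection_iff injection_iff by blast+
  have "\<exists>!x. x \<in>\<^sub>M A \<and> f $ x = y" if y: "y \<in>\<^sub>M B" for y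
  proof -
    obtain x where "x \<in>\<^sub>M A" "f $ x = y" using surj[OF y] by blast
    then show ?thesis by (intro ex1I[of _ x]) (auto intro: injectionD[OF inj])
  qed
  moreover have "dfn (\<lambda>\<rho>. f $ \<rho> 1 = \<rho> 0)" by (intro dfn_intros)
  ultimately have "\<exists>g. is_function g B A \<and> (\<forall>y. y \<in>\<^sub>M B \<longrightarrow> f $ (g $ y) = y)"
    by (rule function_of_relation[of B A "\<lambda>y x. f $ x = y"])
  then obtain g where g: "is_function g B A" "\<And>y. y \<in>\<^sub>M B \<Longrightarrow> f $ (g $ y) = y"
    by blast
  have gf: "g $ (f $ x) = x" if "x \<in>\<^sub>M A" for x
  proof -
    have fx: "f $ x \<in>\<^sub>M B" using function_ap_mem[OF f that] .
    show ?thesis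
      by (rule injectionD[OF inj, OF g(2)[OF fx] function_ap_mem[OF g(1) fx] that])
  qed
  have "x = y" if "x \<in>\<^sub>M B" "y \<in>\<^sub>M B" "g $ x = g $ y" for x y
    using that g(2) by metis
  then have "injection g B A" by (rule injectionI[OF g(1)])
  moreover have "\<exists>y. y \<in>\<^sub>M B \<and> g $ y = x" if "x \<in>\<^sub>M A" for x
    by (rule exI[of _ "f $ x"]) (simp add: gf[OF that] function_ap_mem[OF f that])
  ultimately have "bijection g B A" by (rule bijectionI)
  then show ?thesis using g(2) gf by (intro exI[of _ g]) simp
qed

lemma bijection_identity: "\<exists>f. bijection f A A \<and> (\<forall>x. x \<in>\<^sub>M A \<longrightarrow> f $ x = x)"
proof -
  obtain f where f: "is_function f A A" "\<And>x. x \<in>\<^sub>M A \<Longrightarrow> f $ x = x"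
    using function_of_term[of A "\<lambda>x. x" A] dft_var by blast
  then have "bijection f A A" unfolding bijection_iff injection_iff by auto
  then show ?thesis using f by blast
qed

section \<open>Isomorphism of ordered sets as an equivalence relation\<close>

lemma order_isomorphic_refl: "order_isomorphic X r X r"
proof -
  obtain f where "bijection f X X" "\<And>x. x \<in>\<^sub>M X \<Longrightarrow> f $ x = x" using bijection_identity by blast
  then show ?thesis unfolding order_isomorphic_iff by (intro exI[of _ f]) auto
qed

lemma order_isomorphic_trans:
  assumes "order_isomorphic X r Y s" "order_isomorphic Y s Z t"
  shows "order_isomorphic X r Z t"
proof -
  obtain f where f: "bijection f X Y"
    "\<And>x y. x \<in>\<^sub>M X \<Longrightarrow> y \<in>\<^sub>M X \<Longrightarrow> rel r x y \<longleftrightarrow> rel s (f $ x) (f $ y)"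
    using assms(1) unfolding order_isomorphic_iff by blast
  obtain g where g: "bijection g Y Z"
    "\<And>x y. x \<in>\<^sub>M Y \<Longrightarrow> y \<in>\<^sub>M Y \<Longrightarrow> rel s x y \<longleftrightarrow> rel t (g $ x) (g $ y)"
    using assms(2) unfolding order_isomorphic_iff by blast
  obtain h where h: "bijection h X Z" "\<And>x. x \<in>\<^sub>M X \<Longrightarrow> h $ x = g $ (f $ x)"
    using bijection_compose[OF f(1) g(1)] by blast
  have "is_function f X Y" using f(1) unfolding bijection_iff injection_iff by blast
  then have "rel r x y \<longleftrightarrow> rel t (h $ x) (h $ y)" if "x \<in>\<^sub>M X" "y \<in>\<^sub>M X" for x y
    using that by (simp add: f(2) g(2) h(2) function_ap_mem)
  then show ?thesis unfolding order_isomorphic_iff using h(1) by blast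
qed

lemma order_isomorphic_sym:
  assumes "order_isomorphic X r Y s"
  shows "order_isomorphic Y s X r"
proof -
  obtain f where f: "bijection f X Y"
    "\<And>x y. x \<in>\<^sub>M X \<Longrightarrow> y \<in>\<^sub>M X \<Longrightarrow> rel r x y \<longleftrightarrow> rel s (f $ x) (f $ y)"
    using assms(1) unfolding order_isomorphic_iff by blast
  obtain g where g: "bijection g Y X" "\<And>y. y \<in>\<^sub>M Y \<Longrightarrow> f $ (g $ y) = y"
    using bijection_inverse[OF f(1)] by blast
  have "is_function g Y X" using g(1) unfolding bijection_iff injection_iff by blast
  then have "rel s x y \<longleftrightarrow> rel r (g $ x) (g $ y)" if "x \<in>\<^sub>M Y" "y \<in>\<^sub>M Y" for x y
    using that by (simp add: f(2) g(2) function_ap_mem)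
  then show ?thesis unfolding order_isomorphic_iff using g(1) by blast
qed

subsection \<open>The natural numbers and finite sets\<close>

text \<open>Infinity supplies one inductive set, from which the intersection of all inductive sets
  is separated.\<close>

lemma mem_omega: "n \<in>\<^sub>M omega \<longleftrightarrow> (\<forall>I. is_inductive I \<longrightarrow> n \<in>\<^sub>M I)"
  unfolding omega_def
proof (rule mem_setofI)
  obtain I where e: "\<exists>e. e \<in>\<^sub>M I \<and> (\<forall>w. \<not> w \<in>\<^sub>M e)"
    and s: "\<And>y. y \<in>\<^sub>M I \<Longrightarrow> \<exists>s. s \<in>\<^sub>M I \<and> (\<forall>w. w \<in>\<^sub>M s \<longleftrightarrow> w \<in>\<^sub>M y \<or> w = y)"
    using infinity by blast
  have "is_inductive I"
    unfolding is_inductive_def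
  proof (intro conjI allI impI)
    obtain e where "e \<in>\<^sub>M I" "\<forall>w. \<not> w \<in>\<^sub>M e" using e by blast
    moreover have "e = empty_set" by (rule setI) (use calculation in simp)
    ultimately show "empty_set \<in>\<^sub>M I" by simp
  next
    fix n assume "n \<in>\<^sub>M I"
    then obtain s where "s \<in>\<^sub>M I" "\<forall>w. w \<in>\<^sub>M s \<longleftrightarrow> w \<in>\<^sub>M n \<or> w = n" using s by blast
    moreover have "s = succ n" by (rule setI) (use calculation in simp)
    ultimately show "succ n \<in>\<^sub>M I" by simp
  qed
  moreover have "dfn (\<lambda>\<rho>. \<forall>I. empty_set \<in>\<^sub>M I \<and> (\<forall>n. n \<in>\<^sub>M I \<longrightarrow> succ n \<in>\<^sub>M I) \<longrightarrow> \<rho> 0 \<in>\<^sub>M I)"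
    by (intro dfn_intros)
  then have "\<exists>b. \<forall>x. x \<in>\<^sub>M b \<longleftrightarrow> x \<in>\<^sub>M I \<and> (\<forall>I. is_inductive I \<longrightarrow> x \<in>\<^sub>M I)"
    unfolding is_inductive_def by (rule separation_dfn)
  ultimately show "\<exists>s. \<forall>n. n \<in>\<^sub>M s \<longleftrightarrow> (\<forall>I. is_inductive I \<longrightarrow> n \<in>\<^sub>M I)"
    by meson
qed

lemma omega_empty: "empty_set \<in>\<^sub>M omega"
  unfolding mem_omega is_inductive_def by blast

lemma omega_succ: "n \<in>\<^sub>M omega \<Longrightarrow> succ n \<in>\<^sub>M omega"
  unfolding mem_omega is_inductive_def by blast

text \<open>Minimality of \<open>omega\<close> speaks about sets of the model, so \<open>P\<close>
  must be definable for the numbers satisfying it to form one.\<close>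

lemma omega_induct:
  assumes "n \<in>\<^sub>M omega" "dfn (\<lambda>\<rho>. P (\<rho> 0))" "P empty_set"
    "\<And>n. n \<in>\<^sub>M omega \<Longrightarrow> P n \<Longrightarrow> P (succ n)"
  shows "P n"
proof -
  have *: "x \<in>\<^sub>M sep omega P \<longleftrightarrow> x \<in>\<^sub>M omega \<and> P x" for x
    by (rule mem_sep[OF assms(2)])
  then have "is_inductive (sep omega P)"
    unfolding is_inductive_def using assms(3,4) omega_empty omega_succ by blast
  then show ?thesis using assms(1) * unfolding mem_omega[of n] by blast
qed

text \<open>Otherwise \<open>m\<close> and \<open>n\<close> would be elements of each other, which
  foundation for the unordered pair excludes.\<close>

lemma succ_inject:
  assumes "succ m = succ n"
  shows "m = n"
proof (rule ccontr)
  assume "m \<noteq> n"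
  then have "m \<in>\<^sub>M n" "n \<in>\<^sub>M m"
    using mem_succ[of m m] mem_succ[of m n] mem_succ[of n m] mem_succ[of n n] assms by auto
  then show False using foundation[of "upair m n"] by auto
qed

lemma succ_neq_empty: "succ n \<noteq> empty_set"
  using mem_succ[of n n] not_mem_empty[of n] by metis

section \<open>Finite and countable sets under injections\<close>

lemma finite_empty: "finite_set empty_set"
proof -
  obtain f where "bijection f empty_set empty_set" using bijection_identity by blast
  then show ?thesis unfolding finite_set_def using omega_empty by blast
qed

lemma finite_insert:
  assumes "finite_set A"
  shows "finite_set (un A (upair a a))"
proof (cases "a \<in>\<^sub>M A")
  case True
  then have "un A (upair a a) = A" by (intro setI) auto
  then show ?thesis using assms by simp
next
  case False
  obtain n f where n: "n \<in>\<^sub>M omega" and f: "bijection f A n"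
    using assms unfolding finite_set_def by blast
  then have inj: "injection f A n" and fn: "is_function f A n"
    unfolding bijection_iff injection_iff by blast+
  define F where "F x = (if x = a then n else f $ x)" for x
  have F: "F x \<in>\<^sub>M n" "F x = f $ x" if "x \<in>\<^sub>M A" for x
    using that False function_ap_mem[OF fn] by (auto simp: F_def)
  have F_dft: "dft (\<lambda>\<rho>. F (\<rho> 0))" unfolding F_def by (intro dfn_intros)
  have F_succ: "F x \<in>\<^sub>M succ n" if "x \<in>\<^sub>M un A (upair a a)" for x
    using that F(1)[of x] by (cases "x = a") (auto simp: F_def)
  obtain g where g: "is_function g (un A (upair a a)) (succ n)"
    "\<And>x. x \<in>\<^sub>M un A (upair a a) \<Longrightarrow> g $ x = F x"
    using function_of_term[OF F_succ F_dft] by blast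
  have Fa: "F a = n" by (simp add: F_def)
  have "injection g (un A (upair a a)) (succ n)"
    unfolding injection_iff
  proof (intro conjI allI impI g(1))
    fix x y assume x: "x \<in>\<^sub>M un A (upair a a)" and y: "y \<in>\<^sub>M un A (upair a a)" and "g $ x = g $ y"
    then have "F x = F y" using g(2) by simp
    then show "x = y"
      using x y F Fa mem_irrefl injectionD[OF inj] by (cases "x = a"; cases "y = a") auto
  qed
  moreover have "\<exists>x. x \<in>\<^sub>M un A (upair a a) \<and> g $ x = y" if "y \<in>\<^sub>M succ n" for y
  proof (cases "y = n")
    case True
    then show ?thesis using g(2)[of a] Fa by (intro exI[of _ a]) simp
  next
    case False
    then have "y \<in>\<^sub>M n" using that by simp
    then obtain x where "x \<in>\<^sub>M A" "f $ x = y" using f unfolding bijection_iff by blast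
    then show ?thesis using g(2)[of x] F(2)[of x] by (intro exI[of _ x]) simp
  qed
  ultimately have "bijection g (un A (upair a a)) (succ n)" by (rule bijectionI)
  then show ?thesis unfolding finite_set_def using omega_succ[OF n] by blast
qed

definition del :: "'a \<Rightarrow> 'a \<Rightarrow> 'a" where
  "del A a = sep A (\<lambda>x. x \<noteq> a)"

lemma mem_del [simp]: "x \<in>\<^sub>M del A a \<longleftrightarrow> x \<in>\<^sub>M A \<and> x \<noteq> a"
  unfolding del_def by (rule mem_sep) (intro dfn_intros)

lemma insert_del: "a \<in>\<^sub>M A \<Longrightarrow> un (del A a) (upair a a) = A"
  by (rule setI) auto

text \<open>Induction on \<open>n\<close> with \<open>A\<close> and \<open>f\<close> inside the
  induction formula: removing the element sent to the last number leaves an injection into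
  \<open>n\<close>.\<close>

lemma injection_into_omega_finite:
  assumes "n \<in>\<^sub>M omega" "injection f A n"
  shows "finite_set A"
proof -
  have "\<forall>A f. injection f A n \<longrightarrow> finite_set A"
    using assms(1)
  proof (rule omega_induct)
    show "dfn (\<lambda>\<rho>. \<forall>A f. injection f A (\<rho> 0) \<longrightarrow> finite_set A)" by (intro dfn_intros)
    show "\<forall>A f. injection f A empty_set \<longrightarrow> finite_set A"
    proof (intro allI impI)
      fix A f assume "injection f A empty_set"
      then have "is_function f A empty_set" unfolding injection_iff by blast
      then have "A = empty_set" by (intro setI) (auto dest: function_ap_mem)
      then show "finite_set A" using finite_empty by simp
    qed
  next
    fix n assume n: "n \<in>\<^sub>M omega" and IH: "\<forall>A f. injection f A n \<longrightarrow> finite_set A"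
    show "\<forall>A f. injection f A (succ n) \<longrightarrow> finite_set A"
    proof (intro allI impI)
      fix A f assume inj: "injection f A (succ n)"
      then have f: "is_function f A (succ n)" unfolding injection_iff by blast
      have *: "finite_set B" if B: "\<And>x. x \<in>\<^sub>M B \<Longrightarrow> x \<in>\<^sub>M A \<and> f $ x \<noteq> n" for B
      proof -
        have "f $ x \<in>\<^sub>M n" if "x \<in>\<^sub>M B" for x
          using B[OF that] function_ap_mem[OF f, of x] by simp
        moreover have "dft (\<lambda>\<rho>. f $ \<rho> 0)" by (intro dfn_intros)
        ultimately obtain g where "is_function g B n" "\<And>x. x \<in>\<^sub>M B \<Longrightarrow> g $ x = f $ x"
          using function_of_term[of B "\<lambda>x. f $ x" n] by blast
        then have "injection g B n"
          unfolding injection_iff using B injectionD[OF inj] by auto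
        then show ?thesis using IH by blast
      qed
      show "finite_set A"
      proof (cases "\<exists>a. a \<in>\<^sub>M A \<and> f $ a = n")
        case True
        then obtain a where a: "a \<in>\<^sub>M A" "f $ a = n" by blast
        have "finite_set (del A a)"
          by (rule *) (use a injectionD[OF inj] in auto)
        then show ?thesis using finite_insert[of "del A a" a] insert_del[OF a(1)] by simp
      next
        case False
        then show ?thesis by (intro *) auto
      qed
    qed
  qed
  then show ?thesis using assms(2) by blast
qed

lemma finite_injection:
  assumes "finite_set B" "injection f A B"
  shows "finite_set A"
proof -
  obtain n g where n: "n \<in>\<^sub>M omega" and g: "bijection g B n"
    using assms(1) unfolding finite_set_def by blast
  then have "injection g B n" unfolding bijection_iff by blast
  then obtain h where "injection h A n" using injection_compose[OF assms(2)] by blast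
  then show ?thesis by (rule injection_into_omega_finite[OF n])
qed

lemma injection_subset:
  assumes "A \<subseteq>\<^sub>M B"
  shows "\<exists>f. injection f A B"
proof -
  obtain f where f: "is_function f A B" "\<And>x. x \<in>\<^sub>M A \<Longrightarrow> f $ x = x"
    using function_of_term[of A "\<lambda>x. x" B] subset_ofD[OF assms] dft_var by blast
  then have "injection f A B" unfolding injection_iff by auto
  then show ?thesis by blast
qed

lemma finite_subset: "finite_set B \<Longrightarrow> A \<subseteq>\<^sub>M B \<Longrightarrow> finite_set A"
  using injection_subset finite_injection by blast

lemma countable_injection:
  assumes "countable_set B" "injection f A B"
  shows "countable_set A"
proof -
  obtain g where "injection g B omega" using assms(1) unfolding countable_set_def by blast
  then obtain h where "injection h A omega" using injection_compose[OF assms(2)] by blast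
  then show ?thesis unfolding countable_set_def by blast
qed

lemma countable_subset: "countable_set B \<Longrightarrow> A \<subseteq>\<^sub>M B \<Longrightarrow> countable_set A"
  using injection_subset countable_injection by blast

lemma finite_order_isomorphic:
  assumes "order_isomorphic X r Y s" "finite_set Y"
  shows "finite_set X"
  using assms finite_injection unfolding order_isomorphic_iff bijection_iff by blast

text \<open>Induction on the number of elements; the element numbered last is split off.\<close>

lemma finite_set_induct:
  assumes "finite_set A" "dfn (\<lambda>\<rho>. P (\<rho> 0))" "P empty_set"
    "\<And>A a. finite_set A \<Longrightarrow> P A \<Longrightarrow> P (un A (upair a a))"
  shows "P A"
proof -
  obtain n f where n: "n \<in>\<^sub>M omega" and f: "bijection f A n"
    using assms(1) unfolding finite_set_def by blast
  have "\<forall>A f. bijection f A n \<longrightarrow> P A"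
    using n
  proof (rule omega_induct)
    show "dfn (\<lambda>\<rho>. \<forall>A f. bijection f A (\<rho> 0) \<longrightarrow> P A)"
      by (intro dfn_intros dfn1[OF assms(2)])
    show "\<forall>A f. bijection f A empty_set \<longrightarrow> P A"
    proof (intro allI impI)
      fix A f assume "bijection f A empty_set"
      then have "is_function f A empty_set" unfolding bijection_iff injection_iff by blast
      then have "A = empty_set" by (intro setI) (auto dest: function_ap_mem)
      then show "P A" using assms(3) by simp
    qed
  next
    fix n assume n: "n \<in>\<^sub>M omega" and IH: "\<forall>A f. bijection f A n \<longrightarrow> P A"
    show "\<forall>A f. bijection f A (succ n) \<longrightarrow> P A"
    proof (intro allI impI)
      fix A f assume bij: "bijection f A (succ n)"
      then have inj: "injection f A (succ n)" and f: "is_function f A (succ n)"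
        and surj: "\<And>y. y \<in>\<^sub>M succ n \<Longrightarrow> \<exists>x. x \<in>\<^sub>M A \<and> f $ x = y"
        unfolding bijection_iff injection_iff by blast+
      obtain a where a: "a \<in>\<^sub>M A" "f $ a = n" using surj[of n] by auto
      have "f $ x \<in>\<^sub>M n" if "x \<in>\<^sub>M del A a" for x
        using that a function_ap_mem[OF f, of x] injectionD[OF inj, of x a] by auto
      moreover have "dft (\<lambda>\<rho>. f $ \<rho> 0)" by (intro dfn_intros)
      ultimately obtain g where g: "is_function g (del A a) n" "\<And>x. x \<in>\<^sub>M del A a \<Longrightarrow> g $ x = f $ x"
        using function_of_term[of "del A a" "\<lambda>x. f $ x" n] by blast
      then have "injection g (del A a) n"
        unfolding injection_iff using injectionD[OF inj] by auto
      moreover have "\<exists>x. x \<in>\<^sub>M del A a \<and> g $ x = y" if y: "y \<in>\<^sub>M n" for y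
      proof -
        obtain x where "x \<in>\<^sub>M A" "f $ x = y" using surj[of y] y by auto
        moreover have "x \<noteq> a" using calculation a y mem_irrefl by auto
        ultimately show ?thesis using g(2)[of x] by auto
      qed
      ultimately have bij': "bijection g (del A a) n" by (rule bijectionI)
      then have "finite_set (del A a)" "P (del A a)"
        using n IH unfolding finite_set_def by blast+
      then show "P A" using assms(4)[of "del A a" a] insert_del[OF a(1)] by simp
    qed
  qed
  then show ?thesis using f by blast
qed

lemma mem_subsets_of_type:
  "X \<in>\<^sub>M subsets_of_type A q L s \<longleftrightarrow> X \<subseteq>\<^sub>M A \<and> order_isomorphic X q L s"
  unfolding subsets_of_type_def
proof (rule mem_setofI)
  have "dfn (\<lambda>\<rho>. order_isomorphic (\<rho> 0) q L s)" by (intro dfn_intros)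
  then have "\<exists>b. \<forall>X. X \<in>\<^sub>M b \<longleftrightarrow> X \<in>\<^sub>M pow A \<and> order_isomorphic X q L s"
    by (rule separation_dfn)
  then show "\<exists>b. \<forall>X. X \<in>\<^sub>M b \<longleftrightarrow> X \<subseteq>\<^sub>M A \<and> order_isomorphic X q L s" by simp
qed

lemma countable_order_isomorphic:
  assumes "order_isomorphic X q L s" "countable_set X"
  shows "countable_set L"
proof -
  obtain f where "bijection f X L" using assms(1) unfolding order_isomorphic_iff by blast
  then obtain g where "bijection g L X" using bijection_inverse by blast
  then have "injection g L X" unfolding bijection_iff by blast
  then show ?thesis by (rule countable_injection[OF assms(2)])
qed

end

section \<open>The reals of the model\<close>

locale real_model = ZF_model mem for mem :: "'a \<Rightarrow> 'a \<Rightarrow> bool"  (infix \<open>\<in>\<^sub>M\<close> 50) +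
  fixes R lt pl ml zr one :: 'a
  assumes cof: "complete_ordered_field R lt pl ml zr one"
begin

definition add :: "'a \<Rightarrow> 'a \<Rightarrow> 'a"  (infixl \<open>\<oplus>\<close> 65) where
  "x \<oplus> y = pl $ opair x y"

definition mul :: "'a \<Rightarrow> 'a \<Rightarrow> 'a"  (infixl \<open>\<otimes>\<close> 70) where
  "x \<otimes> y = ml $ opair x y"

text \<open>The relation \<open>lt\<close> may contain pairs outside of \<open>R\<close>.\<close>

definition less :: "'a \<Rightarrow> 'a \<Rightarrow> bool"  (infix \<open>\<prec>\<close> 50) where
  "x \<prec> y \<longleftrightarrow> x \<in>\<^sub>M R \<and> y \<in>\<^sub>M R \<and> rel lt x y"

lemma dft_add: "dft t \<Longrightarrow> dft u \<Longrightarrow> dft (\<lambda>\<rho>. t \<rho> \<oplus> u \<rho>)"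
  unfolding add_def by (intro dfn_intros)

lemma dft_mul: "dft t \<Longrightarrow> dft u \<Longrightarrow> dft (\<lambda>\<rho>. t \<rho> \<otimes> u \<rho>)"
  unfolding mul_def by (intro dfn_intros)

lemma dfn_less: "dft t \<Longrightarrow> dft u \<Longrightarrow> dfn (\<lambda>\<rho>. t \<rho> \<prec> u \<rho>)"
  unfolding less_def by (intro dfn_intros)

lemmas dfn_real = dfn_intros dft_add dft_mul dfn_less

lemma rel_lt_iff: "x \<in>\<^sub>M R \<Longrightarrow> y \<in>\<^sub>M R \<Longrightarrow> rel lt x y \<longleftrightarrow> x \<prec> y"
  by (simp add: less_def)

lemma less_mem: "x \<prec> y \<Longrightarrow> x \<in>\<^sub>M R" "x \<prec> y \<Longrightarrow> y \<in>\<^sub>M R"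
  by (simp_all add: less_def)

lemma pl_function: "is_function pl (cprod R R) R"
  and ml_function: "is_function ml (cprod R R) R"
  and zero_mem [simp]: "zr \<in>\<^sub>M R"
  and one_mem [simp]: "one \<in>\<^sub>M R"
  and zero_neq_one: "zr \<noteq> one"
  and strict_linear: "strict_linear_order R lt"
  using cof unfolding complete_ordered_field_def by blast+

lemma app2_pl: "x \<in>\<^sub>M R \<Longrightarrow> y \<in>\<^sub>M R \<Longrightarrow> app2 pl x y = x \<oplus> y"
  unfolding app2_def add_def by (rule app_eq_ap[OF pl_function]) simp

lemma app2_ml: "x \<in>\<^sub>M R \<Longrightarrow> y \<in>\<^sub>M R \<Longrightarrow> app2 ml x y = x \<otimes> y"
  unfolding app2_def mul_def by (rule app_eq_ap[OF ml_function]) simp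

lemma add_mem [simp]: "x \<in>\<^sub>M R \<Longrightarrow> y \<in>\<^sub>M R \<Longrightarrow> x \<oplus> y \<in>\<^sub>M R"
  unfolding add_def by (rule function_ap_mem[OF pl_function]) simp

lemma mul_mem [simp]: "x \<in>\<^sub>M R \<Longrightarrow> y \<in>\<^sub>M R \<Longrightarrow> x \<otimes> y \<in>\<^sub>M R"
  unfolding mul_def by (rule function_ap_mem[OF ml_function]) simp

lemmas cof_axioms = cof[unfolded complete_ordered_field_def, THEN conjunct2, THEN conjunct2,
    THEN conjunct2, THEN conjunct2, THEN conjunct2]

lemma add_assoc: "x \<in>\<^sub>M R \<Longrightarrow> y \<in>\<^sub>M R \<Longrightarrow> w \<in>\<^sub>M R \<Longrightarrow> x \<oplus> y \<oplus> w = x \<oplus> (y \<oplus> w)"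
  and mul_assoc: "x \<in>\<^sub>M R \<Longrightarrow> y \<in>\<^sub>M R \<Longrightarrow> w \<in>\<^sub>M R \<Longrightarrow> x \<otimes> y \<otimes> w = x \<otimes> (y \<otimes> w)"
  and distrib: "x \<in>\<^sub>M R \<Longrightarrow> y \<in>\<^sub>M R \<Longrightarrow> w \<in>\<^sub>M R \<Longrightarrow> x \<otimes> (y \<oplus> w) = x \<otimes> y \<oplus> x \<otimes> w"
  using cof_axioms[THEN conjunct1, rule_format, of x y w] by (simp_all add: app2_pl app2_ml)

lemma add_commute: "x \<in>\<^sub>M R \<Longrightarrow> y \<in>\<^sub>M R \<Longrightarrow> x \<oplus> y = y \<oplus> x"
  and mul_commute: "x \<in>\<^sub>M R \<Longrightarrow> y \<in>\<^sub>M R \<Longrightarrow> x \<otimes> y = y \<otimes> x"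
  using cof_axioms[THEN conjunct2, THEN conjunct1, rule_format, of x y]
  by (simp_all add: app2_pl app2_ml)

lemma add_zero [simp]: "x \<in>\<^sub>M R \<Longrightarrow> x \<oplus> zr = x"
  and mul_one [simp]: "x \<in>\<^sub>M R \<Longrightarrow> x \<otimes> one = x"
  using cof_axioms[THEN conjunct2, THEN conjunct2, THEN conjunct1, rule_format, of x]
  by (simp_all add: app2_pl app2_ml)

lemmas cof_axioms' = cof_axioms[THEN conjunct2, THEN conjunct2, THEN conjunct2]

lemma negative: "x \<in>\<^sub>M R \<Longrightarrow> \<exists>y. y \<in>\<^sub>M R \<and> x \<oplus> y = zr"
  using cof_axioms'[THEN conjunct1, rule_format, of x] by (simp add: app2_pl cong: conj_cong)

lemma reciprocal: "x \<in>\<^sub>M R \<Longrightarrow> x \<noteq> zr \<Longrightarrow> \<exists>y. y \<in>\<^sub>M R \<and> x \<otimes> y = one"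
  using cof_axioms'[THEN conjunct2, THEN conjunct1, rule_format, of x]
  by (simp add: app2_ml cong: conj_cong)

lemma add_mono: "w \<in>\<^sub>M R \<Longrightarrow> x \<prec> y \<Longrightarrow> x \<oplus> w \<prec> y \<oplus> w"
  using cof_axioms'[THEN conjunct2, THEN conjunct2, THEN conjunct2, THEN conjunct1, rule_format, of x y w]
  by (simp add: app2_pl less_def)

lemma mul_pos: "zr \<prec> x \<Longrightarrow> zr \<prec> y \<Longrightarrow> zr \<prec> x \<otimes> y"
  using cof_axioms'[THEN conjunct2, THEN conjunct2, THEN conjunct2, THEN conjunct2, THEN conjunct1,
      rule_format, of x y]
  by (simp add: app2_ml less_def)

definition is_sup :: "'a \<Rightarrow> 'a \<Rightarrow> bool" where
  "is_sup S d \<longleftrightarrow> d \<in>\<^sub>M R \<and> (\<forall>x. x \<in>\<^sub>M S \<longrightarrow> \<not> d \<prec> x) \<and>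
    (\<forall>b. b \<in>\<^sub>M R \<longrightarrow> (\<forall>x. x \<in>\<^sub>M S \<longrightarrow> \<not> b \<prec> x) \<longrightarrow> \<not> b \<prec> d)"

lemma is_sup_exists:
  assumes "S \<subseteq>\<^sub>M R" "s \<in>\<^sub>M S" "b \<in>\<^sub>M R" "\<And>x. x \<in>\<^sub>M S \<Longrightarrow> \<not> b \<prec> x"
  shows "\<exists>d. is_sup S d"
proof -
  have *: "x \<in>\<^sub>M S \<Longrightarrow> x \<in>\<^sub>M R" for x using assms(1) by (rule subset_ofD)
  note complete = cof_axioms'[THEN conjunct2, THEN conjunct2, THEN conjunct2, THEN conjunct2,
      THEN conjunct2]
  have "\<forall>x. x \<in>\<^sub>M S \<longrightarrow> \<not> rel lt b x" using assms(3,4) * by (simp add: less_def)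
  then obtain l where "l \<in>\<^sub>M R" "\<forall>x. x \<in>\<^sub>M S \<longrightarrow> \<not> rel lt l x"
    "\<forall>b. b \<in>\<^sub>M R \<longrightarrow> (\<forall>x. x \<in>\<^sub>M S \<longrightarrow> \<not> rel lt b x) \<longrightarrow> \<not> rel lt b l"
    using complete assms(1-3) by blast
  then have "is_sup S l" using * by (simp add: is_sup_def less_def)
  then show ?thesis by blast
qed

lemma less_irrefl: "\<not> x \<prec> x"
  using strict_linear unfolding strict_linear_order_def less_def by blast

lemma less_trans: "x \<prec> y \<Longrightarrow> y \<prec> w \<Longrightarrow> x \<prec> w"
  using strict_linear unfolding strict_linear_order_def less_def by blast

lemma less_total: "x \<in>\<^sub>M R \<Longrightarrow> y \<in>\<^sub>M R \<Longrightarrow> x \<prec> y \<or> x = y \<or> y \<prec> x"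
  using strict_linear unfolding strict_linear_order_def less_def by blast

lemma less_asym: "x \<prec> y \<Longrightarrow> \<not> y \<prec> x"
  using less_irrefl less_trans by blast

lemma le_less_trans: "x \<in>\<^sub>M R \<Longrightarrow> \<not> y \<prec> x \<Longrightarrow> y \<prec> w \<Longrightarrow> x \<prec> w"
  using less_total[of x y] less_trans less_mem by blast

lemma less_le_trans: "w \<in>\<^sub>M R \<Longrightarrow> x \<prec> y \<Longrightarrow> \<not> w \<prec> y \<Longrightarrow> x \<prec> w"
  using less_total[of y w] less_trans less_mem by blast

subsection \<open>Ordered field arithmetic\<close>

lemma add_left_commute: "x \<in>\<^sub>M R \<Longrightarrow> y \<in>\<^sub>M R \<Longrightarrow> w \<in>\<^sub>M R \<Longrightarrow> x \<oplus> (y \<oplus> w) = y \<oplus> (x \<oplus> w)"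
  using add_assoc[of x y w] add_assoc[of y x w] add_commute[of x y] by simp

lemmas add_ac = add_assoc add_commute add_left_commute

lemma zero_add [simp]: "x \<in>\<^sub>M R \<Longrightarrow> zr \<oplus> x = x"
  using add_commute[of zr x] by simp

lemma one_mul [simp]: "x \<in>\<^sub>M R \<Longrightarrow> one \<otimes> x = x"
  using mul_commute[of one x] by simp

lemma distrib_right: "x \<in>\<^sub>M R \<Longrightarrow> y \<in>\<^sub>M R \<Longrightarrow> w \<in>\<^sub>M R \<Longrightarrow> (x \<oplus> y) \<otimes> w = x \<otimes> w \<oplus> y \<otimes> w"
  using distrib[of w x y] by (simp add: mul_commute)

lemma add_less_cancel:
  assumes "x \<in>\<^sub>M R" "y \<in>\<^sub>M R" "w \<in>\<^sub>M R"
  shows "x \<oplus> w \<prec> y \<oplus> w \<longleftrightarrow> x \<prec> y"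
  using assms less_total[of x y] add_mono[of w] less_asym less_irrefl by metis

lemma add_less_cancel_left:
  assumes "x \<in>\<^sub>M R" "y \<in>\<^sub>M R" "w \<in>\<^sub>M R"
  shows "w \<oplus> x \<prec> w \<oplus> y \<longleftrightarrow> x \<prec> y"
  using add_less_cancel[OF assms] assms by (simp add: add_commute)

lemma add_cancel:
  assumes "x \<in>\<^sub>M R" "y \<in>\<^sub>M R" "w \<in>\<^sub>M R"
  shows "x \<oplus> w = y \<oplus> w \<longleftrightarrow> x = y"
  using assms less_total[of x y] add_mono[of w] less_irrefl by metis

lemma add_cancel_left:
  assumes "x \<in>\<^sub>M R" "y \<in>\<^sub>M R" "w \<in>\<^sub>M R"
  shows "w \<oplus> x = w \<oplus> y \<longleftrightarrow> x = y"
  using add_cancel[OF assms] assms by (simp add: add_commute)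

lemma difference:
  assumes "x \<in>\<^sub>M R" "y \<in>\<^sub>M R"
  obtains d where "d \<in>\<^sub>M R" "y = x \<oplus> d"
proof -
  obtain u where u: "u \<in>\<^sub>M R" "x \<oplus> u = zr" using negative[OF assms(1)] by blast
  have "x \<oplus> (y \<oplus> u) = y \<oplus> (x \<oplus> u)"
    using assms u(1) by (simp add: add_ac)
  then have "y = x \<oplus> (y \<oplus> u)" using u assms by simp
  then show ?thesis using that[of "y \<oplus> u"] assms u(1) by simp
qed

lemma positive_difference:
  assumes "x \<prec> y"
  obtains d where "zr \<prec> d" "y = x \<oplus> d"
proof -
  obtain d where d: "d \<in>\<^sub>M R" "y = x \<oplus> d" using difference less_mem[OF assms] by metis
  then have "x \<oplus> zr \<prec> x \<oplus> d" using assms less_mem by simp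
  then have "zr \<prec> d" using add_less_cancel_left[of zr d x] less_mem[OF assms] d(1) by simp
  then show ?thesis using that d by blast
qed

lemma mul_zero [simp]: "x \<in>\<^sub>M R \<Longrightarrow> x \<otimes> zr = zr"
  using distrib[of x zr zr] add_cancel_left[of "x \<otimes> zr" zr "x \<otimes> zr"] by simp

lemma zero_mul [simp]: "x \<in>\<^sub>M R \<Longrightarrow> zr \<otimes> x = zr"
  using mul_commute[of zr x] by simp

lemma mul_less:
  assumes "zr \<prec> k" "x \<prec> y"
  shows "k \<otimes> x \<prec> k \<otimes> y"
proof -
  obtain d where d: "zr \<prec> d" "y = x \<oplus> d" using positive_difference[OF assms(2)] by blast
  have m: "k \<in>\<^sub>M R" "x \<in>\<^sub>M R" "d \<in>\<^sub>M R" using assms d less_mem by blast+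
  have "k \<otimes> x \<oplus> zr \<prec> k \<otimes> x \<oplus> k \<otimes> d"
    using mul_pos[OF assms(1) d(1)] m by (subst add_less_cancel_left) auto
  then show ?thesis using d m by (simp add: distrib)
qed

lemma zero_less_one: "zr \<prec> one"
proof (rule ccontr)
  assume "\<not> zr \<prec> one"
  then have one: "one \<prec> zr" using less_total[of zr one] zero_neq_one by auto
  obtain u where u: "u \<in>\<^sub>M R" "one \<oplus> u = zr" using negative[of one] by auto
  then have pos: "zr \<prec> u" using add_mono[OF u(1) one] by simp
  \<comment> \<open>Both \<open>one\<close> and \<open>u \<otimes> u\<close> are additive inverses
    of \<open>u\<close>, so the square of the positive \<open>u\<close> would be the negative
    \<open>one\<close>.\<close>
  have "one \<oplus> u \<otimes> one = zr" using u by simp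
  moreover have "u \<otimes> u \<oplus> u \<otimes> one = zr"
    using distrib[of u u one] u by (simp add: add_commute)
  ultimately have "one = u \<otimes> u"
    using add_cancel[of one "u \<otimes> u" "u \<otimes> one"] u by simp
  then show False using mul_pos[OF pos pos] one less_asym by auto
qed

lemma less_add_one: "x \<in>\<^sub>M R \<Longrightarrow> x \<prec> x \<oplus> one"
  using add_less_cancel_left[of zr one x] zero_less_one by simp

subsection \<open>Natural numbers inside the reals\<close>

text \<open>Indices are taken inside \<open>R\<close> rather than in \<open>omega\<close>, so that
  their order and arithmetic are inherited from the field.\<close>

definition nats :: 'a where
  "nats = sep R (\<lambda>x. \<forall>I. zr \<in>\<^sub>M I \<and> (\<forall>y. y \<in>\<^sub>M I \<longrightarrow> y \<oplus> one \<in>\<^sub>M I) \<longrightarrow> x \<in>\<^sub>M I)"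

lemma mem_nats: "x \<in>\<^sub>M nats \<longleftrightarrow>
    x \<in>\<^sub>M R \<and> (\<forall>I. zr \<in>\<^sub>M I \<and> (\<forall>y. y \<in>\<^sub>M I \<longrightarrow> y \<oplus> one \<in>\<^sub>M I) \<longrightarrow> x \<in>\<^sub>M I)"
  unfolding nats_def by (rule mem_sep) (intro dfn_real)

lemma nats_real [simp]: "n \<in>\<^sub>M nats \<Longrightarrow> n \<in>\<^sub>M R"
  by (simp add: mem_nats)

lemma nats_zero [simp]: "zr \<in>\<^sub>M nats"
  by (simp add: mem_nats)

lemma nats_Suc [simp]: "n \<in>\<^sub>M nats \<Longrightarrow> n \<oplus> one \<in>\<^sub>M nats"
  by (simp add: mem_nats)

lemma nats_induct [consumes 1, case_names dfn zero Suc]: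
  assumes "n \<in>\<^sub>M nats" "dfn (\<lambda>\<rho>. P (\<rho> 0))" "P zr"
    "\<And>n. n \<in>\<^sub>M nats \<Longrightarrow> P n \<Longrightarrow> P (n \<oplus> one)"
  shows "P n"
proof -
  have *: "x \<in>\<^sub>M sep nats P \<longleftrightarrow> x \<in>\<^sub>M nats \<and> P x" for x
    by (rule mem_sep[OF assms(2)])
  then have "zr \<in>\<^sub>M sep nats P \<and> (\<forall>y. y \<in>\<^sub>M sep nats P \<longrightarrow> y \<oplus> one \<in>\<^sub>M sep nats P)"
    using assms(3,4) by simp
  then have "n \<in>\<^sub>M sep nats P" using assms(1) unfolding mem_nats[of n] by blast
  then show ?thesis using * by blast
qed

lemma nats_cases:
  assumes "n \<in>\<^sub>M nats"
  shows "n = zr \<or> (\<exists>m. m \<in>\<^sub>M nats \<and> n = m \<oplus> one)"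
  using assms by (induction rule: nats_induct) (intro dfn_real, blast+)

lemma nats_nonneg: "n \<in>\<^sub>M nats \<Longrightarrow> \<not> n \<prec> zr"
proof (induction rule: nats_induct)
  case dfn
  show ?case by (intro dfn_real)
next
  case zero
  show ?case by (rule less_irrefl)
next
  case (Suc n)
  then show ?case using less_add_one[of n] less_trans nats_real by blast
qed

lemma nats_pos: "n \<in>\<^sub>M nats \<Longrightarrow> n \<noteq> zr \<Longrightarrow> zr \<prec> n"
  using less_total[of n zr] nats_nonneg by auto

text \<open>Induction on \<open>n\<close> for all \<open>m\<close> at once: a number above
  \<open>n \<oplus> one\<close> is itself a successor, and cancelling \<open>one\<close> leads back
  to the previous case.\<close>

lemma nats_discrete:
  assumes "n \<in>\<^sub>M nats" "m \<in>\<^sub>M nats" "n \<prec> m"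
  shows "\<not> m \<prec> n \<oplus> one"
proof -
  have "\<forall>m. m \<in>\<^sub>M nats \<longrightarrow> n \<prec> m \<longrightarrow> \<not> m \<prec> n \<oplus> one"
    using assms(1)
  proof (induction rule: nats_induct)
    case dfn
    show ?case by (intro dfn_real)
  next
    case zero
    show ?case
    proof (intro allI impI)
      fix m assume m: "m \<in>\<^sub>M nats" "zr \<prec> m"
      then obtain k where "k \<in>\<^sub>M nats" "m = k \<oplus> one" using nats_cases less_irrefl by blast
      then show "\<not> m \<prec> zr \<oplus> one"
        using nats_nonneg[of k] add_less_cancel[of k zr one] by simp
    qed
  next
    case (Suc n)
    show ?case
    proof (intro allI impI)
      fix m assume m: "m \<in>\<^sub>M nats" "n \<oplus> one \<prec> m"
      have "m \<noteq> zr" using m(2) nats_nonneg[of "n \<oplus> one"] Suc(1) by auto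
      then obtain k where k: "k \<in>\<^sub>M nats" "m = k \<oplus> one" using m(1) nats_cases by blast
      then have "n \<prec> k" using m(2) Suc(1) add_less_cancel[of n k one] by simp
      then have "\<not> k \<prec> n \<oplus> one" using Suc(2) k(1) by blast
      then show "\<not> m \<prec> n \<oplus> one \<oplus> one"
        using k Suc(1) add_less_cancel[of k "n \<oplus> one" one] by simp
    qed
  qed
  then show ?thesis using assms by blast
qed

lemma nats_less_Suc:
  assumes "n \<in>\<^sub>M nats" "m \<in>\<^sub>M nats"
  shows "m \<prec> n \<oplus> one \<longleftrightarrow> \<not> n \<prec> m"
  using assms nats_discrete[of n m] le_less_trans[of m n "n \<oplus> one"] less_add_one[of n] by auto

text \<open>Induction on a bound for the witnesses: a witness is least, or a smaller one falls under
  the previous bound. This supplies the first candidates used in place of choice.\<close>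

lemma nats_least:
  assumes "n \<in>\<^sub>M nats" "P n" "dfn (\<lambda>\<rho>. P (\<rho> 0))"
  shows "\<exists>m. m \<in>\<^sub>M nats \<and> P m \<and> (\<forall>k. k \<in>\<^sub>M nats \<longrightarrow> k \<prec> m \<longrightarrow> \<not> P k)" (is ?T)
proof -
  have "\<forall>k. k \<in>\<^sub>M nats \<and> \<not> n \<prec> k \<and> P k \<longrightarrow> ?T"
    using assms(1)
  proof (induction rule: nats_induct)
    case dfn
    show ?case by (intro dfn_real dfn1[OF assms(3)])
  next
    case zero
    show ?case
    proof (intro allI impI)
      fix k assume k: "k \<in>\<^sub>M nats \<and> \<not> zr \<prec> k \<and> P k"
      then have "k = zr" using nats_pos by blast
      then show ?T using k nats_nonneg by blast
    qed
  next
    case (Suc n)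
    show ?case
    proof (intro allI impI)
      fix k assume k: "k \<in>\<^sub>M nats \<and> \<not> n \<oplus> one \<prec> k \<and> P k"
      show ?T
      proof (cases "\<exists>j. j \<in>\<^sub>M nats \<and> j \<prec> k \<and> P j")
        case True
        then obtain j where j: "j \<in>\<^sub>M nats" "j \<prec> k" "P j" by blast
        then have "j \<prec> n \<oplus> one"
          using less_le_trans[of "n \<oplus> one" j k] k Suc(1) by simp
        then have "\<not> n \<prec> j" using nats_less_Suc Suc(1) j(1) by blast
        then show ?T using Suc(2) j by blast
      next
        case False
        then show ?T using k by blast
      qed
    qed
  qed
  then show ?thesis using assms less_irrefl by blast
qed

lemma nats_add [simp]:
  assumes "m \<in>\<^sub>M nats" "n \<in>\<^sub>M nats"
  shows "m \<oplus> n \<in>\<^sub>M nats"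
  using assms(2)
proof (induction rule: nats_induct)
  case dfn
  show ?case by (intro dfn_real)
next
  case zero
  show ?case using assms(1) by simp
next
  case (Suc n)
  then show ?case using assms(1) nats_Suc[of "m \<oplus> n"] add_assoc[of m n one] by simp
qed

lemma nats_mul [simp]:
  assumes "m \<in>\<^sub>M nats" "n \<in>\<^sub>M nats"
  shows "m \<otimes> n \<in>\<^sub>M nats"
  using assms(2)
proof (induction rule: nats_induct)
  case dfn
  show ?case by (intro dfn_real)
next
  case zero
  show ?case using assms(1) by simp
next
  case (Suc n)
  then show ?case using assms(1) nats_add[of "m \<otimes> n" m] distrib[of m n one] by simp
qed

section \<open>The Archimedean property, rationals, and a countable base of intervals\<close>

lemma archimedean:
  assumes "zr \<prec> d" "x \<in>\<^sub>M R"
  shows "\<exists>n. n \<in>\<^sub>M nats \<and> x \<prec> n \<otimes> d"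
proof (rule ccontr)
  assume no: "\<not> (\<exists>n. n \<in>\<^sub>M nats \<and> x \<prec> n \<otimes> d)"
  have d: "d \<in>\<^sub>M R" using assms(1) less_mem by blast
  define S where "S = sep R (\<lambda>y. \<exists>n. n \<in>\<^sub>M nats \<and> y = n \<otimes> d)"
  have S: "y \<in>\<^sub>M S \<longleftrightarrow> y \<in>\<^sub>M R \<and> (\<exists>n. n \<in>\<^sub>M nats \<and> y = n \<otimes> d)" for y
    unfolding S_def by (rule mem_sep) (intro dfn_real)
  have "\<exists>l. is_sup S l"
  proof (rule is_sup_exists)
    show "S \<subseteq>\<^sub>M R" by (rule subset_ofI) (simp add: S)
    show "zr \<otimes> d \<in>\<^sub>M S" using d nats_zero unfolding S by fastforce
    show "\<not> x \<prec> y" if "y \<in>\<^sub>M S" for y using no that unfolding S by blast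
  qed (rule assms(2))
  then obtain l where l: "l \<in>\<^sub>M R" "\<And>y. y \<in>\<^sub>M S \<Longrightarrow> \<not> l \<prec> y"
    "\<And>b. b \<in>\<^sub>M R \<Longrightarrow> (\<And>y. y \<in>\<^sub>M S \<Longrightarrow> \<not> b \<prec> y) \<Longrightarrow> \<not> b \<prec> l"
    unfolding is_sup_def by blast
  \<comment> \<open>\<open>m\<close> is the supremum minus \<open>d\<close>; a multiple of
    \<open>d\<close> beyond \<open>m\<close> is followed by a multiple beyond the supremum.\<close>
  obtain m where m: "m \<in>\<^sub>M R" "l = d \<oplus> m" using difference[OF d l(1)] by metis
  have "m \<prec> l" using add_less_cancel[of zr d m] m d assms(1) by simp
  then obtain y where y: "y \<in>\<^sub>M S" "m \<prec> y" using l(3) m(1) by blast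
  then obtain n where n: "n \<in>\<^sub>M nats" "y = n \<otimes> d" unfolding S by blast
  have "d \<oplus> m \<prec> d \<oplus> y" using y(2) less_mem[OF y(2)] add_less_cancel_left d by simp
  moreover have "d \<oplus> y = (n \<oplus> one) \<otimes> d"
    using n d by (simp add: distrib_right add_commute)
  then have "d \<oplus> y \<in>\<^sub>M S" unfolding S using n d by (metis nats_Suc nats_real mul_mem)
  ultimately show False using l(2) m(2) by blast
qed

lemma nats_unbounded: "x \<in>\<^sub>M R \<Longrightarrow> \<exists>n. n \<in>\<^sub>M nats \<and> x \<prec> n"
  using archimedean[OF zero_less_one, of x] by force

text \<open>\<open>q = (a - b) / k\<close>, so that \<open>nats\<close> suffices to code the rationals.\<close>

definition is_ratio :: "'a \<Rightarrow> 'a \<Rightarrow> 'a \<Rightarrow> 'a \<Rightarrow> bool" where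
  "is_ratio a b k q \<longleftrightarrow> zr \<prec> k \<and> k \<otimes> q \<oplus> b = a"

lemma is_ratio_unique:
  assumes "is_ratio a b k q" "is_ratio a b k q'" "b \<in>\<^sub>M R" "q \<in>\<^sub>M R" "q' \<in>\<^sub>M R"
  shows "q = q'"
proof -
  have k: "zr \<prec> k" "k \<in>\<^sub>M R" using assms(1) less_mem unfolding is_ratio_def by blast+
  have "k \<otimes> q = k \<otimes> q'"
    using assms k add_cancel[of "k \<otimes> q" "k \<otimes> q'" b] unfolding is_ratio_def by simp
  then show ?thesis using mul_less[OF k(1)] less_total[of q q'] assms less_irrefl by metis
qed

lemma ratio_between:
  assumes "u \<prec> v"
  shows "\<exists>a b k q. a \<in>\<^sub>M nats \<and> b \<in>\<^sub>M nats \<and> k \<in>\<^sub>M nats \<and> q \<in>\<^sub>M R \<and> is_ratio a b k q \<and> u \<prec> q \<and> q \<prec> v"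
proof -
  have uv: "u \<in>\<^sub>M R" "v \<in>\<^sub>M R" using assms less_mem by blast+
  obtain d where d: "zr \<prec> d" "v = u \<oplus> d" using positive_difference[OF assms] by metis
  have dR: "d \<in>\<^sub>M R" using d(1) less_mem by blast
  \<comment> \<open>Scaled by \<open>k\<close>, the gap between \<open>u\<close> and
    \<open>v\<close> is longer than \<open>one\<close>, hence has an integer \<open>a - b\<close>
    strictly inside.\<close>
  obtain k where k: "k \<in>\<^sub>M nats" "one \<prec> k \<otimes> d" using archimedean[OF d(1), of one] by auto
  have kR: "k \<in>\<^sub>M R" using k(1) by simp
  have "k \<noteq> zr" using k(2) zero_less_one less_asym dR by auto
  then have kpos: "zr \<prec> k" using nats_pos k(1) by blast
  obtain w' where w': "w' \<in>\<^sub>M R" "k \<otimes> u \<oplus> w' = zr" using negative[of "k \<otimes> u"] kR uv by auto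
  \<comment> \<open>The shift by \<open>b\<close> makes the scaled left end positive, where
    \<open>nats\<close> has the integers needed; the \<open>b\<close> in \<open>is_ratio\<close>
    undoes it.\<close>
  obtain b where b: "b \<in>\<^sub>M nats" "w' \<prec> b" using nats_unbounded[OF w'(1)] by blast
  define w where "w = k \<otimes> u \<oplus> b"
  have bR: "b \<in>\<^sub>M R" and wR: "w \<in>\<^sub>M R" using b kR uv by (simp_all add: w_def)
  have wpos: "zr \<prec> w"
    using add_less_cancel_left[of w' b "k \<otimes> u"] w' b bR kR uv by (simp add: w_def)
  obtain a0 where "a0 \<in>\<^sub>M nats" "w \<prec> a0" using nats_unbounded[OF wR] by blast
  moreover have "dfn (\<lambda>\<rho>. w \<prec> \<rho> 0)" by (intro dfn_real)
  \<comment> \<open>The least natural number above \<open>w\<close> exceeds it by at most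
    \<open>one\<close>, so it stays below the shifted right end.\<close>
  ultimately obtain a where a: "a \<in>\<^sub>M nats" "w \<prec> a" "\<And>j. j \<in>\<^sub>M nats \<Longrightarrow> j \<prec> a \<Longrightarrow> \<not> w \<prec> j"
    using nats_least[of a0 "\<lambda>x. w \<prec> x"] by blast
  have "a \<noteq> zr" using wpos a(2) less_asym by blast
  then obtain a' where a': "a' \<in>\<^sub>M nats" "a = a' \<oplus> one" using nats_cases a(1) by blast
  have "\<not> w \<prec> a'" using a(3)[OF a'(1)] a'(2) less_add_one[of a'] a'(1) by simp
  then have "\<not> w \<oplus> one \<prec> a"
    using add_less_cancel[of w a' one] a' wR by simp
  moreover have "w \<oplus> one \<prec> w \<oplus> k \<otimes> d"
    using add_less_cancel_left[of one "k \<otimes> d" w] k(2) kR dR wR by simp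
  ultimately have aw: "a \<prec> w \<oplus> k \<otimes> d"
    using le_less_trans[of a "w \<oplus> one"] a(1) by simp
  have "w \<oplus> k \<otimes> d = k \<otimes> v \<oplus> b"
    using kR uv bR dR unfolding w_def d(2) by (simp add: distrib add_ac)
  then have av: "a \<prec> k \<otimes> v \<oplus> b" using aw by simp
  obtain c where c: "c \<in>\<^sub>M R" "a = b \<oplus> c" using difference[OF bR, of a] a(1) by auto
  obtain i where i: "i \<in>\<^sub>M R" "k \<otimes> i = one" using reciprocal[OF kR \<open>k \<noteq> zr\<close>] by blast
  define q where "q = i \<otimes> c"
  have qR: "q \<in>\<^sub>M R" using i c by (simp add: q_def)
  have "k \<otimes> q = c" unfolding q_def using mul_assoc[OF kR i(1) c(1)] i c by simp
  then have kq: "k \<otimes> q \<oplus> b = a" using c bR by (simp add: add_commute)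
  have "u \<prec> q"
  proof (rule ccontr)
    assume "\<not> u \<prec> q"
    then have "q \<prec> u \<or> q = u" using less_total[OF uv(1) qR] by blast
    then have "\<not> k \<otimes> u \<prec> k \<otimes> q"
      using mul_less[OF kpos, of q u] less_asym less_irrefl by blast
    then have "\<not> w \<prec> a"
      unfolding w_def kq[symmetric] using add_less_cancel kR uv qR bR by simp
    then show False using a(2) by blast
  qed
  moreover have "q \<prec> v"
  proof (rule ccontr)
    assume "\<not> q \<prec> v"
    then have "v \<prec> q \<or> q = v" using less_total[OF uv(2) qR] by blast
    then have "\<not> k \<otimes> q \<prec> k \<otimes> v"
      using mul_less[OF kpos, of v q] less_asym less_irrefl by blast
    then have "\<not> a \<prec> k \<otimes> v \<oplus> b"
      unfolding kq[symmetric] using add_less_cancel kR uv qR bR by simp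
    then show False using av by blast
  qed
  moreover have "is_ratio a b k q" unfolding is_ratio_def using kpos kq by blast
  ultimately show ?thesis using a(1) b(1) k(1) qR by blast
qed

text \<open>
  Since \<open>a\<close> is at most \<open>a + b\<close>, the code of \<open>(a, b)\<close> lies between the squares of \<open>a + b\<close> and of
  \<open>a + b + 1\<close>, which makes the pairing injective.
\<close>

definition pair :: "'a \<Rightarrow> 'a \<Rightarrow> 'a" where
  "pair a b = (a \<oplus> b) \<otimes> (a \<oplus> b) \<oplus> a"

lemma dft_pair: "dft t \<Longrightarrow> dft u \<Longrightarrow> dft (\<lambda>\<rho>. pair (t \<rho>) (u \<rho>))"
  unfolding pair_def by (intro dfn_real)

lemma pair_nats [simp]: "a \<in>\<^sub>M nats \<Longrightarrow> b \<in>\<^sub>M nats \<Longrightarrow> pair a b \<in>\<^sub>M nats"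
  unfolding pair_def by simp

lemma nats_le_add:
  assumes "a \<in>\<^sub>M nats" "b \<in>\<^sub>M nats"
  shows "\<not> a \<oplus> b \<prec> a"
  using add_less_cancel_left[of b zr a] nats_nonneg assms by simp

lemma nats_square_mono:
  assumes "s \<in>\<^sub>M nats" "t \<in>\<^sub>M nats" "\<not> t \<prec> s"
  shows "\<not> t \<otimes> t \<prec> s \<otimes> s"
proof (cases "s = t \<or> s = zr")
  case True
  then show ?thesis using assms less_irrefl nats_nonneg[of "t \<otimes> t"] by auto
next
  case False
  then have st: "s \<prec> t" and "zr \<prec> s" using assms less_total[of s t] nats_pos by auto
  then have "zr \<prec> t" using less_trans by blast
  have "s \<otimes> s \<prec> s \<otimes> t" using mul_less[OF \<open>zr \<prec> s\<close> st] .
  moreover have "t \<otimes> s \<prec> t \<otimes> t" using mul_less[OF \<open>zr \<prec> t\<close> st] .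
  ultimately have "s \<otimes> s \<prec> t \<otimes> t" using less_trans mul_commute[of s t] assms by simp
  then show ?thesis by (rule less_asym)
qed

lemma pair_less:
  assumes m: "a \<in>\<^sub>M nats" "b \<in>\<^sub>M nats" "c \<in>\<^sub>M nats" "d \<in>\<^sub>M nats" and lt: "a \<oplus> b \<prec> c \<oplus> d"
  shows "pair a b \<prec> pair c d"
proof -
  define s t where "s = a \<oplus> b" and "t = c \<oplus> d"
  have st: "s \<in>\<^sub>M nats" "t \<in>\<^sub>M nats" "s \<prec> t" using assms by (simp_all add: s_def t_def)
  have "\<not> s \<prec> a" unfolding s_def using nats_le_add m by blast
  then have a: "a \<prec> s \<oplus> one" using nats_less_Suc[of s a] st m by blast
  have eq: "(s \<oplus> one) \<otimes> (s \<oplus> one) = s \<otimes> s \<oplus> s \<oplus> (s \<oplus> one)"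
    using st(1) by (simp add: distrib distrib_right)
  have "s \<otimes> s \<oplus> a \<prec> s \<otimes> s \<oplus> (s \<oplus> one)"
    using a st m by (subst add_less_cancel_left) auto
  moreover have "\<not> s \<otimes> s \<oplus> (s \<oplus> one) \<oplus> s \<prec> s \<otimes> s \<oplus> (s \<oplus> one)"
    using nats_le_add[of "s \<otimes> s \<oplus> (s \<oplus> one)" s] st(1) by simp
  moreover have "s \<otimes> s \<oplus> (s \<oplus> one) \<oplus> s = (s \<oplus> one) \<otimes> (s \<oplus> one)"
    unfolding eq using st(1) by (simp add: add_ac)
  ultimately have 1: "pair a b \<prec> (s \<oplus> one) \<otimes> (s \<oplus> one)"
    using less_le_trans[of "(s \<oplus> one) \<otimes> (s \<oplus> one)"] st(1) unfolding pair_def s_def[symmetric] by simp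
  have "\<not> t \<prec> s \<oplus> one" using nats_discrete st by blast
  then have "\<not> t \<otimes> t \<prec> (s \<oplus> one) \<otimes> (s \<oplus> one)" using nats_square_mono st by simp
  then have "pair a b \<prec> t \<otimes> t" using less_le_trans[OF _ 1] st(2) by simp
  moreover have "\<not> t \<otimes> t \<oplus> c \<prec> t \<otimes> t" using nats_le_add[of "t \<otimes> t" c] st m by simp
  ultimately show ?thesis
    using less_le_trans[of "t \<otimes> t \<oplus> c"] st m unfolding pair_def t_def[symmetric] by simp
qed

lemma pair_eqD:
  assumes "a \<in>\<^sub>M nats" "b \<in>\<^sub>M nats" "c \<in>\<^sub>M nats" "d \<in>\<^sub>M nats" "pair a b = pair c d"
  shows "a = c \<and> b = d"
proof -
  have "\<not> a \<oplus> b \<prec> c \<oplus> d" "\<not> c \<oplus> d \<prec> a \<oplus> b"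
    using pair_less assms less_irrefl by metis+
  then have s: "a \<oplus> b = c \<oplus> d" using less_total assms(1-4) nats_add nats_real by metis
  then have "a = c"
    using assms add_cancel_left[of a c "(c \<oplus> d) \<otimes> (c \<oplus> d)"] unfolding pair_def by simp
  then show ?thesis using s assms add_cancel_left[of b d c] by simp
qed

text \<open>A single sequence \<open>f\<close> of rationals, indexed by codes of triples, is dense;
  codes of pairs of its indices then give the two ends. Indices that code nothing get the default
  \<open>zr\<close>.\<close>

lemma countable_base:
  "\<exists>l r. is_function l nats R \<and> is_function r nats R \<and>
    (\<forall>u x v. u \<prec> x \<longrightarrow> x \<prec> v \<longrightarrow>
      (\<exists>n. n \<in>\<^sub>M nats \<and> u \<prec> l $ n \<and> l $ n \<prec> x \<and> x \<prec> r $ n \<and> r $ n \<prec> v))"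
proof -
  define Q where "Q n q \<longleftrightarrow> (\<exists>a b k. a \<in>\<^sub>M nats \<and> b \<in>\<^sub>M nats \<and> k \<in>\<^sub>M nats \<and>
    n = pair a (pair b k) \<and> is_ratio a b k q)" for n q
  have "q = q'" if q: "q \<in>\<^sub>M R" "q' \<in>\<^sub>M R" "Q n q" "Q n q'" for n q q'
  proof -
    obtain a b k where 1: "a \<in>\<^sub>M nats" "b \<in>\<^sub>M nats" "k \<in>\<^sub>M nats" "n = pair a (pair b k)" "is_ratio a b k q"
      using q(3) unfolding Q_def by blast
    obtain a' b' k' where 2: "a' \<in>\<^sub>M nats" "b' \<in>\<^sub>M nats" "k' \<in>\<^sub>M nats" "n = pair a' (pair b' k')"
      "is_ratio a' b' k' q'"
      using q(4) unfolding Q_def by blast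
    have "a = a' \<and> pair b k = pair b' k'" using pair_eqD[of a "pair b k" a' "pair b' k'"] 1 2 by simp
    moreover from this have "b = b' \<and> k = k'" using pair_eqD[of b k b' k'] 1 2 by simp
    ultimately show ?thesis using is_ratio_unique[of a b k q q'] 1 2 q by simp
  qed
  moreover have "dfn (\<lambda>\<rho>. Q (\<rho> 0) (\<rho> 1))"
    unfolding Q_def is_ratio_def by (intro dfn_real dft_pair)
  ultimately have "\<exists>f. is_function f nats R \<and> (\<forall>n q. n \<in>\<^sub>M nats \<longrightarrow> q \<in>\<^sub>M R \<longrightarrow> Q n q \<longrightarrow> f $ n = q)"
    using zero_mem by (intro function_extending_relation)
  then obtain f where f: "is_function f nats R"
    "\<And>n q. n \<in>\<^sub>M nats \<Longrightarrow> q \<in>\<^sub>M R \<Longrightarrow> Q n q \<Longrightarrow> f $ n = q" by blast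
  have dense: "\<exists>n. n \<in>\<^sub>M nats \<and> u \<prec> f $ n \<and> f $ n \<prec> v" if uv: "u \<prec> v" for u v
  proof -
    obtain a b k q where *: "a \<in>\<^sub>M nats" "b \<in>\<^sub>M nats" "k \<in>\<^sub>M nats" "q \<in>\<^sub>M R" "is_ratio a b k q" "u \<prec> q" "q \<prec> v"
      using ratio_between[OF uv] by blast
    then have "Q (pair a (pair b k)) q" unfolding Q_def by blast
    then have "f $ pair a (pair b k) = q" using f(2) * by simp
    then show ?thesis using * by (intro exI[of _ "pair a (pair b k)"]) simp
  qed
  define A where "A n y \<longleftrightarrow> (\<exists>i j. i \<in>\<^sub>M nats \<and> j \<in>\<^sub>M nats \<and> n = pair i j \<and> y = f $ i)" for n y
  define B where "B n y \<longleftrightarrow> (\<exists>i j. i \<in>\<^sub>M nats \<and> j \<in>\<^sub>M nats \<and> n = pair i j \<and> y = f $ j)" for n y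
  have "y = y'" if "A n y" "A n y'" for n y y'
    using that pair_eqD unfolding A_def by metis
  moreover have "dfn (\<lambda>\<rho>. A (\<rho> 0) (\<rho> 1))"
    unfolding A_def by (intro dfn_real dft_pair)
  ultimately have "\<exists>l. is_function l nats R \<and> (\<forall>n y. n \<in>\<^sub>M nats \<longrightarrow> y \<in>\<^sub>M R \<longrightarrow> A n y \<longrightarrow> l $ n = y)"
    using zero_mem by (intro function_extending_relation)
  then obtain l where l: "is_function l nats R"
    "\<And>n y. n \<in>\<^sub>M nats \<Longrightarrow> y \<in>\<^sub>M R \<Longrightarrow> A n y \<Longrightarrow> l $ n = y" by blast
  have "y = y'" if "B n y" "B n y'" for n y y'
    using that pair_eqD unfolding B_def by metis
  moreover have "dfn (\<lambda>\<rho>. B (\<rho> 0) (\<rho> 1))"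
    unfolding B_def by (intro dfn_real dft_pair)
  ultimately have "\<exists>r. is_function r nats R \<and> (\<forall>n y. n \<in>\<^sub>M nats \<longrightarrow> y \<in>\<^sub>M R \<longrightarrow> B n y \<longrightarrow> r $ n = y)"
    using zero_mem by (intro function_extending_relation)
  then obtain r where r: "is_function r nats R"
    "\<And>n y. n \<in>\<^sub>M nats \<Longrightarrow> y \<in>\<^sub>M R \<Longrightarrow> B n y \<Longrightarrow> r $ n = y" by blast
  have "\<exists>n. n \<in>\<^sub>M nats \<and> u \<prec> l $ n \<and> l $ n \<prec> x \<and> x \<prec> r $ n \<and> r $ n \<prec> v"
    if ux: "u \<prec> x" and xv: "x \<prec> v" for u x v
  proof -
    obtain i j where ij: "i \<in>\<^sub>M nats" "u \<prec> f $ i" "f $ i \<prec> x" "j \<in>\<^sub>M nats" "x \<prec> f $ j" "f $ j \<prec> v"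
      using dense[OF ux] dense[OF xv] by blast
    have "A (pair i j) (f $ i)" "B (pair i j) (f $ j)" unfolding A_def B_def using ij by blast+
    then have "l $ pair i j = f $ i" "r $ pair i j = f $ j"
      using l(2) r(2) ij function_ap_mem[OF f(1)] by simp_all
    then show ?thesis using ij by (intro exI[of _ "pair i j"]) simp
  qed
  then show ?thesis using l(1) r(1) by blast
qed

text \<open>Countability is defined by \<open>omega\<close>, while indices live in
  \<open>nats\<close>. The graph of the recursion is the least set of pairs that contains the
  initial pair and is closed under simultaneous successors.\<close>

lemma bijection_omega_nats: "\<exists>e. bijection e omega nats"
proof -
  define cl where "cl C \<longleftrightarrow> opair empty_set zr \<in>\<^sub>M C \<and>
    (\<forall>n x. opair n x \<in>\<^sub>M C \<longrightarrow> opair (succ n) (x \<oplus> one) \<in>\<^sub>M C)" for C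
  define G where "G = sep (cprod omega nats) (\<lambda>p. \<forall>C. cl C \<longrightarrow> p \<in>\<^sub>M C)"
  have G: "p \<in>\<^sub>M G \<longleftrightarrow> p \<in>\<^sub>M cprod omega nats \<and> (\<forall>C. cl C \<longrightarrow> p \<in>\<^sub>M C)" for p
    unfolding G_def cl_def by (rule mem_sep) (intro dfn_real)
  have G_mem: "n \<in>\<^sub>M omega" "x \<in>\<^sub>M nats" if "opair n x \<in>\<^sub>M G" for n x
    using that unfolding G by simp_all
  have G0: "opair empty_set zr \<in>\<^sub>M G"
    unfolding G using omega_empty by (simp add: cl_def)
  have G_Suc: "opair (succ n) (x \<oplus> one) \<in>\<^sub>M G" if "opair n x \<in>\<^sub>M G" for n x
  proof -
    have "opair (succ n) (x \<oplus> one) \<in>\<^sub>M C" if "cl C" for C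
      using \<open>opair n x \<in>\<^sub>M G\<close> that unfolding G by (simp add: cl_def)
    then show ?thesis using G_mem[OF that] omega_succ unfolding G by simp
  qed
  \<comment> \<open>Leastness gives inversion: the pairs of \<open>G\<close> that are initial or
    successors of pairs of \<open>G\<close> form a closed set.\<close>
  have G_inv: "n = empty_set \<and> x = zr \<or> (\<exists>m y. opair m y \<in>\<^sub>M G \<and> n = succ m \<and> x = y \<oplus> one)"
    if "opair n x \<in>\<^sub>M G" for n x
  proof -
    define C where "C = sep G (\<lambda>p. p = opair empty_set zr \<or>
      (\<exists>m y. opair m y \<in>\<^sub>M G \<and> p = opair (succ m) (y \<oplus> one)))"
    have C: "p \<in>\<^sub>M C \<longleftrightarrow> p \<in>\<^sub>M G \<and> (p = opair empty_set zr \<or>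
      (\<exists>m y. opair m y \<in>\<^sub>M G \<and> p = opair (succ m) (y \<oplus> one)))" for p
      unfolding C_def by (rule mem_sep) (intro dfn_real)
    have "opair empty_set zr \<in>\<^sub>M C" using G0 unfolding C by simp
    moreover have "opair (succ n) (x \<oplus> one) \<in>\<^sub>M C" if "opair n x \<in>\<^sub>M C" for n x
      using that G_Suc unfolding C by blast
    ultimately have "cl C" unfolding cl_def by blast
    then have "opair n x \<in>\<^sub>M C" using that unfolding G by blast
    then show ?thesis unfolding C by simp
  qed
  have Suc_neq: "y \<oplus> one \<noteq> zr" if "y \<in>\<^sub>M nats" for y
    using less_add_one[of y] nats_nonneg[OF that] that by force
  have ex1: "\<exists>!x. opair n x \<in>\<^sub>M G" if "n \<in>\<^sub>M omega" for n
    using that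
  proof (rule omega_induct)
    show "dfn (\<lambda>\<rho>. \<exists>!x. opair (\<rho> 0) x \<in>\<^sub>M G)" by (intro dfn_intros)
    show "\<exists>!x. opair empty_set x \<in>\<^sub>M G"
      using G0 G_inv succ_neq_empty by metis
  next
    fix n assume "\<exists>!x. opair n x \<in>\<^sub>M G"
    then obtain x where x: "opair n x \<in>\<^sub>M G" "\<And>y. opair n y \<in>\<^sub>M G \<Longrightarrow> y = x" by blast
    show "\<exists>!x. opair (succ n) x \<in>\<^sub>M G"
    proof (rule ex1I[of _ "x \<oplus> one"])
      show "opair (succ n) (x \<oplus> one) \<in>\<^sub>M G" by (rule G_Suc[OF x(1)])
      fix y assume "opair (succ n) y \<in>\<^sub>M G"
      then obtain m w where "opair m w \<in>\<^sub>M G" "succ n = succ m" "y = w \<oplus> one"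
        using G_inv succ_neq_empty by metis
      then show "y = x \<oplus> one" using x(2) succ_inject by metis
    qed
  qed
  have ex1': "\<exists>!n. opair n x \<in>\<^sub>M G" if "x \<in>\<^sub>M nats" for x
    using that
  proof (induction rule: nats_induct)
    case dfn
    show ?case by (intro dfn_intros)
  next
    case zero
    show ?case using G0 G_inv G_mem Suc_neq by metis
  next
    case (Suc x)
    then obtain n where n: "opair n x \<in>\<^sub>M G" "\<And>m. opair m x \<in>\<^sub>M G \<Longrightarrow> m = n" by blast
    show ?case
    proof (rule ex1I[of _ "succ n"])
      show "opair (succ n) (x \<oplus> one) \<in>\<^sub>M G" by (rule G_Suc[OF n(1)])
      fix m assume "opair m (x \<oplus> one) \<in>\<^sub>M G"
      then obtain k w where k: "opair k w \<in>\<^sub>M G" "m = succ k" "x \<oplus> one = w \<oplus> one"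
        using G_inv Suc_neq[OF Suc(1)] by metis
      then have "x = w" using add_cancel[of x w one] Suc(1) G_mem by simp
      then show "m = succ n" using n(2) k by simp
    qed
  qed
  have fn: "is_function G omega nats"
    unfolding is_function_iff using ex1 G by simp
  have mem: "opair n (G $ n) \<in>\<^sub>M G" if "n \<in>\<^sub>M omega" for n
    using that opair_mem_function[OF fn] by blast
  have "injection G omega nats"
  proof (rule injectionI[OF fn])
    fix m n assume "m \<in>\<^sub>M omega" "n \<in>\<^sub>M omega" "G $ m = G $ n"
    then show "m = n" using mem[of m] mem[of n] ex1'[of "G $ n"] G_mem by metis
  qed
  then have "bijection G omega nats"
  proof (rule bijectionI)
    fix x assume "x \<in>\<^sub>M nats"
    then obtain n where "opair n x \<in>\<^sub>M G" using ex1' by blast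
    then show "\<exists>n. n \<in>\<^sub>M omega \<and> G $ n = x"
      using opair_mem_function[OF fn, of n x] by auto
  qed
  then show ?thesis by blast
qed

lemma countable_iff_nats: "countable_set X \<longleftrightarrow> (\<exists>f. injection f X nats)"
proof -
  obtain e where e: "bijection e omega nats" using bijection_omega_nats by blast
  obtain e' where e': "bijection e' nats omega" using bijection_inverse[OF e] by blast
  have "injection e omega nats" "injection e' nats omega" using e e' unfolding bijection_iff by blast+
  then show ?thesis unfolding countable_set_def using injection_compose by blast
qed

lemma finite_has_min:
  assumes "finite_set A" "A \<subseteq>\<^sub>M R" "a \<in>\<^sub>M A"
  shows "\<exists>m. m \<in>\<^sub>M A \<and> (\<forall>x. x \<in>\<^sub>M A \<longrightarrow> \<not> x \<prec> m)"
proof -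
  have "A \<subseteq>\<^sub>M R \<longrightarrow> (\<forall>a. a \<in>\<^sub>M A \<longrightarrow> (\<exists>m. m \<in>\<^sub>M A \<and> (\<forall>x. x \<in>\<^sub>M A \<longrightarrow> \<not> x \<prec> m)))"
    using assms(1)
  proof (rule finite_set_induct)
    show "dfn (\<lambda>\<rho>. \<rho> 0 \<subseteq>\<^sub>M R \<longrightarrow> (\<forall>a. a \<in>\<^sub>M \<rho> 0 \<longrightarrow> (\<exists>m. m \<in>\<^sub>M \<rho> 0 \<and> (\<forall>x. x \<in>\<^sub>M \<rho> 0 \<longrightarrow> \<not> x \<prec> m))))"
      by (intro dfn_real)
  next
    fix A a
    assume IH: "A \<subseteq>\<^sub>M R \<longrightarrow> (\<forall>a. a \<in>\<^sub>M A \<longrightarrow> (\<exists>m. m \<in>\<^sub>M A \<and> (\<forall>x. x \<in>\<^sub>M A \<longrightarrow> \<not> x \<prec> m)))"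
    have "\<exists>m. m \<in>\<^sub>M un A (upair a a) \<and> (\<forall>x. x \<in>\<^sub>M un A (upair a a) \<longrightarrow> \<not> x \<prec> m)"
      if sub: "un A (upair a a) \<subseteq>\<^sub>M R"
    proof (cases "\<exists>b. b \<in>\<^sub>M A")
      case True
      have AR: "A \<subseteq>\<^sub>M R" and a: "a \<in>\<^sub>M R" using sub by (simp_all add: subset_of_def)
      obtain m where m: "m \<in>\<^sub>M A" "\<And>x. x \<in>\<^sub>M A \<Longrightarrow> \<not> x \<prec> m" using IH AR True by blast
      have mR: "m \<in>\<^sub>M R" using m AR subset_ofD by blast
      show ?thesis
      proof (cases "a \<prec> m")
        case True
        then have "\<not> x \<prec> a" if "x \<in>\<^sub>M A" for x using m(2)[OF that] less_trans by blast
        then show ?thesis using less_irrefl by (intro exI[of _ a]) auto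
      next
        case False
        then show ?thesis using m by (intro exI[of _ m]) auto
      qed
    next
      case False
      then show ?thesis using less_irrefl by (intro exI[of _ a]) auto
    qed
    then show "un A (upair a a) \<subseteq>\<^sub>M R \<longrightarrow> (\<forall>a'. a' \<in>\<^sub>M un A (upair a a) \<longrightarrow>
        (\<exists>m. m \<in>\<^sub>M un A (upair a a) \<and> (\<forall>x. x \<in>\<^sub>M un A (upair a a) \<longrightarrow> \<not> x \<prec> m)))" by blast
  qed simp
  then show ?thesis using assms by blast
qed

subsection \<open>Embedding countable orders into countable dense orders\<close>

text \<open>Only finitely many elements have an index below \<open>n\<close>, so an extremal one
  exists; the induction finds it directly. With \<open>L\<close> the order or its reverse, it yields
  the nearest earlier neighbours of a point.\<close>

lemma best_below:
  assumes a: "is_function a X nats" and n: "n \<in>\<^sub>M nats"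
    and P: "dfn (\<lambda>\<rho>. P (\<rho> 0))" and L: "dfn (\<lambda>\<rho>. L (\<rho> 0) (\<rho> 1))"
    and inj: "\<And>x y. x \<in>\<^sub>M X \<Longrightarrow> y \<in>\<^sub>M X \<Longrightarrow> a $ x = a $ y \<Longrightarrow> x = y"
    and irrefl: "\<And>x. \<not> L x x" and trans: "\<And>x y z. L x y \<Longrightarrow> L y z \<Longrightarrow> L x z"
  shows "(\<forall>y. y \<in>\<^sub>M X \<and> a $ y \<prec> n \<longrightarrow> \<not> P y) \<or>
    (\<exists>y. y \<in>\<^sub>M X \<and> a $ y \<prec> n \<and> P y \<and> (\<forall>w. w \<in>\<^sub>M X \<and> a $ w \<prec> n \<and> P w \<longrightarrow> \<not> L y w))"
  using n
proof (induction rule: nats_induct)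
  case dfn
  show ?case by (intro dfn_real dfn1[OF P] dfn2[OF L])
next
  case zero
  show ?case using nats_nonneg function_ap_mem[OF a] by blast
next
  case (Suc n)
  have split: "a $ y \<prec> n \<oplus> one \<longleftrightarrow> a $ y \<prec> n \<or> a $ y = n" if "y \<in>\<^sub>M X" for y
    using nats_less_Suc[OF Suc(1) function_ap_mem[OF a that]] less_irrefl less_asym
      less_total[of "a $ y" n] function_ap_mem[OF a that] Suc(1) nats_real by metis
  show ?case
  proof (cases "\<exists>x. x \<in>\<^sub>M X \<and> a $ x = n \<and> P x")
    case False
    then show ?thesis using Suc(2) split by metis
  next
    case True
    then obtain x where x: "x \<in>\<^sub>M X" "a $ x = n" "P x" by blast
    have only: "w = x" if "w \<in>\<^sub>M X" "a $ w = n" for w using inj that x by metis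
    show ?thesis
    proof (cases "\<exists>y. y \<in>\<^sub>M X \<and> a $ y \<prec> n \<and> P y")
      case False
      then show ?thesis using x split only irrefl by (intro disjI2 exI[of _ x]) metis
    next
      case True
      then obtain y where y: "y \<in>\<^sub>M X" "a $ y \<prec> n" "P y"
        "\<And>w. w \<in>\<^sub>M X \<Longrightarrow> a $ w \<prec> n \<Longrightarrow> P w \<Longrightarrow> \<not> L y w" using Suc(2) by blast
      show ?thesis
      proof (cases "L y x")
        case True
        then show ?thesis using x y split only irrefl trans by (intro disjI2 exI[of _ x]) metis
      next
        case False
        then show ?thesis using x y split only by (intro disjI2 exI[of _ y]) metis
      qed
    qed
  qed
qed

text \<open>
  The embedding is defined greedily: the value at \<open>x\<close> is the first element of \<open>D\<close> in the right
  position relative to the values at the elements enumerated before \<open>x\<close>. Taking the first one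
  makes the finite approximations unique, so no choice is needed to put them together.
\<close>

lemma embed_countable_in_dense:
  assumes XR: "X \<subseteq>\<^sub>M R" and X: "countable_set X" and DR: "D \<subseteq>\<^sub>M R" and D: "countable_set D"
    and D0: "d0 \<in>\<^sub>M D"
    and dense: "\<And>x y. x \<in>\<^sub>M D \<Longrightarrow> y \<in>\<^sub>M D \<Longrightarrow> x \<prec> y \<Longrightarrow> \<exists>d. d \<in>\<^sub>M D \<and> x \<prec> d \<and> d \<prec> y"
    and above: "\<And>x. x \<in>\<^sub>M D \<Longrightarrow> \<exists>d. d \<in>\<^sub>M D \<and> x \<prec> d"
    and below: "\<And>x. x \<in>\<^sub>M D \<Longrightarrow> \<exists>d. d \<in>\<^sub>M D \<and> d \<prec> x"
  shows "\<exists>f. is_function f X D \<and> (\<forall>x y. x \<in>\<^sub>M X \<longrightarrow> y \<in>\<^sub>M X \<longrightarrow> x \<prec> y \<longrightarrow> f $ x \<prec> f $ y)"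
proof -
  obtain a where a: "injection a X nats" using X countable_iff_nats by blast
  obtain b where b: "injection b D nats" using D countable_iff_nats by blast
  have afun: "is_function a X nats" and bfun: "is_function b D nats"
    using a b unfolding injection_iff by blast+
  have aN: "a $ x \<in>\<^sub>M nats" if "x \<in>\<^sub>M X" for x using function_ap_mem[OF afun that] .
  have bN: "b $ x \<in>\<^sub>M nats" if "x \<in>\<^sub>M D" for x using function_ap_mem[OF bfun that] .
  have XR': "x \<in>\<^sub>M R" if "x \<in>\<^sub>M X" for x using subset_ofD[OF XR that] .
  have DR': "x \<in>\<^sub>M R" if "x \<in>\<^sub>M D" for x using subset_ofD[OF DR that] .
  define Xn where "Xn n = sep X (\<lambda>x. a $ x \<prec> n)" for n
  have Xn: "x \<in>\<^sub>M Xn n \<longleftrightarrow> x \<in>\<^sub>M X \<and> a $ x \<prec> n" for x n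
    unfolding Xn_def by (rule mem_sep) (intro dfn_real)
  define cand where "cand g x d \<longleftrightarrow> d \<in>\<^sub>M D \<and> (\<forall>y. y \<in>\<^sub>M X \<and> a $ y \<prec> a $ x \<longrightarrow>
    (y \<prec> x \<longrightarrow> g $ y \<prec> d) \<and> (x \<prec> y \<longrightarrow> d \<prec> g $ y))" for g x d
  define best where "best g x d \<longleftrightarrow> cand g x d \<and> (\<forall>d'. cand g x d' \<longrightarrow> \<not> b $ d' \<prec> b $ d)" for g x d
  define good where "good g n \<longleftrightarrow> is_function g (Xn n) D \<and> (\<forall>x. x \<in>\<^sub>M Xn n \<longrightarrow> best g x (g $ x))" for g n
  have best_unique: "d = d'" if "best g x d" "best g x d'" for g x d d'
    using that less_total[of "b $ d" "b $ d'"] bN nats_real injectionD[OF b]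
    unfolding best_def cand_def by metis
  have best_cong: "best g x d \<longleftrightarrow> best g' x d"
    if "\<And>y. y \<in>\<^sub>M X \<Longrightarrow> a $ y \<prec> a $ x \<Longrightarrow> g $ y = g' $ y" for g g' x d
  proof -
    have "cand g x d \<longleftrightarrow> cand g' x d" for d unfolding cand_def using that by metis
    then show ?thesis unfolding best_def by simp
  qed
  have good_agree: "g $ x = g' $ x" if g: "good g n" "good g' n'" "x \<in>\<^sub>M Xn n" "x \<in>\<^sub>M Xn n'" for g g' n n' x
  proof (rule ccontr)
    assume ne: "g $ x \<noteq> g' $ x"
    \<comment> \<open>At the first index of a disagreement both approximations have the same earlier
      values, hence the same best value.\<close>
    let ?P = "\<lambda>k. \<exists>x. x \<in>\<^sub>M X \<and> a $ x \<prec> n \<and> a $ x \<prec> n' \<and> a $ x = k \<and> g $ x \<noteq> g' $ x"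
    have "dfn (\<lambda>\<rho>. ?P (\<rho> 0))" by (intro dfn_real)
    moreover have "?P (a $ x)" "a $ x \<in>\<^sub>M nats" using ne g(3,4) Xn aN by blast+
    ultimately obtain k where k: "k \<in>\<^sub>M nats" "?P k" "\<And>j. j \<in>\<^sub>M nats \<Longrightarrow> j \<prec> k \<Longrightarrow> \<not> ?P j"
      using nats_least[of "a $ x" ?P] by blast
    then obtain y where y: "y \<in>\<^sub>M X" "a $ y \<prec> n" "a $ y \<prec> n'" "a $ y = k" "g $ y \<noteq> g' $ y" by blast
    have "g $ w = g' $ w" if "w \<in>\<^sub>M X" "a $ w \<prec> a $ y" for w
      using k(3)[of "a $ w"] that y aN less_trans by blast
    then have "best g y d \<longleftrightarrow> best g' y d" for d by (rule best_cong)
    moreover have "best g y (g $ y)" "best g' y (g' $ y)"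
      using g(1,2) y Xn unfolding good_def by blast+
    ultimately show False using best_unique y(5) by blast
  qed
  have good_mono: "g $ x \<prec> g $ y" if g: "good g n" "x \<in>\<^sub>M Xn n" "y \<in>\<^sub>M Xn n" "x \<prec> y" for g n x y
  proof -
    have xy: "x \<in>\<^sub>M X" "y \<in>\<^sub>M X" "x \<noteq> y" using g Xn less_irrefl by blast+
    have "cand g x (g $ x)" "cand g y (g $ y)" using g unfolding good_def best_def by blast+
    moreover have "a $ x \<prec> a $ y \<or> a $ y \<prec> a $ x"
      using less_total[of "a $ x" "a $ y"] aN nats_real xy injectionD[OF a] by metis
    ultimately show ?thesis using xy g(4) unfolding cand_def by blast
  qed
  have dfn_good: "dfn (\<lambda>\<rho>. good (\<rho> 0) (\<rho> 1))"
    unfolding good_def best_def cand_def Xn_def by (intro dfn_real)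
  have exists: "\<exists>g. good g n" if "n \<in>\<^sub>M nats" for n
    using that
  proof (induction rule: nats_induct)
    case dfn
    show ?case by (intro dfn_intros dfn2[OF dfn_good])
  next
    case zero
    have empty: "\<not> x \<in>\<^sub>M Xn zr" for x using Xn nats_nonneg aN by blast
    have "\<exists>f. is_function f (Xn zr) D \<and> (\<forall>x. x \<in>\<^sub>M Xn zr \<longrightarrow> f $ x = d0)"
      using D0 by (intro function_of_term dfn_intros)
    then show ?case unfolding good_def using empty by blast
  next
    case (Suc n)
    then obtain g where g: "good g n" by blast
    have gfun: "is_function g (Xn n) D" using g unfolding good_def by blast
    have split: "a $ y \<prec> n \<oplus> one \<longleftrightarrow> a $ y \<prec> n \<or> a $ y = n" if "y \<in>\<^sub>M X" for y
      using nats_less_Suc[OF Suc(1) aN[OF that]] less_irrefl less_asym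
        less_total[of "a $ y" n] aN[OF that] Suc(1) nats_real by metis
    show ?case
    proof (cases "\<exists>x. x \<in>\<^sub>M X \<and> a $ x = n")
      case False
      then have "Xn (n \<oplus> one) = Xn n" using split by (intro setI) (auto simp: Xn)
      then show ?thesis using g unfolding good_def by auto
    next
      case True
      then obtain x where x: "x \<in>\<^sub>M X" "a $ x = n" by blast
      have only: "w = x" if "w \<in>\<^sub>M X" "a $ w = n" for w using injectionD[OF a] that x by metis
      have gD: "g $ y \<in>\<^sub>M D" if "y \<in>\<^sub>M X" "a $ y \<prec> n" for y
        using function_ap_mem[OF gfun] that Xn by blast
      have gm: "g $ y \<prec> g $ y'"
        if "y \<in>\<^sub>M X" "a $ y \<prec> n" "y' \<in>\<^sub>M X" "a $ y' \<prec> n" "y \<prec> y'" for y y'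
        using good_mono[OF g] that Xn by blast
      \<comment> \<open>The earlier elements nearest to \<open>x\<close> on either side are found; a
        value placed correctly relative to theirs suits all earlier elements.\<close>
      have lower: "(\<forall>y. y \<in>\<^sub>M X \<and> a $ y \<prec> n \<longrightarrow> \<not> y \<prec> x) \<or>
        (\<exists>y. y \<in>\<^sub>M X \<and> a $ y \<prec> n \<and> y \<prec> x \<and> (\<forall>w. w \<in>\<^sub>M X \<and> a $ w \<prec> n \<and> w \<prec> x \<longrightarrow> \<not> y \<prec> w))"
      proof (rule best_below[OF afun Suc(1), of "\<lambda>y. y \<prec> x" "\<lambda>u v. u \<prec> v"])
        show "dfn (\<lambda>\<rho>. \<rho> 0 \<prec> x)" "dfn (\<lambda>\<rho>. \<rho> 0 \<prec> \<rho> 1)" by (intro dfn_real)+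
      qed (use injectionD[OF a] less_irrefl less_trans in blast)+
      have upper: "(\<forall>y. y \<in>\<^sub>M X \<and> a $ y \<prec> n \<longrightarrow> \<not> x \<prec> y) \<or>
        (\<exists>y. y \<in>\<^sub>M X \<and> a $ y \<prec> n \<and> x \<prec> y \<and> (\<forall>w. w \<in>\<^sub>M X \<and> a $ w \<prec> n \<and> x \<prec> w \<longrightarrow> \<not> w \<prec> y))"
      proof (rule best_below[OF afun Suc(1), of "\<lambda>y. x \<prec> y" "\<lambda>u v. v \<prec> u"])
        show "dfn (\<lambda>\<rho>. x \<prec> \<rho> 0)" "dfn (\<lambda>\<rho>. \<rho> 1 \<prec> \<rho> 0)" by (intro dfn_real)+
      qed (use injectionD[OF a] less_irrefl less_trans in blast)+
      have lo: "\<exists>y. y \<in>\<^sub>M X \<and> a $ y \<prec> n \<and> y \<prec> x \<and> (\<forall>w. w \<in>\<^sub>M X \<and> a $ w \<prec> n \<and> w \<prec> x \<longrightarrow> w = y \<or> w \<prec> y)"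
        if "\<exists>y. y \<in>\<^sub>M X \<and> a $ y \<prec> n \<and> y \<prec> x"
        using lower that less_total XR' by meson
      have up: "\<exists>y. y \<in>\<^sub>M X \<and> a $ y \<prec> n \<and> x \<prec> y \<and> (\<forall>w. w \<in>\<^sub>M X \<and> a $ w \<prec> n \<and> x \<prec> w \<longrightarrow> w = y \<or> y \<prec> w)"
        if "\<exists>y. y \<in>\<^sub>M X \<and> a $ y \<prec> n \<and> x \<prec> y"
        using upper that less_total XR' by meson
      have "\<exists>d. cand g x d"
      proof (cases "\<exists>y. y \<in>\<^sub>M X \<and> a $ y \<prec> n \<and> y \<prec> x")
        case no_lo: False
        show ?thesis
        proof (cases "\<exists>y. y \<in>\<^sub>M X \<and> a $ y \<prec> n \<and> x \<prec> y")
          case False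
          then show ?thesis using no_lo D0 unfolding cand_def x(2) by blast
        next
          case True
          then obtain y where y: "y \<in>\<^sub>M X" "a $ y \<prec> n" "x \<prec> y"
            "\<And>w. w \<in>\<^sub>M X \<Longrightarrow> a $ w \<prec> n \<Longrightarrow> x \<prec> w \<Longrightarrow> w = y \<or> y \<prec> w" using up by blast
          obtain d where d: "d \<in>\<^sub>M D" "d \<prec> g $ y" using below[OF gD[OF y(1,2)]] by blast
          have "d \<prec> g $ w" if "w \<in>\<^sub>M X" "a $ w \<prec> n" "x \<prec> w" for w
            using y(4)[OF that] gm[OF y(1,2) that(1,2)] d(2) less_trans by blast
          then show ?thesis using no_lo d(1) unfolding cand_def x(2) by blast
        qed
      next
        case True
        then obtain u where u: "u \<in>\<^sub>M X" "a $ u \<prec> n" "u \<prec> x"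
          "\<And>w. w \<in>\<^sub>M X \<Longrightarrow> a $ w \<prec> n \<Longrightarrow> w \<prec> x \<Longrightarrow> w = u \<or> w \<prec> u" using lo by blast
        have ulow: "g $ w \<prec> d" if "g $ u \<prec> d" "w \<in>\<^sub>M X" "a $ w \<prec> n" "w \<prec> x" for w d
          using u(4)[OF that(2-4)] gm[OF that(2,3) u(1,2)] that(1) less_trans by blast
        show ?thesis
        proof (cases "\<exists>y. y \<in>\<^sub>M X \<and> a $ y \<prec> n \<and> x \<prec> y")
          case False
          obtain d where d: "d \<in>\<^sub>M D" "g $ u \<prec> d" using above[OF gD[OF u(1,2)]] by blast
          then show ?thesis using False ulow[OF d(2)] unfolding cand_def x(2) by blast
        next
          case True
          then obtain y where y: "y \<in>\<^sub>M X" "a $ y \<prec> n" "x \<prec> y"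
            "\<And>w. w \<in>\<^sub>M X \<Longrightarrow> a $ w \<prec> n \<Longrightarrow> x \<prec> w \<Longrightarrow> w = y \<or> y \<prec> w" using up by blast
          have "u \<prec> y" using u(3) y(3) less_trans by blast
          then obtain d where d: "d \<in>\<^sub>M D" "g $ u \<prec> d" "d \<prec> g $ y"
            using dense[OF gD[OF u(1,2)] gD[OF y(1,2)] gm[OF u(1,2) y(1,2)]] by blast
          have "d \<prec> g $ w" if "w \<in>\<^sub>M X" "a $ w \<prec> n" "x \<prec> w" for w
            using y(4)[OF that] gm[OF y(1,2) that(1,2)] d(3) less_trans by blast
          then show ?thesis using ulow[OF d(2)] d(1) unfolding cand_def x(2) by blast
        qed
      qed
      \<comment> \<open>This local \<open>d0\<close> shadows the element of \<open>D\<close> fixed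
        in the assumptions. It only shows that some index in \<open>b\<close> is admissible, so that
        the first one can be taken.\<close>
      then obtain d0 where d0: "cand g x d0" by blast
      let ?P = "\<lambda>k. \<exists>d. cand g x d \<and> b $ d = k"
      have "dfn (\<lambda>\<rho>. ?P (\<rho> 0))" unfolding cand_def by (intro dfn_real)
      moreover have "?P (b $ d0)" "b $ d0 \<in>\<^sub>M nats" using d0 bN unfolding cand_def by blast+
      ultimately obtain k where k: "k \<in>\<^sub>M nats" "?P k" "\<And>j. j \<in>\<^sub>M nats \<Longrightarrow> j \<prec> k \<Longrightarrow> \<not> ?P j"
        using nats_least[of "b $ d0" ?P] by blast
      then obtain d where d: "cand g x d" "b $ d = k" by blast
      have dbest: "best g x d"
        unfolding best_def using d k(3) bN unfolding cand_def by blast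
      have dD: "d \<in>\<^sub>M D" using d unfolding cand_def by blast
      have "\<exists>h. is_function h (Xn (n \<oplus> one)) D \<and> (\<forall>y. y \<in>\<^sub>M Xn (n \<oplus> one) \<longrightarrow> h $ y = (if y = x then d else g $ y))"
      proof (rule function_of_term)
        show "dft (\<lambda>\<rho>. if \<rho> 0 = x then d else g $ \<rho> 0)" by (intro dfn_intros)
        show "(if y = x then d else g $ y) \<in>\<^sub>M D" if "y \<in>\<^sub>M Xn (n \<oplus> one)" for y
          using that split only gD dD unfolding Xn by auto
      qed
      then obtain h where h: "is_function h (Xn (n \<oplus> one)) D"
        "\<And>y. y \<in>\<^sub>M Xn (n \<oplus> one) \<Longrightarrow> h $ y = (if y = x then d else g $ y)" by blast
      have hg: "h $ y = g $ y" if "y \<in>\<^sub>M X" "a $ y \<prec> n" for y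
      proof -
        have "y \<in>\<^sub>M Xn (n \<oplus> one)" using that split Xn by blast
        moreover have "y \<noteq> x" using that x less_irrefl by blast
        ultimately show ?thesis using h(2) by simp
      qed
      have hx: "h $ x = d" using h(2)[of x] x less_add_one[of n] Suc(1) Xn by simp
      have "best h y (h $ y)" if y: "y \<in>\<^sub>M Xn (n \<oplus> one)" for y
      proof (cases "y = x")
        case True
        have "best h x d \<longleftrightarrow> best g x d" by (rule best_cong) (use hg x in simp)
        then show ?thesis using dbest hx True by simp
      next
        case False
        then have y': "y \<in>\<^sub>M X" "a $ y \<prec> n" using y split only unfolding Xn by blast+
        have "best h y (g $ y) \<longleftrightarrow> best g y (g $ y)"
          by (rule best_cong) (use hg y' less_trans in blast)
        then show ?thesis using g y' hg Xn unfolding good_def by simp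
      qed
      then have "good h (n \<oplus> one)" unfolding good_def using h(1) by blast
      then show ?thesis by blast
    qed
  qed
  \<comment> \<open>The value at \<open>x\<close> may be read from any approximation defined there;
    \<open>good_agree\<close> makes it unique.\<close>
  let ?Q = "\<lambda>x d. \<exists>n g. n \<in>\<^sub>M nats \<and> good g n \<and> x \<in>\<^sub>M Xn n \<and> d = g $ x"
  have "\<exists>f. is_function f X D \<and> (\<forall>x. x \<in>\<^sub>M X \<longrightarrow> ?Q x (f $ x))"
  proof (rule function_of_relation)
    show "dfn (\<lambda>\<rho>. ?Q (\<rho> 0) (\<rho> 1))"
      unfolding Xn_def by (intro dfn_real dfn2[OF dfn_good])
    fix x assume x: "x \<in>\<^sub>M X"
    have n: "a $ x \<oplus> one \<in>\<^sub>M nats" using aN[OF x] by simp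
    obtain g where g: "good g (a $ x \<oplus> one)" using exists[OF n] by blast
    have xn: "x \<in>\<^sub>M Xn (a $ x \<oplus> one)" using less_add_one aN[OF x] x unfolding Xn by simp
    show "\<exists>!d. d \<in>\<^sub>M D \<and> ?Q x d"
    proof (rule ex1I[of _ "g $ x"])
      show "g $ x \<in>\<^sub>M D \<and> ?Q x (g $ x)"
        using g n xn function_ap_mem unfolding good_def by blast
      fix d assume "d \<in>\<^sub>M D \<and> ?Q x d"
      then obtain n' g' where "good g' n'" "x \<in>\<^sub>M Xn n'" "d = g' $ x" by blast
      then show "d = g $ x" using good_agree[of g' n' g _ x] g xn by simp
    qed
  qed
  then obtain f where f: "is_function f X D" "\<And>x. x \<in>\<^sub>M X \<Longrightarrow> ?Q x (f $ x)" by blast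
  have f_good: "f $ x = g $ x" if "good g n" "x \<in>\<^sub>M Xn n" for g n x
  proof -
    have "x \<in>\<^sub>M X" using that(2) Xn by blast
    then obtain n' g' where "good g' n'" "x \<in>\<^sub>M Xn n'" "f $ x = g' $ x" using f(2) by blast
    then show ?thesis using good_agree[of g' n' g n x] that by simp
  qed
  have "f $ x \<prec> f $ y" if xy: "x \<in>\<^sub>M X" "y \<in>\<^sub>M X" "x \<prec> y" for x y
  proof -
    obtain n where n: "n \<in>\<^sub>M nats" "a $ x \<prec> n" "a $ y \<prec> n"
    proof (cases "a $ x \<prec> a $ y")
      case True
      then show ?thesis
        using that[of "a $ y \<oplus> one"] less_add_one[of "a $ y"] less_trans aN xy nats_real nats_Suc by blast
    next
      case False
      then have "a $ y \<prec> a $ x \<oplus> one" using nats_less_Suc aN xy by blast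
      then show ?thesis
        using that[of "a $ x \<oplus> one"] less_add_one[of "a $ x"] aN xy nats_real nats_Suc by blast
    qed
    obtain g where g: "good g n" using exists n by blast
    then show ?thesis using f_good[OF g] good_mono[OF g] n xy Xn by simp
  qed
  then show ?thesis using f(1) by blast
qed

subsection \<open>Countable infinite sets of reals are inexact\<close>

lemma order_preserving_real:
  assumes "X \<subseteq>\<^sub>M R"
  shows "order_preserving f X lt \<longleftrightarrow> is_function f X X \<and>
    (\<forall>x y. x \<in>\<^sub>M X \<longrightarrow> y \<in>\<^sub>M X \<longrightarrow> x \<prec> y \<longrightarrow> f $ x \<prec> f $ y)"
  unfolding order_preserving_iff
  using subset_ofD[OF assms] function_ap_mem[of f X X] by (auto simp: less_def)

lemma inexact_real_iff:
  assumes "X \<subseteq>\<^sub>M R"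
  shows "inexact X lt \<longleftrightarrow> (\<exists>f x. is_function f X X \<and>
    (\<forall>x y. x \<in>\<^sub>M X \<longrightarrow> y \<in>\<^sub>M X \<longrightarrow> x \<prec> y \<longrightarrow> f $ x \<prec> f $ y) \<and> x \<in>\<^sub>M X \<and> f $ x \<noteq> x)"
  unfolding inexact_def exact_iff order_preserving_real[OF assms] by blast

text \<open>Lets each argument be carried out once for the order and its reverse. Irreflexivity and
  transitivity hold everywhere because \<open>less\<close> includes membership in \<open>R\<close>;
  totality can hold only on \<open>R\<close>.\<close>

definition linear_rel :: "('a \<Rightarrow> 'a \<Rightarrow> bool) \<Rightarrow> bool" where
  "linear_rel L \<longleftrightarrow> dfn (\<lambda>\<rho>. L (\<rho> 0) (\<rho> 1)) \<and> (\<forall>x. \<not> L x x) \<and>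
    (\<forall>x y z. L x y \<longrightarrow> L y z \<longrightarrow> L x z) \<and> (\<forall>x y. x \<in>\<^sub>M R \<longrightarrow> y \<in>\<^sub>M R \<longrightarrow> L x y \<or> x = y \<or> L y x)"

lemma linear_rel_less: "linear_rel (\<lambda>x y. x \<prec> y)"
  unfolding linear_rel_def using less_irrefl less_trans less_total
  by (intro conjI dfn_real) blast+

lemma linear_rel_greater: "linear_rel (\<lambda>x y. y \<prec> x)"
  unfolding linear_rel_def using less_irrefl less_trans less_total
  by (intro conjI dfn_real) blast+

text \<open>Points of \<open>C\<close> move to their immediate successors and all others stay. Order
  is kept strictly: a point beyond \<open>x\<close> lies at or beyond the successor of
  \<open>x\<close>, and if it equals that successor it is in \<open>C\<close> and moves on
  itself.\<close>

lemma shift_along_successors: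
  assumes L: "linear_rel L" and CX: "C \<subseteq>\<^sub>M X" and c: "c \<in>\<^sub>M C"
    and succ: "\<And>x. x \<in>\<^sub>M C \<Longrightarrow> \<exists>y. y \<in>\<^sub>M C \<and> L x y \<and> (\<forall>z. z \<in>\<^sub>M X \<longrightarrow> L x z \<longrightarrow> z = y \<or> L y z)"
  shows "\<exists>f. is_function f X X \<and> (\<forall>x y. x \<in>\<^sub>M X \<longrightarrow> y \<in>\<^sub>M X \<longrightarrow> L x y \<longrightarrow> L (f $ x) (f $ y)) \<and> f $ c \<noteq> c"
proof -
  have dfnL: "dfn (\<lambda>\<rho>. L (\<rho> 0) (\<rho> 1))" and irrefl: "\<And>x. \<not> L x x"
    and trans: "\<And>x y z. L x y \<Longrightarrow> L y z \<Longrightarrow> L x z"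
    using L unfolding linear_rel_def by blast+
  have CX': "x \<in>\<^sub>M X" if "x \<in>\<^sub>M C" for x using subset_ofD[OF CX that] .
  define S where "S x y \<longleftrightarrow> y \<in>\<^sub>M C \<and> L x y \<and> (\<forall>z. z \<in>\<^sub>M X \<longrightarrow> L x z \<longrightarrow> z = y \<or> L y z)" for x y
  have S_unique: "y = y'" if "S x y" "S x y'" for x y y'
    using that irrefl trans CX' unfolding S_def by metis
  let ?Q = "\<lambda>x y. x \<in>\<^sub>M C \<and> S x y \<or> \<not> x \<in>\<^sub>M C \<and> y = x"
  have "\<exists>f. is_function f X X \<and> (\<forall>x. x \<in>\<^sub>M X \<longrightarrow> ?Q x (f $ x))"
  proof (rule function_of_relation)
    show "dfn (\<lambda>\<rho>. ?Q (\<rho> 0) (\<rho> 1))"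
      unfolding S_def by (intro dfn_intros dfn2[OF dfnL])
    fix x assume x: "x \<in>\<^sub>M X"
    show "\<exists>!y. y \<in>\<^sub>M X \<and> ?Q x y"
    proof (cases "x \<in>\<^sub>M C")
      case True
      then obtain y where y: "S x y" using succ unfolding S_def by blast
      have "y \<in>\<^sub>M X" using y CX' unfolding S_def by blast
      then show ?thesis using True y S_unique by (intro ex1I[of _ y]) blast+
    next
      case False
      then show ?thesis using x by (intro ex1I[of _ x]) blast+
    qed
  qed
  then obtain f where f: "is_function f X X" "\<And>x. x \<in>\<^sub>M X \<Longrightarrow> ?Q x (f $ x)" by blast
  have "L (f $ x) (f $ y)" if x: "x \<in>\<^sub>M X" and y: "y \<in>\<^sub>M X" and xy: "L x y" for x y
  proof -
    have fy: "f $ y = y \<or> L y (f $ y)" using f(2)[OF y] unfolding S_def by blast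
    show ?thesis
    proof (cases "x \<in>\<^sub>M C")
      case True
      then have S: "S x (f $ x)" using f(2)[OF x] by blast
      then have "y = f $ x \<or> L (f $ x) y" using xy y unfolding S_def by blast
      moreover have "f $ x \<in>\<^sub>M C" using S unfolding S_def by blast
      then have "L y (f $ y)" if "y = f $ x" using that f(2)[OF y] unfolding S_def by simp
      ultimately show ?thesis using fy trans by metis
    next
      case False
      then have "f $ x = x" using f(2)[OF x] by blast
      then show ?thesis using xy fy trans by metis
    qed
  qed
  moreover have "f $ c \<noteq> c" using f(2)[OF CX'[OF c]] c irrefl unfolding S_def by metis
  ultimately show ?thesis using f(1) by blast
qed

text \<open>For an exact \<open>X\<close> this reads: a definable \<open>P\<close> that holds
  somewhere on \<open>X\<close> holds at a point with no immediate successor satisfying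
  \<open>P\<close>. The countable case uses it in this form for several \<open>P\<close>.\<close>

lemma successor_closed_inexact:
  assumes XR: "X \<subseteq>\<^sub>M R" and P: "dfn (\<lambda>\<rho>. P (\<rho> 0))" and c: "c \<in>\<^sub>M X" "P c"
    and succ: "\<And>x. x \<in>\<^sub>M X \<Longrightarrow> P x \<Longrightarrow>
      \<exists>y. y \<in>\<^sub>M X \<and> P y \<and> x \<prec> y \<and> (\<forall>z. z \<in>\<^sub>M X \<longrightarrow> x \<prec> z \<longrightarrow> z = y \<or> y \<prec> z)"
  shows "inexact X lt"
proof -
  have C: "x \<in>\<^sub>M sep X P \<longleftrightarrow> x \<in>\<^sub>M X \<and> P x" for x by (rule mem_sep[OF P])
  have "\<exists>f. is_function f X X \<and> (\<forall>x y. x \<in>\<^sub>M X \<longrightarrow> y \<in>\<^sub>M X \<longrightarrow> x \<prec> y \<longrightarrow> f $ x \<prec> f $ y) \<and> f $ c \<noteq> c"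
    by (rule shift_along_successors[OF linear_rel_less, of "sep X P"])
      (use c succ in \<open>auto simp: C subset_of_def\<close>)
  then show ?thesis unfolding inexact_real_iff[OF XR] using c(1) by blast
qed

lemma predecessor_closed_inexact:
  assumes XR: "X \<subseteq>\<^sub>M R" and P: "dfn (\<lambda>\<rho>. P (\<rho> 0))" and c: "c \<in>\<^sub>M X" "P c"
    and pred: "\<And>x. x \<in>\<^sub>M X \<Longrightarrow> P x \<Longrightarrow>
      \<exists>y. y \<in>\<^sub>M X \<and> P y \<and> y \<prec> x \<and> (\<forall>z. z \<in>\<^sub>M X \<longrightarrow> z \<prec> x \<longrightarrow> z = y \<or> z \<prec> y)"
  shows "inexact X lt"
proof -
  have C: "x \<in>\<^sub>M sep X P \<longleftrightarrow> x \<in>\<^sub>M X \<and> P x" for x by (rule mem_sep[OF P])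
  have "\<exists>f. is_function f X X \<and> (\<forall>x y. x \<in>\<^sub>M X \<longrightarrow> y \<in>\<^sub>M X \<longrightarrow> y \<prec> x \<longrightarrow> f $ y \<prec> f $ x) \<and> f $ c \<noteq> c"
    by (rule shift_along_successors[OF linear_rel_greater, of "sep X P"])
      (use c pred in \<open>auto simp: C subset_of_def\<close>)
  then show ?thesis unfolding inexact_real_iff[OF XR] using c(1) by blast
qed

text \<open>
  If no nonempty subset is closed under immediate successors or under immediate predecessors, then
  the elements without an immediate successor are densely ordered, and there are at least two of
  them unless the set is finite.
\<close>

lemma countable_infinite_inexact:
  assumes XR: "X \<subseteq>\<^sub>M R" and X: "countable_set X" and inf: "\<not> finite_set X"
  shows "inexact X lt"
proof (rule ccontr)
  assume ex: "\<not> inexact X lt"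
  have XR': "x \<in>\<^sub>M R" if "x \<in>\<^sub>M X" for x using subset_ofD[OF XR that] .
  have tot: "x \<prec> y \<or> x = y \<or> y \<prec> x" if "x \<in>\<^sub>M X" "y \<in>\<^sub>M X" for x y
    using less_total XR' that by blast
  define S where "S x y \<longleftrightarrow> x \<prec> y \<and> (\<forall>z. z \<in>\<^sub>M X \<longrightarrow> x \<prec> z \<longrightarrow> z = y \<or> y \<prec> z)" for x y
  define Pr where "Pr x y \<longleftrightarrow> y \<prec> x \<and> (\<forall>z. z \<in>\<^sub>M X \<longrightarrow> z \<prec> x \<longrightarrow> z = y \<or> z \<prec> y)" for x y
  have S_iff_Pr: "S x y \<longleftrightarrow> Pr y x" if "x \<in>\<^sub>M X" "y \<in>\<^sub>M X" for x y
    using that tot less_irrefl less_trans unfolding S_def Pr_def by metis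
  have noS: "\<exists>x. x \<in>\<^sub>M X \<and> P x \<and> \<not> (\<exists>y. y \<in>\<^sub>M X \<and> P y \<and> S x y)"
    if "dfn (\<lambda>\<rho>. P (\<rho> 0))" "c \<in>\<^sub>M X" "P c" for P c
    using successor_closed_inexact[OF XR that] ex unfolding S_def by blast
  have noP: "\<exists>x. x \<in>\<^sub>M X \<and> P x \<and> \<not> (\<exists>y. y \<in>\<^sub>M X \<and> P y \<and> Pr x y)"
    if "dfn (\<lambda>\<rho>. P (\<rho> 0))" "c \<in>\<^sub>M X" "P c" for P c
    using predecessor_closed_inexact[OF XR that] ex unfolding Pr_def by blast
  define D where "D = sep X (\<lambda>x. \<not> (\<exists>y. y \<in>\<^sub>M X \<and> S x y))"
  have D: "x \<in>\<^sub>M D \<longleftrightarrow> x \<in>\<^sub>M X \<and> \<not> (\<exists>y. y \<in>\<^sub>M X \<and> S x y)" for x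
    unfolding D_def S_def by (rule mem_sep) (intro dfn_real)
  \<comment> \<open>A point of \<open>P\<close> below \<open>z\<close> whose successor does not stay
    in \<open>P\<close> below \<open>z\<close> has no successor at all: that successor could only be
    \<open>z\<close>, which has no predecessor.\<close>
  have initial: "\<exists>x. x \<in>\<^sub>M D \<and> P x \<and> x \<prec> z"
    if z: "z \<in>\<^sub>M X" "\<And>y. y \<in>\<^sub>M X \<Longrightarrow> \<not> Pr z y" and P: "dfn (\<lambda>\<rho>. P (\<rho> 0))"
      and P_up: "\<And>x y. P x \<Longrightarrow> x \<prec> y \<Longrightarrow> P y" and w: "w \<in>\<^sub>M X" "P w" "w \<prec> z" for z P w
  proof (rule ccontr)
    assume no: "\<not> (\<exists>x. x \<in>\<^sub>M D \<and> P x \<and> x \<prec> z)"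
    have "dfn (\<lambda>\<rho>. P (\<rho> 0) \<and> \<rho> 0 \<prec> z)" using P by (intro dfn_real)
    then obtain x where x: "x \<in>\<^sub>M X" "P x" "x \<prec> z" "\<not> (\<exists>y. y \<in>\<^sub>M X \<and> (P y \<and> y \<prec> z) \<and> S x y)"
      using noS[of "\<lambda>x. P x \<and> x \<prec> z" w] w by blast
    then obtain y where y: "y \<in>\<^sub>M X" "S x y" using no D by blast
    have "\<not> S x z" using z x(1) S_iff_Pr by blast
    then have "y \<prec> z" using y x(3) z(1) unfolding S_def by blast
    moreover have "P y" using P_up x(2) y(2) unfolding S_def by blast
    ultimately show False using x(4) y by blast
  qed
  have dense: "\<exists>y. y \<in>\<^sub>M D \<and> d \<prec> y \<and> y \<prec> d'" if d: "d \<in>\<^sub>M D" "d' \<in>\<^sub>M D" "d \<prec> d'" for d d'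
  proof -
    \<comment> \<open>Take \<open>z\<close> above \<open>d\<close> and at most \<open>d'\<close>
      whose predecessor, if any, leaves this range. The predecessor would have to be
      \<open>d\<close>, but \<open>d\<close> has no successor; so \<open>z\<close> has no
      predecessor and \<open>initial\<close> gives a point of \<open>D\<close> below it.\<close>
    have "dfn (\<lambda>\<rho>. d \<prec> \<rho> 0 \<and> \<not> d' \<prec> \<rho> 0)" by (intro dfn_real)
    then obtain z where z: "z \<in>\<^sub>M X" "d \<prec> z" "\<not> d' \<prec> z" "\<not> (\<exists>y. y \<in>\<^sub>M X \<and> (d \<prec> y \<and> \<not> d' \<prec> y) \<and> Pr z y)"
      using noP[of "\<lambda>z. d \<prec> z \<and> \<not> d' \<prec> z" d'] d D less_irrefl by blast
    have no_pred: "\<not> Pr z y" if y: "y \<in>\<^sub>M X" for y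
    proof
      assume Pr: "Pr z y"
      then have "d = y \<or> d \<prec> y" using z(2) d(1) D unfolding Pr_def by blast
      moreover have "d \<noteq> y" using d(1) D S_iff_Pr y z(1) Pr by blast
      moreover have "\<not> d' \<prec> y" using Pr z(3) less_trans unfolding Pr_def by blast
      ultimately show False using z(4) y Pr by blast
    qed
    obtain w where w: "w \<in>\<^sub>M X" "w \<prec> z" "d \<prec> w"
      using no_pred[of d] d(1) D z(2) tot unfolding Pr_def by blast
    have "dfn (\<lambda>\<rho>. d \<prec> \<rho> 0)" by (intro dfn_real)
    then have "\<exists>x. x \<in>\<^sub>M D \<and> d \<prec> x \<and> x \<prec> z"
      using initial[of z "\<lambda>x. d \<prec> x" w] z(1) no_pred w less_trans by blast
    then show ?thesis using less_le_trans[of d' _ z] z(3) d(2) D XR' by blast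
  qed
  have "\<exists>d0 d1. d0 \<in>\<^sub>M D \<and> d1 \<in>\<^sub>M D \<and> d0 \<prec> d1"
  proof (rule ccontr)
    assume single: "\<not> (\<exists>d0 d1. d0 \<in>\<^sub>M D \<and> d1 \<in>\<^sub>M D \<and> d0 \<prec> d1)"
    have "X \<noteq> empty_set" using inf finite_empty by blast
    then obtain x0 where x0: "x0 \<in>\<^sub>M X" using setI[of X empty_set] not_mem_empty by blast
    obtain d where d: "d \<in>\<^sub>M D" using noS[OF dfn_const x0, of True] D by blast
    have dX: "d \<in>\<^sub>M X" using d D by blast
    have only: "y = d" if "y \<in>\<^sub>M D" for y using single tot D that d by blast
    have d_max: "\<not> d \<prec> x" if x: "x \<in>\<^sub>M X" for x
    proof
      assume dx: "d \<prec> x"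
      have "dfn (\<lambda>\<rho>. d \<prec> \<rho> 0)" by (intro dfn_real)
      then obtain y where y: "y \<in>\<^sub>M X" "d \<prec> y" "\<not> (\<exists>w. w \<in>\<^sub>M X \<and> d \<prec> w \<and> S y w)"
        using noS[of "\<lambda>y. d \<prec> y" x] x dx by blast
      then have "y \<in>\<^sub>M D" unfolding D using less_trans unfolding S_def by blast
      then show False using only y(2) less_irrefl by blast
    qed
    obtain z where z: "z \<in>\<^sub>M X" "\<And>y. y \<in>\<^sub>M X \<Longrightarrow> \<not> Pr z y" using noP[OF dfn_const x0, of True] by blast
    have z_min: "\<not> x \<prec> z" if x: "x \<in>\<^sub>M X" for x
    proof
      assume xz: "x \<prec> z"
      have "\<exists>y. y \<in>\<^sub>M D \<and> True \<and> y \<prec> z"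
        by (rule initial[OF z dfn_const _ x TrueI xz])
      then show False using only d_max z(1) by blast
    qed
    \<comment> \<open>Finiteness of the initial segment starts at the minimum \<open>z\<close> and
      passes to immediate successors, so it can stop only at \<open>d\<close>, the point without
      successor. As \<open>d\<close> is the maximum, \<open>X\<close> would be finite.\<close>
    define I where "I x = sep X (\<lambda>y. \<not> x \<prec> y)" for x
    have I: "y \<in>\<^sub>M I x \<longleftrightarrow> y \<in>\<^sub>M X \<and> \<not> x \<prec> y" for x y
      unfolding I_def by (rule mem_sep) (intro dfn_real)
    have "I z \<subseteq>\<^sub>M un empty_set (upair z z)"
      using tot z_min z(1) by (auto simp: subset_of_def I)
    then have Iz: "finite_set (I z)" using finite_subset finite_insert finite_empty by blast
    have "dfn (\<lambda>\<rho>. finite_set (I (\<rho> 0)))" unfolding I_def by (intro dfn_real)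
    then obtain x where x: "x \<in>\<^sub>M X" "finite_set (I x)" "\<not> (\<exists>y. y \<in>\<^sub>M X \<and> finite_set (I y) \<and> S x y)"
      using noS[of "\<lambda>x. finite_set (I x)" z] z(1) Iz by blast
    have "x = d"
    proof (rule ccontr)
      assume "x \<noteq> d"
      then obtain y where y: "y \<in>\<^sub>M X" "S x y" using x(1) only D by blast
      have "I y \<subseteq>\<^sub>M un (I x) (upair y y)"
        using y(2) unfolding S_def by (auto simp: subset_of_def I)
      then have "finite_set (I y)" using finite_subset finite_insert x(2) by blast
      then show False using x(3) y by blast
    qed
    moreover have "X \<subseteq>\<^sub>M I d" using d_max by (simp add: subset_of_def I)
    ultimately show False using x(2) finite_subset inf by blast
  qed
  then obtain d0 d1 where d01: "d0 \<in>\<^sub>M D" "d1 \<in>\<^sub>M D" "d0 \<prec> d1" by blast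
  \<comment> \<open>An open interval of \<open>D\<close> has no end points, and it leaves
    \<open>d0\<close> out, so an embedding of \<open>X\<close> into it moves
    \<open>d0\<close>.\<close>
  define E where "E = sep D (\<lambda>y. d0 \<prec> y \<and> y \<prec> d1)"
  have E: "y \<in>\<^sub>M E \<longleftrightarrow> y \<in>\<^sub>M D \<and> d0 \<prec> y \<and> y \<prec> d1" for y
    unfolding E_def by (rule mem_sep) (intro dfn_real)
  have EX: "E \<subseteq>\<^sub>M X" using E D by (simp add: subset_of_def)
  have ER: "E \<subseteq>\<^sub>M R" using EX XR by (simp add: subset_of_def)
  obtain e0 where e0: "e0 \<in>\<^sub>M E" using dense[OF d01] E by blast
  have "\<exists>f. is_function f X E \<and> (\<forall>x y. x \<in>\<^sub>M X \<longrightarrow> y \<in>\<^sub>M X \<longrightarrow> x \<prec> y \<longrightarrow> f $ x \<prec> f $ y)"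
  proof (rule embed_countable_in_dense[OF XR X ER countable_subset[OF X EX] e0])
    show "\<exists>d. d \<in>\<^sub>M E \<and> x \<prec> d \<and> d \<prec> y" if "x \<in>\<^sub>M E" "y \<in>\<^sub>M E" "x \<prec> y" for x y
      using dense[of x y] that less_trans unfolding E by blast
    show "\<exists>d. d \<in>\<^sub>M E \<and> x \<prec> d" if "x \<in>\<^sub>M E" for x
      using dense[of x d1] that d01 less_trans unfolding E by blast
    show "\<exists>d. d \<in>\<^sub>M E \<and> d \<prec> x" if "x \<in>\<^sub>M E" for x
      using dense[of d0 x] that d01 less_trans unfolding E by blast
  qed
  then obtain f where f: "is_function f X E"
    "\<And>x y. x \<in>\<^sub>M X \<Longrightarrow> y \<in>\<^sub>M X \<Longrightarrow> x \<prec> y \<Longrightarrow> f $ x \<prec> f $ y" by blast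
  have d0X: "d0 \<in>\<^sub>M X" using d01 D by blast
  have "f $ d0 \<noteq> d0" using function_ap_mem[OF f(1) d0X] E less_irrefl by metis
  then have "inexact X lt"
    unfolding inexact_real_iff[OF XR] using function_weaken[OF f(1) EX] f(2) d0X by blast
  then show False using ex by blast
qed

end

text \<open>Fixing one enumeration of intervals makes the first index of a property canonical; as
  elements of the model, \<open>l\<close> and \<open>r\<close> may occur as parameters in
  formulas.\<close>

locale real_base = real_model mem R lt pl ml zr one
  for mem :: "'a \<Rightarrow> 'a \<Rightarrow> bool"  (infix \<open>\<in>\<^sub>M\<close> 50) and R lt pl ml zr one +
  fixes l r :: 'a
  assumes l_function: "is_function l nats R" and r_function: "is_function r nats R"
    and base: "u \<prec> x \<Longrightarrow> x \<prec> v \<Longrightarrow>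
      \<exists>n. n \<in>\<^sub>M nats \<and> u \<prec> l $ n \<and> l $ n \<prec> x \<and> x \<prec> r $ n \<and> r $ n \<prec> v"
begin

section \<open>Inexactness and partitions\<close>

lemma l_real [simp]: "n \<in>\<^sub>M nats \<Longrightarrow> l $ n \<in>\<^sub>M R"
  by (rule function_ap_mem[OF l_function])

lemma l_dense: "u \<prec> v \<Longrightarrow> \<exists>n. n \<in>\<^sub>M nats \<and> u \<prec> l $ n \<and> l $ n \<prec> v"
  using base[of u v "v \<oplus> one"] less_add_one[of v] less_mem(2) by blast

definition first :: "('a \<Rightarrow> bool) \<Rightarrow> 'a \<Rightarrow> bool" where
  "first P n \<longleftrightarrow> n \<in>\<^sub>M nats \<and> P n \<and> (\<forall>m. m \<in>\<^sub>M nats \<longrightarrow> m \<prec> n \<longrightarrow> \<not> P m)"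

lemma first_unique: "first P m \<Longrightarrow> first P n \<Longrightarrow> m = n"
  unfolding first_def using less_total[of m n] nats_real by blast

lemma first_exists: "n \<in>\<^sub>M nats \<Longrightarrow> P n \<Longrightarrow> dfn (\<lambda>\<rho>. P (\<rho> 0)) \<Longrightarrow> \<exists>m. first P m"
  unfolding first_def by (rule nats_least)

subsection \<open>Uncountable sets split into two infinite parts\<close>

definition low :: "'a \<Rightarrow> 'a \<Rightarrow> 'a" where
  "low Y c = sep Y (\<lambda>y. y \<prec> c)"

definition up :: "'a \<Rightarrow> 'a \<Rightarrow> 'a" where
  "up Y c = sep Y (\<lambda>y. \<not> y \<prec> c)"

lemma mem_low: "y \<in>\<^sub>M low Y c \<longleftrightarrow> y \<in>\<^sub>M Y \<and> y \<prec> c"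
  unfolding low_def by (rule mem_sep) (intro dfn_real)

lemma mem_up: "y \<in>\<^sub>M up Y c \<longleftrightarrow> y \<in>\<^sub>M Y \<and> \<not> y \<prec> c"
  unfolding up_def by (rule mem_sep) (intro dfn_real)

text \<open>The left ends of the base double as an enumeration of a dense set of cut points.\<close>

definition splits :: "'a \<Rightarrow> 'a \<Rightarrow> bool" where
  "splits Y n \<longleftrightarrow> \<not> finite_set (low Y (l $ n)) \<and> \<not> finite_set (up Y (l $ n))"

text \<open>A rational between two points of \<open>H\<close> that are limits of \<open>H\<close>
  from the right would split \<open>H\<close>, so without a splitting rational there is at most one
  such point. Every other point is followed by a gap of \<open>H\<close> containing a rational, and
  the first such rational determines the point.\<close>

lemma uncountable_splits:
  assumes HR: "H \<subseteq>\<^sub>M R" and H: "\<not> countable_set H"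
  shows "\<exists>n. n \<in>\<^sub>M nats \<and> splits H n"
proof (rule ccontr)
  assume none: "\<not> (\<exists>n. n \<in>\<^sub>M nats \<and> splits H n)"
  have HR': "x \<in>\<^sub>M R" if "x \<in>\<^sub>M H" for x using subset_ofD[OF HR that] .
  define ri where "ri y n \<longleftrightarrow> y \<prec> l $ n \<and> \<not> (\<exists>w. w \<in>\<^sub>M H \<and> y \<prec> w \<and> \<not> l $ n \<prec> w)" for y n
  \<comment> \<open>Points of \<open>H\<close> come arbitrarily close to \<open>y\<close> from the
    right, so the points in a right neighbourhood have no least element.\<close>
  have limit: "\<not> finite_set A"
    if y: "y \<in>\<^sub>M H" "\<And>n. n \<in>\<^sub>M nats \<Longrightarrow> \<not> ri y n" and v: "y \<prec> v"
      and A: "\<And>w. w \<in>\<^sub>M A \<longleftrightarrow> w \<in>\<^sub>M H \<and> y \<prec> w \<and> w \<prec> v" for A y v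
  proof
    assume fin: "finite_set A"
    have near: "\<exists>w. w \<in>\<^sub>M H \<and> y \<prec> w \<and> w \<prec> u" if u: "y \<prec> u" for u
    proof -
      obtain n where n: "n \<in>\<^sub>M nats" "y \<prec> l $ n" "l $ n \<prec> u" using l_dense[OF u] by blast
      then obtain w where "w \<in>\<^sub>M H" "y \<prec> w" "\<not> l $ n \<prec> w" using y(2) unfolding ri_def by blast
      then show ?thesis using le_less_trans[of w "l $ n" u] n HR' by blast
    qed
    obtain w where "w \<in>\<^sub>M A" using near[OF v] A by blast
    moreover have "A \<subseteq>\<^sub>M R" using A HR' by (simp add: subset_of_def)
    ultimately obtain m where m: "m \<in>\<^sub>M A" "\<And>x. x \<in>\<^sub>M A \<Longrightarrow> \<not> x \<prec> m"
      using finite_has_min fin by blast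
    then obtain x where "x \<in>\<^sub>M H" "y \<prec> x" "x \<prec> m" using near A by blast
    then show False using m A less_trans by blast
  qed
  have unique: "\<not> y \<prec> y'" if y: "y \<in>\<^sub>M H" "\<And>n. n \<in>\<^sub>M nats \<Longrightarrow> \<not> ri y n"
    and y': "y' \<in>\<^sub>M H" "\<And>n. n \<in>\<^sub>M nats \<Longrightarrow> \<not> ri y' n" for y y'
  proof
    assume "y \<prec> y'"
    then obtain n where n: "n \<in>\<^sub>M nats" "y \<prec> l $ n" "l $ n \<prec> y'" using l_dense by blast
    obtain v where v: "y' \<prec> v" using less_add_one HR' y'(1) by blast
    define A where "A y v = sep H (\<lambda>w. y \<prec> w \<and> w \<prec> v)" for y v
    have A: "w \<in>\<^sub>M A y v \<longleftrightarrow> w \<in>\<^sub>M H \<and> y \<prec> w \<and> w \<prec> v" for w y v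
      unfolding A_def by (rule mem_sep) (intro dfn_real)
    have "\<not> finite_set (A y (l $ n))" by (rule limit[OF y n(2) A])
    moreover have "A y (l $ n) \<subseteq>\<^sub>M low H (l $ n)" by (simp add: subset_of_def A mem_low)
    ultimately have 1: "\<not> finite_set (low H (l $ n))" using finite_subset by blast
    have "\<not> finite_set (A y' v)" by (rule limit[OF y' v A])
    moreover have "A y' v \<subseteq>\<^sub>M up H (l $ n)"
      using n(3) less_trans less_asym unfolding subset_of_def A mem_up by blast
    ultimately have "\<not> finite_set (up H (l $ n))" using finite_subset by blast
    then show False using 1 n(1) none unfolding splits_def by blast
  qed
  have dfn_ri: "dfn (\<lambda>\<rho>. ri (\<rho> 0) (\<rho> 1))" unfolding ri_def by (intro dfn_real)
  \<comment> \<open>The shift by \<open>one\<close> reserves the code \<open>zr\<close> for the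
    single point that may have no isolating rational.\<close>
  let ?Q = "\<lambda>y m. (\<exists>n. first (ri y) n \<and> m = n \<oplus> one) \<or> (\<forall>n. n \<in>\<^sub>M nats \<longrightarrow> \<not> ri y n) \<and> m = zr"
  have "\<exists>f. is_function f H nats \<and> (\<forall>y. y \<in>\<^sub>M H \<longrightarrow> ?Q y (f $ y))"
  proof (rule function_of_relation)
    show "dfn (\<lambda>\<rho>. ?Q (\<rho> 0) (\<rho> 1))"
      unfolding first_def by (intro dfn_real dfn2[OF dfn_ri])
    fix y assume y: "y \<in>\<^sub>M H"
    show "\<exists>!m. m \<in>\<^sub>M nats \<and> ?Q y m"
    proof (cases "\<exists>n. n \<in>\<^sub>M nats \<and> ri y n")
      case True
      then obtain n0 where "n0 \<in>\<^sub>M nats" "ri y n0" by blast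
      moreover have "dfn (\<lambda>\<rho>. ri y (\<rho> 0))" by (intro dfn2[OF dfn_ri] dfn_intros)
      ultimately obtain n where n: "first (ri y) n" using first_exists by blast
      have "n \<oplus> one \<in>\<^sub>M nats" using n unfolding first_def by simp
      then show ?thesis
      proof (intro ex1I[of _ "n \<oplus> one"])
        show "m = n \<oplus> one" if "m \<in>\<^sub>M nats \<and> ?Q y m" for m
          using that True first_unique[OF n] by auto
      qed (use n in blast)
    next
      case False
      then show ?thesis unfolding first_def by (intro ex1I[of _ zr]) (simp, blast)
    qed
  qed
  then obtain f where f: "is_function f H nats" "\<And>y. y \<in>\<^sub>M H \<Longrightarrow> ?Q y (f $ y)" by blast
  have not_less: "\<not> y \<prec> y'" if y: "y \<in>\<^sub>M H" "y' \<in>\<^sub>M H" "f $ y = f $ y'" for y y'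
  proof (cases "f $ y = zr")
    case True
    have "n \<oplus> one \<noteq> zr" if "first P n" for P n
      using that less_add_one[of n] nats_nonneg[of n] unfolding first_def by force
    then have "\<not> ri y n" "\<not> ri y' n" if "n \<in>\<^sub>M nats" for n
      using f(2)[OF y(1)] f(2)[OF y(2)] True y(3) that by metis+
    then show ?thesis using unique y by blast
  next
    case False
    then obtain n n' where n: "first (ri y) n" "f $ y = n \<oplus> one" "first (ri y') n'" "f $ y' = n' \<oplus> one"
      using f(2)[OF y(1)] f(2)[OF y(2)] y(3) by metis
    have "n \<in>\<^sub>M R" "n' \<in>\<^sub>M R" using n(1,3) nats_real unfolding first_def by blast+
    moreover have "n \<oplus> one = n' \<oplus> one" using n(2,4) y(3) by simp
    ultimately have nn: "n = n'" using add_cancel[of n n' one] by simp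
    \<comment> \<open>If \<open>y\<close> preceded \<open>y'\<close>, then \<open>y'\<close> would
      be a point of \<open>H\<close> in the gap between \<open>y\<close> and its isolating
      rational.\<close>
    have "y' \<prec> l $ n" using n(3) nn unfolding first_def ri_def by blast
    moreover have "ri y n" using n(1) unfolding first_def by blast
    ultimately show ?thesis using y(2) less_asym unfolding ri_def by blast
  qed
  have "injection f H nats"
  proof (rule injectionI[OF f(1)])
    fix y y' assume y: "y \<in>\<^sub>M H" "y' \<in>\<^sub>M H" "f $ y = f $ y'"
    show "y = y'"
      using not_less[OF y] not_less[OF y(2,1) y(3)[symmetric]] less_total[OF HR'[OF y(1)] HR'[OF y(2)]]
      by blast
  qed
  then show False using H countable_iff_nats by blast
qed

subsection \<open>Thinning out an inexact set\<close>

text \<open>Stated through an isomorphic copy rather than a self-map, so that it transfers from a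
  copy back to \<open>Z\<close> by composing isomorphisms.\<close>

definition movable :: "'a \<Rightarrow> 'a \<Rightarrow> bool" where
  "movable Z n \<longleftrightarrow> (\<exists>z. z \<in>\<^sub>M Z \<and> l $ n \<prec> z \<and> z \<prec> r $ n) \<and>
    (\<exists>Z'. Z' \<subseteq>\<^sub>M Z \<and> order_isomorphic Z lt Z' lt \<and> \<not> (\<exists>z. z \<in>\<^sub>M Z' \<and> l $ n \<prec> z \<and> z \<prec> r $ n))"

lemma dfn_movable: "dft t \<Longrightarrow> dft u \<Longrightarrow> dfn (\<lambda>\<rho>. movable (t \<rho>) (u \<rho>))"
  by (rule dfn2) (unfold movable_def, intro dfn_real)

text \<open>The map \<open>g\<close> fixes what lies before \<open>x\<close> and acts as
  \<open>f\<close> from \<open>x\<close> on; it keeps the order because \<open>f\<close> moves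
  \<open>x\<close> forward. It is applied twice: one pass clears only the stretch between
  \<open>x\<close> and \<open>f $ x\<close>, which need not have a point of \<open>Z\<close> in its
  interior, whereas the second extends it to \<open>f $ (f $ x)\<close>, with the point
  \<open>f $ x\<close> inside.\<close>

lemma thin_out:
  assumes L: "linear_rel L" and ZR: "Z \<subseteq>\<^sub>M R" and f: "is_function f Z Z"
    and mono: "\<And>x y. x \<in>\<^sub>M Z \<Longrightarrow> y \<in>\<^sub>M Z \<Longrightarrow> L x y \<Longrightarrow> L (f $ x) (f $ y)"
    and x: "x \<in>\<^sub>M Z" "L x (f $ x)"
  shows "\<exists>Z' h. Z' \<subseteq>\<^sub>M Z \<and> bijection h Z Z' \<and>
    (\<forall>y y'. y \<in>\<^sub>M Z \<longrightarrow> y' \<in>\<^sub>M Z \<longrightarrow> (L y y' \<longleftrightarrow> L (h $ y) (h $ y'))) \<and>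
    (\<forall>w. w \<in>\<^sub>M Z' \<longrightarrow> \<not> (L x w \<and> L w (f $ (f $ x))))"
proof -
  have dfnL: "dfn (\<lambda>\<rho>. L (\<rho> 0) (\<rho> 1))" and irrefl: "\<And>x. \<not> L x x"
    and trans: "\<And>x y z. L x y \<Longrightarrow> L y z \<Longrightarrow> L x z"
    and total: "\<And>x y. x \<in>\<^sub>M R \<Longrightarrow> y \<in>\<^sub>M R \<Longrightarrow> L x y \<or> x = y \<or> L y x"
    using L unfolding linear_rel_def by blast+
  have tot: "L x y \<or> x = y \<or> L y x" if "x \<in>\<^sub>M Z" "y \<in>\<^sub>M Z" for x y
    using total subset_ofD[OF ZR] that by blast
  define g where "g y = (if L y x then y else f $ y)" for y
  have gZ: "g y \<in>\<^sub>M Z" if "y \<in>\<^sub>M Z" for y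
    using that function_ap_mem[OF f that] by (simp add: g_def)
  have fx: "f $ x = f $ y \<or> L (f $ x) (f $ y)" if "y \<in>\<^sub>M Z" "\<not> L y x" for y
    using tot[OF that(1) x(1)] mono[OF x(1) that(1)] that(2) by blast
  have g_mono: "L (g y) (g y')" if y: "y \<in>\<^sub>M Z" "y' \<in>\<^sub>M Z" "L y y'" for y y'
  proof (cases "L y' x")
    case True
    then have "L y x" using y(3) trans by blast
    then show ?thesis using True y(3) by (simp add: g_def)
  next
    case y': False
    show ?thesis
    proof (cases "L y x")
      case True
      then have "L y (f $ x)" using x(2) trans by blast
      then have "L y (f $ y')" using fx[OF y(2) y'] trans by metis
      then show ?thesis using True y' by (simp add: g_def)
    next
      case False
      then show ?thesis using y' mono[OF y] by (simp add: g_def)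
    qed
  qed
  define F where "F y = g (g y)" for y
  have FZ: "F y \<in>\<^sub>M Z" if "y \<in>\<^sub>M Z" for y using gZ that by (simp add: F_def)
  have F_mono: "L (F y) (F y')" if "y \<in>\<^sub>M Z" "y' \<in>\<^sub>M Z" "L y y'" for y y'
    using that g_mono gZ by (simp add: F_def)
  have F_iff: "L y y' \<longleftrightarrow> L (F y) (F y')" if "y \<in>\<^sub>M Z" "y' \<in>\<^sub>M Z" for y y'
    using that F_mono tot[OF that] irrefl trans by metis
  have F_dft: "dft t \<Longrightarrow> dft (\<lambda>\<rho>. F (t \<rho>))" for t
    by (rule dft1) (unfold F_def g_def, intro dfn_intros dfn2[OF dfnL])
  define Z' where "Z' = sep Z (\<lambda>w. \<exists>y. y \<in>\<^sub>M Z \<and> w = F y)"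
  have Z': "w \<in>\<^sub>M Z' \<longleftrightarrow> w \<in>\<^sub>M Z \<and> (\<exists>y. y \<in>\<^sub>M Z \<and> w = F y)" for w
    unfolding Z'_def by (rule mem_sep) (intro dfn_intros F_dft)
  have "\<exists>h. is_function h Z Z' \<and> (\<forall>y. y \<in>\<^sub>M Z \<longrightarrow> h $ y = F y)"
    by (rule function_of_term) (use Z' FZ in blast, intro F_dft dfn_intros)
  then obtain h where h: "is_function h Z Z'" "\<And>y. y \<in>\<^sub>M Z \<Longrightarrow> h $ y = F y" by blast
  have "injection h Z Z'"
  proof (rule injectionI[OF h(1)])
    fix y y' assume y: "y \<in>\<^sub>M Z" "y' \<in>\<^sub>M Z" "h $ y = h $ y'"
    then have "F y = F y'" using h(2) by simp
    then show "y = y'" using F_mono[OF y(1,2)] F_mono[OF y(2,1)] tot[OF y(1,2)] irrefl by metis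
  qed
  then have "bijection h Z Z'"
  proof (rule bijectionI)
    fix w assume "w \<in>\<^sub>M Z'"
    then obtain y where "y \<in>\<^sub>M Z" "w = F y" unfolding Z' by blast
    then show "\<exists>y. y \<in>\<^sub>M Z \<and> h $ y = w" using h(2) by (intro exI[of _ y]) simp
  qed
  moreover have "\<not> (L x (F y) \<and> L (F y) (f $ (f $ x)))" if y: "y \<in>\<^sub>M Z" for y
  proof (cases "L y x")
    case True
    then have "F y = y" by (simp add: F_def g_def)
    then show ?thesis using True trans irrefl by metis
  next
    case False
    have fy: "f $ x = f $ y \<or> L (f $ x) (f $ y)" by (rule fx[OF y False])
    then have "\<not> L (f $ y) x" using x(2) trans irrefl by metis
    then have "F y = f $ (f $ y)" using False by (simp add: F_def g_def)
    moreover have "f $ (f $ x) = f $ (f $ y) \<or> L (f $ (f $ x)) (f $ (f $ y))"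
      using fy mono[OF function_ap_mem[OF f x(1)] function_ap_mem[OF f y]] by auto
    ultimately show ?thesis using trans irrefl by metis
  qed
  moreover have "Z' \<subseteq>\<^sub>M Z" using Z' by (simp add: subset_of_def)
  ultimately show ?thesis using F_iff h(2) Z' by (intro exI[of _ Z'] exI[of _ h]) auto
qed

lemma order_isomorphic_realI:
  assumes "X \<subseteq>\<^sub>M R" "Y \<subseteq>\<^sub>M R" "bijection h X Y"
    "\<And>x y. x \<in>\<^sub>M X \<Longrightarrow> y \<in>\<^sub>M X \<Longrightarrow> x \<prec> y \<longleftrightarrow> h $ x \<prec> h $ y"
  shows "order_isomorphic X lt Y lt"
proof -
  have "is_function h X Y" using assms(3) unfolding bijection_iff injection_iff by blast
  then have "rel lt x y \<longleftrightarrow> rel lt (h $ x) (h $ y)" if "x \<in>\<^sub>M X" "y \<in>\<^sub>M X" for x y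
    using assms(4)[OF that] that rel_lt_iff subset_ofD[OF assms(1)] subset_ofD[OF assms(2)]
      function_ap_mem by metis
  then show ?thesis unfolding order_isomorphic_iff using assms(3) by blast
qed

lemma inexact_movable:
  assumes ZR: "Z \<subseteq>\<^sub>M R" and inex: "inexact Z lt"
  shows "\<exists>n. n \<in>\<^sub>M nats \<and> movable Z n"
proof -
  obtain f x where f: "is_function f Z Z"
    and mono: "\<And>x y. x \<in>\<^sub>M Z \<Longrightarrow> y \<in>\<^sub>M Z \<Longrightarrow> x \<prec> y \<Longrightarrow> f $ x \<prec> f $ y"
    and x: "x \<in>\<^sub>M Z" "f $ x \<noteq> x"
    using inex unfolding inexact_real_iff[OF ZR] by blast
  have fxZ: "f $ x \<in>\<^sub>M Z" by (rule function_ap_mem[OF f x(1)])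
  have "x \<in>\<^sub>M R" "f $ x \<in>\<^sub>M R" using x(1) fxZ subset_ofD[OF ZR] by blast+
  then consider "x \<prec> f $ x" | "f $ x \<prec> x" using x(2) less_total by metis
  then obtain Z' h u v where Z': "Z' \<subseteq>\<^sub>M Z" "bijection h Z Z'"
    "\<And>y y'. y \<in>\<^sub>M Z \<Longrightarrow> y' \<in>\<^sub>M Z \<Longrightarrow> y \<prec> y' \<longleftrightarrow> h $ y \<prec> h $ y'"
    "\<And>w. w \<in>\<^sub>M Z' \<Longrightarrow> \<not> (u \<prec> w \<and> w \<prec> v)" and uv: "u \<prec> f $ x" "f $ x \<prec> v"
  proof cases
    case 1
    have "f $ x \<prec> f $ (f $ x)" using mono[OF x(1) fxZ 1] .
    moreover obtain Z' h where "Z' \<subseteq>\<^sub>M Z" "bijection h Z Z'"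
      "\<forall>y y'. y \<in>\<^sub>M Z \<longrightarrow> y' \<in>\<^sub>M Z \<longrightarrow> (y \<prec> y' \<longleftrightarrow> h $ y \<prec> h $ y')"
      "\<forall>w. w \<in>\<^sub>M Z' \<longrightarrow> \<not> (x \<prec> w \<and> w \<prec> f $ (f $ x))"
      using thin_out[OF linear_rel_less ZR f mono x(1) 1] by blast
    ultimately show ?thesis using that[of Z' h x "f $ (f $ x)"] 1 by blast
  next
    case 2
    have "f $ (f $ x) \<prec> f $ x" using mono[OF fxZ x(1) 2] .
    moreover obtain Z' h where "Z' \<subseteq>\<^sub>M Z" "bijection h Z Z'"
      "\<forall>y y'. y \<in>\<^sub>M Z \<longrightarrow> y' \<in>\<^sub>M Z \<longrightarrow> (y' \<prec> y \<longleftrightarrow> h $ y' \<prec> h $ y)"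
      "\<forall>w. w \<in>\<^sub>M Z' \<longrightarrow> \<not> (w \<prec> x \<and> f $ (f $ x) \<prec> w)"
      using thin_out[OF linear_rel_greater ZR f mono x(1) 2] by blast
    ultimately show ?thesis using that[of Z' h "f $ (f $ x)" x] 2 by blast
  qed
  \<comment> \<open>The point \<open>f $ x\<close> of \<open>Z\<close> is interior to the cleared
    stretch, so a rational interval around it fits inside.\<close>
  obtain n where n: "n \<in>\<^sub>M nats" "u \<prec> l $ n" "l $ n \<prec> f $ x" "f $ x \<prec> r $ n" "r $ n \<prec> v"
    using base[OF uv] by blast
  have "Z' \<subseteq>\<^sub>M R" using Z'(1) ZR by (simp add: subset_of_def)
  then have "order_isomorphic Z lt Z' lt" using order_isomorphic_realI[OF ZR _ Z'(2,3)] by blast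
  moreover have "\<not> (\<exists>z. z \<in>\<^sub>M Z' \<and> l $ n \<prec> z \<and> z \<prec> r $ n)" using Z'(4) n less_trans by blast
  ultimately have "movable Z n" unfolding movable_def using fxZ n(3,4) Z'(1) by blast
  then show ?thesis using n(1) by blast
qed

text \<open>A copy of \<open>Z'\<close> inside \<open>Z'\<close> is a copy of \<open>Z\<close>
  inside \<open>Z\<close>.\<close>

lemma movable_mono:
  assumes "Z' \<subseteq>\<^sub>M Z" "order_isomorphic Z lt Z' lt" "movable Z' n"
  shows "movable Z n"
proof -
  obtain z W where z: "z \<in>\<^sub>M Z'" "l $ n \<prec> z" "z \<prec> r $ n" and W: "W \<subseteq>\<^sub>M Z'" "order_isomorphic Z' lt W lt"
    "\<not> (\<exists>z. z \<in>\<^sub>M W \<and> l $ n \<prec> z \<and> z \<prec> r $ n)"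
    using assms(3) unfolding movable_def by blast
  have "W \<subseteq>\<^sub>M Z" using W(1) assms(1) by (simp add: subset_of_def)
  then show ?thesis unfolding movable_def
    using z W(3) order_isomorphic_trans[OF assms(2) W(2)] subset_ofD[OF assms(1)] by blast
qed

text \<open>Index \<open>n\<close> is lost since \<open>Z'\<close> no longer meets that interval,
  and a smaller index movable for \<open>Z'\<close> would have been movable for
  \<open>Z\<close>.\<close>

lemma first_movable_increase:
  assumes "first (movable Z) n"
  shows "\<exists>Z'. Z' \<subseteq>\<^sub>M Z \<and> order_isomorphic Z lt Z' lt \<and> (\<forall>m. first (movable Z') m \<longrightarrow> n \<prec> m)"
proof -
  obtain Z' where Z': "Z' \<subseteq>\<^sub>M Z" "order_isomorphic Z lt Z' lt"
    "\<not> (\<exists>z. z \<in>\<^sub>M Z' \<and> l $ n \<prec> z \<and> z \<prec> r $ n)"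
    using assms unfolding first_def movable_def by blast
  have "n \<prec> m" if m: "first (movable Z') m" for m
  proof -
    have "m \<noteq> n" using Z'(3) m unfolding first_def movable_def by blast
    moreover have "\<not> m \<prec> n"
      using assms m movable_mono[OF Z'(1,2)] unfolding first_def by blast
    ultimately show ?thesis using less_total[of m n] m assms unfolding first_def by auto
  qed
  then show ?thesis using Z' by blast
qed

text \<open>Each thinning raises the index by at least one. The induction formula only asserts that
  a copy exists, so no sequence of copies is chosen.\<close>

lemma first_movable_unbounded:
  assumes inex: "all_infinite_inexact R lt" and ZR: "Z \<subseteq>\<^sub>M R" and Z: "\<not> finite_set Z"
    and k: "k \<in>\<^sub>M nats"
  shows "\<exists>Z' n. Z' \<subseteq>\<^sub>M Z \<and> order_isomorphic Z lt Z' lt \<and> first (movable Z') n \<and> \<not> n \<prec> k"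
proof -
  have ex: "\<exists>n. first (movable W) n" if W: "W \<subseteq>\<^sub>M Z" "order_isomorphic Z lt W lt" for W
  proof -
    have "W \<subseteq>\<^sub>M R" using W(1) ZR by (simp add: subset_of_def)
    moreover have "\<not> finite_set W" using finite_order_isomorphic W(2) Z by blast
    ultimately obtain n where "n \<in>\<^sub>M nats" "movable W n"
      using inexact_movable inex unfolding all_infinite_inexact_def by blast
    moreover have "dfn (\<lambda>\<rho>. movable W (\<rho> 0))" by (intro dfn_movable dfn_intros)
    ultimately show ?thesis using first_exists by blast
  qed
  show ?thesis
    using k
  proof (induction rule: nats_induct)
    case dfn
    show ?case unfolding first_def by (intro dfn_real dfn_movable)
  next
    case zero
    have "Z \<subseteq>\<^sub>M Z" by (simp add: subset_of_def)
    moreover obtain n where "first (movable Z) n"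
      using ex[OF calculation order_isomorphic_refl] by blast
    moreover have "\<not> n \<prec> zr" using calculation nats_nonneg unfolding first_def by blast
    ultimately show ?case using order_isomorphic_refl by blast
  next
    case (Suc k)
    then obtain Z' n where Z': "Z' \<subseteq>\<^sub>M Z" "order_isomorphic Z lt Z' lt" "first (movable Z') n" "\<not> n \<prec> k"
      by blast
    obtain W where W: "W \<subseteq>\<^sub>M Z'" "order_isomorphic Z' lt W lt" "\<And>m. first (movable W) m \<Longrightarrow> n \<prec> m"
      using first_movable_increase[OF Z'(3)] by blast
    have WZ: "W \<subseteq>\<^sub>M Z" using W(1) Z'(1) by (simp add: subset_of_def)
    have iso: "order_isomorphic Z lt W lt" using order_isomorphic_trans[OF Z'(2) W(2)] .
    obtain m where m: "first (movable W) m" using ex[OF WZ iso] by blast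
    have "k \<prec> m" using le_less_trans[of k n m] Z'(4) W(3)[OF m] Suc(1) by simp
    then have "\<not> m \<prec> k \<oplus> one" using nats_discrete[of k m] Suc(1) m unfolding first_def by blast
    then show ?case using WZ iso m by blast
  qed
qed

text \<open>The halves can be thinned independently, since \<open>c\<close> fixes the order between
  them. The last two claims recover the parts, from which the colour of the union is
  computed.\<close>

lemma glue_isomorphic:
  assumes HR: "H \<subseteq>\<^sub>M R" and c: "c \<in>\<^sub>M R"
    and A: "A \<subseteq>\<^sub>M low H c" "order_isomorphic (low H c) lt A lt"
    and B: "B \<subseteq>\<^sub>M up H c" "order_isomorphic (up H c) lt B lt"
  shows "un A B \<subseteq>\<^sub>M H" "order_isomorphic H lt (un A B) lt" "low (un A B) c = A" "up (un A B) c = B"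
proof -
  have A': "x \<in>\<^sub>M H \<and> x \<prec> c" if "x \<in>\<^sub>M A" for x using subset_ofD[OF A(1) that] mem_low by blast
  have B': "x \<in>\<^sub>M H \<and> \<not> x \<prec> c" if "x \<in>\<^sub>M B" for x using subset_ofD[OF B(1) that] mem_up by blast
  have HR': "x \<in>\<^sub>M R" if "x \<in>\<^sub>M H" for x using subset_ofD[OF HR that] .
  show sub: "un A B \<subseteq>\<^sub>M H" using A' B' by (auto simp: subset_of_def)
  show "low (un A B) c = A" by (rule setI) (use A' B' in \<open>auto simp: mem_low\<close>)
  show "up (un A B) c = B" by (rule setI) (use A' B' in \<open>auto simp: mem_up\<close>)
  obtain f where f: "bijection f (low H c) A"
    "\<And>x y. x \<in>\<^sub>M low H c \<Longrightarrow> y \<in>\<^sub>M low H c \<Longrightarrow> rel lt x y \<longleftrightarrow> rel lt (f $ x) (f $ y)"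
    using A(2) unfolding order_isomorphic_iff by blast
  obtain g where g: "bijection g (up H c) B"
    "\<And>x y. x \<in>\<^sub>M up H c \<Longrightarrow> y \<in>\<^sub>M up H c \<Longrightarrow> rel lt x y \<longleftrightarrow> rel lt (g $ x) (g $ y)"
    using B(2) unfolding order_isomorphic_iff by blast
  have fi: "injection f (low H c) A" and gi: "injection g (up H c) B"
    and ff: "is_function f (low H c) A" and gf: "is_function g (up H c) B"
    using f(1) g(1) unfolding bijection_iff injection_iff by blast+
  define F where "F x = (if x \<prec> c then f $ x else g $ x)" for x
  have FA: "F x \<in>\<^sub>M A" "F x = f $ x" "x \<in>\<^sub>M low H c" if "x \<in>\<^sub>M H" "x \<prec> c" for x
    using that function_ap_mem[OF ff, of x] by (simp_all add: F_def mem_low)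
  have FB: "F x \<in>\<^sub>M B" "F x = g $ x" "x \<in>\<^sub>M up H c" if "x \<in>\<^sub>M H" "\<not> x \<prec> c" for x
    using that function_ap_mem[OF gf, of x] by (simp_all add: F_def mem_up)
  have "\<exists>h. is_function h H (un A B) \<and> (\<forall>x. x \<in>\<^sub>M H \<longrightarrow> h $ x = F x)"
  proof (rule function_of_term)
    show "dft (\<lambda>\<rho>. F (\<rho> 0))" unfolding F_def by (intro dfn_real)
    show "F x \<in>\<^sub>M un A B" if "x \<in>\<^sub>M H" for x using FA(1)[OF that] FB(1)[OF that] by auto
  qed
  then obtain h where h: "is_function h H (un A B)" "\<And>x. x \<in>\<^sub>M H \<Longrightarrow> h $ x = F x" by blast
  have F_iff: "x \<prec> y \<longleftrightarrow> F x \<prec> F y" if x: "x \<in>\<^sub>M H" and y: "y \<in>\<^sub>M H" for x y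
  proof -
    have FR: "F x \<in>\<^sub>M R" "F y \<in>\<^sub>M R" using FA(1) FB(1) A' B' HR' x y by blast+
    have xR: "x \<in>\<^sub>M R" "y \<in>\<^sub>M R" using x y HR' by blast+
    consider "x \<prec> c" "y \<prec> c" | "x \<prec> c" "\<not> y \<prec> c" | "\<not> x \<prec> c" "y \<prec> c" | "\<not> x \<prec> c" "\<not> y \<prec> c"
      by blast
    then show ?thesis
    proof cases
      case 1
      then show ?thesis using f(2)[of x y] FA[OF x 1(1)] FA[OF y 1(2)] FR xR by (simp add: less_def)
    next
      case 2
      have "x \<prec> y" using less_le_trans[OF xR(2) 2] .
      moreover have "F x \<prec> F y"
        using less_le_trans[of "F y" "F x" c] FR A' B' FA(1)[OF x 2(1)] FB(1)[OF y 2(2)] by blast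
      ultimately show ?thesis by blast
    next
      case 3
      have "y \<prec> x" using less_le_trans[OF xR(1) 3(2,1)] .
      moreover have "F y \<prec> F x"
        using less_le_trans[of "F x" "F y" c] FR A' B' FA(1)[OF y 3(2)] FB(1)[OF x 3(1)] by blast
      ultimately show ?thesis using less_asym by blast
    next
      case 4
      then show ?thesis using g(2)[of x y] FB[OF x 4(1)] FB[OF y 4(2)] FR xR by (simp add: less_def)
    qed
  qed
  have "injection h H (un A B)"
  proof (rule injectionI[OF h(1)])
    fix x y assume x: "x \<in>\<^sub>M H" and y: "y \<in>\<^sub>M H" and "h $ x = h $ y"
    then have "F x = F y" using h(2) by simp
    then show "x = y"
      using F_iff[OF x y] F_iff[OF y x] less_irrefl less_total[OF HR'[OF x] HR'[OF y]] by metis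
  qed
  then have "bijection h H (un A B)"
  proof (rule bijectionI)
    fix y assume "y \<in>\<^sub>M un A B"
    then consider "y \<in>\<^sub>M A" | "y \<in>\<^sub>M B" by auto
    then show "\<exists>x. x \<in>\<^sub>M H \<and> h $ x = y"
    proof cases
      case 1
      then obtain x where "x \<in>\<^sub>M low H c" "f $ x = y" using f(1) unfolding bijection_iff by blast
      then show ?thesis using h(2)[of x] FA(2)[of x] by (intro exI[of _ x]) (simp add: mem_low)
    next
      case 2
      then obtain x where "x \<in>\<^sub>M up H c" "g $ x = y" using g(1) unfolding bijection_iff by blast
      then show ?thesis using h(2)[of x] FB(2)[of x] by (intro exI[of _ x]) (simp add: mem_up)
    qed
  qed
  moreover have "un A B \<subseteq>\<^sub>M R" using sub HR by (simp add: subset_of_def)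
  ultimately show "order_isomorphic H lt (un A B) lt"
    using order_isomorphic_realI[OF HR] F_iff h(2) by simp
qed

subsection \<open>The equivalence\<close>

text \<open>
  The colour of \<open>Y\<close> compares the first movable intervals of the two halves of \<open>Y\<close>. Thinning out
  one half of a given set, as often as necessary, makes its first movable interval come later than
  that of the other half.
\<close>

lemma no_partition_if_inexact:
  assumes inex: "all_infinite_inexact R lt"
  shows "no_uncountable_partition R lt"
  unfolding no_uncountable_partition_def
proof (intro allI impI notI)
  fix L s
  assume unc: "\<not> countable_set L" and arr: "arrows R lt L s"
  define T where "T = subsets_of_type R lt L s"
  define col where "col Y \<longleftrightarrow> (\<exists>p m n. first (splits Y) p \<and> first (movable (low Y (l $ p))) m \<and>
    first (movable (up Y (l $ p))) n \<and> m \<prec> n)" for Y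
  have dft_low: "dft t \<Longrightarrow> dft u \<Longrightarrow> dft (\<lambda>\<rho>. low (t \<rho>) (u \<rho>))" for t u
    by (rule dft2) (unfold low_def, intro dfn_real)
  have dft_up: "dft t \<Longrightarrow> dft u \<Longrightarrow> dft (\<lambda>\<rho>. up (t \<rho>) (u \<rho>))" for t u
    by (rule dft2) (unfold up_def, intro dfn_real)
  have dfn_splits: "dft t \<Longrightarrow> dft u \<Longrightarrow> dfn (\<lambda>\<rho>. splits (t \<rho>) (u \<rho>))" for t u
    by (rule dfn2) (unfold splits_def, intro dfn_intros dft_low dft_up)
  \<comment> \<open>The two colours are the elements of the number 2 of the model.\<close>
  define F where "F Y = (if col Y then empty_set else succ empty_set)" for Y
  have "\<exists>f. is_function f T (succ (succ empty_set)) \<and> (\<forall>Y. Y \<in>\<^sub>M T \<longrightarrow> f $ Y = F Y)"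
  proof (rule function_of_term)
    show "dft (\<lambda>\<rho>. F (\<rho> 0))"
      unfolding F_def col_def first_def by (intro dfn_real dfn_movable dfn_splits dft_low dft_up)
  qed (simp add: F_def)
  then obtain f where f: "is_function f T (succ (succ empty_set))" "\<And>Y. Y \<in>\<^sub>M T \<Longrightarrow> f $ Y = F Y"
    by blast
  obtain H c where H: "H \<in>\<^sub>M T" and const: "\<And>X. X \<in>\<^sub>M subsets_of_type H lt L s \<Longrightarrow> app f X = c"
    using arr f(1) unfolding arrows_def T_def by blast
  have HR: "H \<subseteq>\<^sub>M R" and HL: "order_isomorphic H lt L s"
    using H unfolding T_def mem_subsets_of_type by blast+
  have homogeneous: "F Y = c" if Y: "Y \<subseteq>\<^sub>M H" "order_isomorphic H lt Y lt" for Y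
  proof -
    have iso: "order_isomorphic Y lt L s"
      using order_isomorphic_trans[OF order_isomorphic_sym[OF Y(2)] HL] .
    have "Y \<subseteq>\<^sub>M R" using Y(1) HR by (simp add: subset_of_def)
    then have "Y \<in>\<^sub>M T" unfolding T_def mem_subsets_of_type using iso by blast
    moreover have "app f Y = c" using const Y(1) iso unfolding mem_subsets_of_type by blast
    ultimately show ?thesis using app_eq_ap[OF f(1)] f(2) by simp
  qed
  have "\<not> countable_set H" using countable_order_isomorphic[OF HL] unc by blast
  then obtain p0 where "p0 \<in>\<^sub>M nats" "splits H p0" using uncountable_splits[OF HR] by blast
  moreover have "dfn (\<lambda>\<rho>. splits H (\<rho> 0))" by (intro dfn_splits dfn_intros)
  ultimately obtain p where p: "first (splits H) p" using first_exists by blast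
  define d where "d = l $ p"
  have d: "d \<in>\<^sub>M R" using p unfolding d_def first_def by simp
  have lowR: "low H d \<subseteq>\<^sub>M R" and upR: "up H d \<subseteq>\<^sub>M R"
    using HR by (simp_all add: subset_of_def mem_low mem_up)
  have low_inf: "\<not> finite_set (low H d)" and up_inf: "\<not> finite_set (up H d)"
    using p unfolding first_def splits_def d_def by blast+
  have glued: "F (un A B) = c" "col (un A B) \<longleftrightarrow> m \<prec> n"
    if A: "A \<subseteq>\<^sub>M low H d" "order_isomorphic (low H d) lt A lt" "first (movable A) m"
      and B: "B \<subseteq>\<^sub>M up H d" "order_isomorphic (up H d) lt B lt" "first (movable B) n" for A B m n
  proof -
    note glue = glue_isomorphic[OF HR d A(1,2) B(1,2)]
    show "F (un A B) = c" using homogeneous glue(1,2) by blast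
    \<comment> \<open>Cutting a subset gives smaller parts, so no earlier rational splits the union;
      \<open>p\<close> still does, as copies of infinite sets are infinite. Hence the first split of
      the union is again \<open>p\<close>.\<close>
    have sub: "finite_set (low (un A B) w) \<or> finite_set (up (un A B) w)"
      if "finite_set (low H w) \<or> finite_set (up H w)" for w
    proof -
      have "low (un A B) w \<subseteq>\<^sub>M low H w" "up (un A B) w \<subseteq>\<^sub>M up H w"
        using subset_ofD[OF glue(1)] unfolding subset_of_def mem_low mem_up by blast+
      then show ?thesis using that finite_subset by blast
    qed
    have "\<not> finite_set A" "\<not> finite_set B"
      using finite_order_isomorphic A(2) B(2) low_inf up_inf by blast+
    then have "splits (un A B) p"
      unfolding splits_def d_def[symmetric] glue(3,4) by blast
    moreover have "\<not> splits (un A B) k" if "k \<in>\<^sub>M nats" "k \<prec> p" for k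
      using that p sub[of "l $ k"] unfolding first_def splits_def by blast
    ultimately have p': "first (splits (un A B)) p" using p unfolding first_def by blast
    show "col (un A B) \<longleftrightarrow> m \<prec> n"
    proof
      assume "col (un A B)"
      then obtain p'' m' n' where *: "first (splits (un A B)) p''"
        "first (movable (low (un A B) (l $ p''))) m'"
        "first (movable (up (un A B) (l $ p''))) n'" "m' \<prec> n'"
        unfolding col_def by blast
      have "p'' = p" by (rule first_unique[OF *(1) p'])
      then have "first (movable A) m'" "first (movable B) n'"
        using *(2,3) glue(3,4) d_def by simp_all
      then have "m' = m" "n' = n" using first_unique A(3) B(3) by blast+
      then show "m \<prec> n" using *(4) by simp
    next
      assume "m \<prec> n"
      then show "col (un A B)"
        unfolding col_def using p' A(3) B(3) glue(3,4) d_def by metis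
    qed
  qed
  obtain A m where A: "A \<subseteq>\<^sub>M low H d" "order_isomorphic (low H d) lt A lt" "first (movable A) m"
    using first_movable_unbounded[OF inex lowR low_inf nats_zero] by blast
  have mN: "m \<in>\<^sub>M nats" using A(3) unfolding first_def by blast
  \<comment> \<open>Thinning only guarantees an index at or above the bound; the bound
    \<open>m \<oplus> one\<close> makes the comparison strict.\<close>
  obtain B n where B: "B \<subseteq>\<^sub>M up H d" "order_isomorphic (up H d) lt B lt" "first (movable B) n"
    "\<not> n \<prec> m \<oplus> one"
    using first_movable_unbounded[OF inex upR up_inf nats_Suc[OF mN]] by blast
  have nN: "n \<in>\<^sub>M nats" using B(3) unfolding first_def by blast
  have "m \<prec> n" using less_le_trans[of n m "m \<oplus> one"] B(4) less_add_one mN nN by simp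
  then have 1: "F (un A B) = empty_set" using glued(2)[OF A B(1-3)] by (simp add: F_def)
  \<comment> \<open>Here an index equal to \<open>n\<close> is enough, since \<open>col\<close> asks
    for a strict inequality.\<close>
  obtain A' m' where A': "A' \<subseteq>\<^sub>M low H d" "order_isomorphic (low H d) lt A' lt" "first (movable A') m'"
    "\<not> m' \<prec> n"
    using first_movable_unbounded[OF inex lowR low_inf nN] by blast
  have 2: "F (un A' B) = succ empty_set" using glued(2)[OF A'(1-3) B(1-3)] A'(4) by (simp add: F_def)
  show False
    using 1 2 glued(1)[OF A B(1-3)] glued(1)[OF A'(1-3) B(1-3)] succ_neq_empty by metis
qed

lemma inexact_if_no_partition:
  assumes "no_uncountable_partition R lt"
  shows "all_infinite_inexact R lt"
  unfolding all_infinite_inexact_def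
proof (intro allI impI, rule ccontr)
  fix X assume XR: "X \<subseteq>\<^sub>M R" and inf: "\<not> finite_set X" and "\<not> inexact X lt"
  then have ex: "exact X lt" unfolding inexact_def by blast
  have "\<not> countable_set X"
    using countable_infinite_inexact[OF XR _ inf] ex unfolding inexact_def by blast
  moreover have "strict_linear_order X lt"
    using strict_linear subset_ofD[OF XR] unfolding strict_linear_order_def by meson
  moreover have "arrows R lt X lt"
    unfolding arrows_def
  proof (intro allI impI)
    fix F
    have "X \<in>\<^sub>M subsets_of_type R lt X lt"
      unfolding mem_subsets_of_type using XR order_isomorphic_refl by blast
    \<comment> \<open>An isomorphism of \<open>X\<close> onto a subset is an order-preserving
      self-map, so exactness makes it the identity and the subset is all of
      \<open>X\<close>.\<close>
    moreover have "Y = X" if Y: "Y \<in>\<^sub>M subsets_of_type X lt X lt" for Y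
    proof -
      have YX: "Y \<subseteq>\<^sub>M X" using Y unfolding mem_subsets_of_type by blast
      have "order_isomorphic X lt Y lt"
        using Y order_isomorphic_sym unfolding mem_subsets_of_type by blast
      then obtain g where g: "bijection g X Y"
        "\<And>x y. x \<in>\<^sub>M X \<Longrightarrow> y \<in>\<^sub>M X \<Longrightarrow> rel lt x y \<longleftrightarrow> rel lt (g $ x) (g $ y)"
        unfolding order_isomorphic_iff by blast
      have gY: "is_function g X Y" using g(1) unfolding bijection_iff injection_iff by blast
      then have "order_preserving g X lt"
        unfolding order_preserving_iff using function_weaken[OF gY YX] g(2) by blast
      then have "g $ x = x" if "x \<in>\<^sub>M X" for x using ex that unfolding exact_iff by blast
      then have "x \<in>\<^sub>M Y" if "x \<in>\<^sub>M X" for x using function_ap_mem[OF gY that] that by simp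
      then show ?thesis using subset_ofD[OF YX] by (intro setI) blast
    qed
    ultimately show "\<exists>H. H \<in>\<^sub>M subsets_of_type R lt X lt \<and>
        (\<exists>c. \<forall>Y. Y \<in>\<^sub>M subsets_of_type H lt X lt \<longrightarrow> app F Y = c)"
      by (intro exI[of _ X]) metis
  qed
  ultimately show False using assms unfolding no_uncountable_partition_def by blast
qed

subsection \<open>The perfect set property\<close>

lemma dfn_is_sup: "dft t \<Longrightarrow> dft u \<Longrightarrow> dfn (\<lambda>\<rho>. is_sup (t \<rho>) (u \<rho>))"
  by (rule dfn2) (unfold is_sup_def, intro dfn_real)

lemma is_sup_unique: "is_sup S d \<Longrightarrow> is_sup S d' \<Longrightarrow> d = d'"
  unfolding is_sup_def using less_total[of d d'] by blast

lemma is_sup_approx: "is_sup S d \<Longrightarrow> u \<prec> d \<Longrightarrow> \<exists>x. x \<in>\<^sub>M S \<and> u \<prec> x"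
  unfolding is_sup_def using less_mem by blast

lemma exists_below:
  assumes "x \<in>\<^sub>M R"
  shows "\<exists>a. a \<prec> x"
proof -
  obtain a where a: "a \<in>\<^sub>M R" "x = one \<oplus> a" using difference[OF one_mem assms] by metis
  then show ?thesis using less_add_one[of a] by (auto simp: add_commute)
qed

text \<open>An element may have many indices; the first is canonical, and it determines the element
  because no index is shared.\<close>

lemma countable_if_indexed:
  assumes K: "dfn (\<lambda>\<rho>. K (\<rho> 0) (\<rho> 1))"
    and ex: "\<And>a. a \<in>\<^sub>M A \<Longrightarrow> \<exists>n. n \<in>\<^sub>M nats \<and> K n a"
    and unique: "\<And>n a a'. a \<in>\<^sub>M A \<Longrightarrow> a' \<in>\<^sub>M A \<Longrightarrow> K n a \<Longrightarrow> K n a' \<Longrightarrow> a = a'"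
  shows "countable_set A"
proof -
  have "\<exists>f. is_function f A nats \<and> (\<forall>a. a \<in>\<^sub>M A \<longrightarrow> first (\<lambda>n. K n a) (f $ a))"
  proof (rule function_of_relation)
    show "dfn (\<lambda>\<rho>. first (\<lambda>n. K n (\<rho> 0)) (\<rho> 1))"
      unfolding first_def by (intro dfn_real dfn2[OF K])
    fix a assume "a \<in>\<^sub>M A"
    then obtain n0 where "n0 \<in>\<^sub>M nats" "K n0 a" using ex by blast
    moreover have "dfn (\<lambda>\<rho>. K (\<rho> 0) a)" by (intro dfn2[OF K] dfn_intros)
    ultimately obtain n where n: "first (\<lambda>n. K n a) n"
      using first_exists[of n0 "\<lambda>n. K n a"] by blast
    moreover have "n \<in>\<^sub>M nats" using n unfolding first_def by blast
    ultimately show "\<exists>!n. n \<in>\<^sub>M nats \<and> first (\<lambda>n. K n a) n"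
      using first_unique by (intro ex1I[of _ n]) blast+
  qed
  then obtain f where f: "is_function f A nats" "\<And>a. a \<in>\<^sub>M A \<Longrightarrow> first (\<lambda>n. K n a) (f $ a)" by blast
  have "injection f A nats"
  proof (rule injectionI[OF f(1)])
    fix a a' assume a: "a \<in>\<^sub>M A" "a' \<in>\<^sub>M A" "f $ a = f $ a'"
    have "K (f $ a) a" "K (f $ a') a'" using f(2)[OF a(1)] f(2)[OF a(2)] unfolding first_def by blast+
    then show "a = a'" using unique[OF a(1,2)] a(3) by simp
  qed
  then show ?thesis using countable_iff_nats by blast
qed

text \<open>
  The suprema of the initial segments of a perfect set that are cut off by the \<open>l $ n\<close> are limits
  from the left, hence densely ordered. Embedding the countable dense set of the \<open>l $ n\<close> into them
  and taking suprema embeds the whole line.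
\<close>

lemma perfect_subset_inexact:
  assumes XR: "X \<subseteq>\<^sub>M R" and perf: "perfect_set R lt P" and x0: "x0 \<in>\<^sub>M P" and PX: "P \<subseteq>\<^sub>M X"
  shows "inexact X lt"
proof -
  have PR: "x \<in>\<^sub>M R" if "x \<in>\<^sub>M P" for x using subset_ofD[OF XR] subset_ofD[OF PX] that by blast
  have closed: "\<exists>a b. a \<prec> x \<and> x \<prec> b \<and> (\<forall>y. y \<in>\<^sub>M P \<longrightarrow> \<not> (a \<prec> y \<and> y \<prec> b))"
    if "x \<in>\<^sub>M R" "\<not> x \<in>\<^sub>M P" for x
    using perf that unfolding perfect_set_def closed_set_def in_interval_def less_def by blast
  have not_isolated: "\<exists>y. y \<in>\<^sub>M P \<and> a \<prec> y \<and> y \<prec> b \<and> y \<noteq> x" if x: "x \<in>\<^sub>M P" "a \<prec> x" "x \<prec> b" for x a b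
  proof -
    have "\<not> isolated_point R lt P x" using perf unfolding perfect_set_def by blast
    then obtain y where "y \<in>\<^sub>M P" "in_interval lt a b y" "y \<noteq> x"
      using x unfolding isolated_point_def in_interval_def less_def by blast
    then show ?thesis using PR less_mem[OF x(2)] less_mem[OF x(3)]
      unfolding in_interval_def less_def by blast
  qed
  have sup_P: "d \<in>\<^sub>M P" if S: "\<And>x. x \<in>\<^sub>M S \<Longrightarrow> x \<in>\<^sub>M P" and d: "is_sup S d" for S d
  proof (rule ccontr)
    assume "\<not> d \<in>\<^sub>M P"
    then obtain a b where ab: "a \<prec> d" "d \<prec> b" "\<And>y. y \<in>\<^sub>M P \<Longrightarrow> \<not> (a \<prec> y \<and> y \<prec> b)"
      using closed d unfolding is_sup_def by blast
    obtain y where y: "y \<in>\<^sub>M S" "a \<prec> y" using is_sup_approx[OF d ab(1)] by blast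
    have "y \<prec> b" using le_less_trans[of y d b] y ab(2) PR S d unfolding is_sup_def by blast
    then show False using ab(3) S y by blast
  qed
  define K where "K n d \<longleftrightarrow> (\<exists>y. y \<in>\<^sub>M P \<and> y \<prec> l $ n) \<and> is_sup (low P (l $ n)) d" for n d
  have dfn_K: "dfn (\<lambda>\<rho>. K (\<rho> 0) (\<rho> 1))"
    unfolding K_def low_def by (intro dfn_real dfn_is_sup)
  have K_exists: "\<exists>d. K n d" if n: "n \<in>\<^sub>M nats" "y \<in>\<^sub>M P" "y \<prec> l $ n" for n y
  proof -
    have "\<exists>d. is_sup (low P (l $ n)) d"
    proof (rule is_sup_exists)
      show "low P (l $ n) \<subseteq>\<^sub>M R" using PR by (simp add: subset_of_def mem_low)
      show "y \<in>\<^sub>M low P (l $ n)" using n by (simp add: mem_low)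
      show "l $ n \<in>\<^sub>M R" using n by simp
    qed (use mem_low less_asym in blast)
    then show ?thesis unfolding K_def using n by blast
  qed
  have K_P: "d \<in>\<^sub>M P" if "K n d" for n d
    using sup_P[of "low P (l $ n)" d] that mem_low unfolding K_def by blast
  have K_bounds: "\<not> l $ n \<prec> d" "\<And>y. y \<in>\<^sub>M P \<Longrightarrow> y \<prec> l $ n \<Longrightarrow> \<not> d \<prec> y" if "K n d" "n \<in>\<^sub>M nats" for n d
  proof -
    have "\<not> l $ n \<prec> x" if "x \<in>\<^sub>M low P (l $ n)" for x using that mem_low less_asym by blast
    then show "\<not> l $ n \<prec> d" using that l_real unfolding K_def is_sup_def by blast
    show "\<And>y. y \<in>\<^sub>M P \<Longrightarrow> y \<prec> l $ n \<Longrightarrow> \<not> d \<prec> y" using that mem_low unfolding K_def is_sup_def by blast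
  qed
  have K_limit: "\<exists>y. y \<in>\<^sub>M P \<and> u \<prec> y \<and> y \<prec> d" if K: "K n d" "n \<in>\<^sub>M nats" "u \<prec> d" for n d u
  proof -
    have "is_sup (low P (l $ n)) d" using K(1) unfolding K_def by blast
    then obtain y where y: "y \<in>\<^sub>M P" "y \<prec> l $ n" "u \<prec> y"
      using is_sup_approx K(3) mem_low by blast
    show ?thesis
    \<comment> \<open>If the supremum is attained, it lies below \<open>l $ n\<close>, and
      non-isolation gives another point of \<open>P\<close> below \<open>l $ n\<close>. This point
      cannot exceed the supremum, so it lies strictly to its left.\<close>
    proof (cases "y = d")
      case True
      then obtain y' where y': "y' \<in>\<^sub>M P" "u \<prec> y'" "y' \<prec> l $ n" "y' \<noteq> d" using not_isolated y by blast
      then show ?thesis using K_bounds(2)[OF K(1,2) y'(1,3)] less_total[of y' d] PR K_P[OF K(1)] by blast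
    next
      case False
      then show ?thesis using K_bounds(2)[OF K(1,2) y(1,2)] y less_total[of y d] PR K_P[OF K(1)] by blast
    qed
  qed
  have K_between: "\<exists>n d. n \<in>\<^sub>M nats \<and> K n d \<and> \<not> d \<prec> y \<and> d \<prec> y'" if y: "y \<in>\<^sub>M P" "y \<prec> y'" for y y'
  proof -
    obtain n where n: "n \<in>\<^sub>M nats" "y \<prec> l $ n" "l $ n \<prec> y'" using l_dense[OF y(2)] by blast
    obtain d where d: "K n d" using K_exists n(1) y(1) n(2) by blast
    have "\<not> d \<prec> y" using K_bounds(2)[OF d n(1) y(1) n(2)] .
    moreover have "d \<prec> y'" using le_less_trans[of d "l $ n" y'] K_bounds(1)[OF d n(1)] n(3) PR K_P[OF d] by blast
    ultimately show ?thesis using n(1) d by blast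
  qed
  define D where "D = sep P (\<lambda>d. \<exists>n. n \<in>\<^sub>M nats \<and> K n d)"
  have D: "d \<in>\<^sub>M D \<longleftrightarrow> (\<exists>n. n \<in>\<^sub>M nats \<and> K n d)" for d
  proof -
    have "dfn (\<lambda>\<rho>. \<exists>n. n \<in>\<^sub>M nats \<and> K n (\<rho> 0))" by (intro dfn_intros dfn2[OF dfn_K])
    then show ?thesis unfolding D_def using K_P mem_sep[of "\<lambda>d. \<exists>n. n \<in>\<^sub>M nats \<and> K n d" d P] by blast
  qed
  have DP: "d \<in>\<^sub>M P" if "d \<in>\<^sub>M D" for d using that K_P D by blast
  have dense: "\<exists>y. y \<in>\<^sub>M D \<and> d \<prec> y \<and> y \<prec> d'" if d: "d \<in>\<^sub>M D" "d' \<in>\<^sub>M D" "d \<prec> d'" for d d'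
  proof -
    obtain n where n: "n \<in>\<^sub>M nats" "K n d'" using d(2) D by blast
    obtain y where y: "y \<in>\<^sub>M P" "d \<prec> y" "y \<prec> d'" using K_limit[OF n(2,1) d(3)] by blast
    obtain k e where e: "k \<in>\<^sub>M nats" "K k e" "\<not> e \<prec> y" "e \<prec> d'" using K_between[OF y(1,3)] by blast
    have "d \<prec> e" using less_le_trans[of e d y] e(3) y(2) PR K_P[OF e(2)] by blast
    then show ?thesis using e D by blast
  qed
  have D_countable: "countable_set D"
    by (rule countable_if_indexed[OF dfn_K]) (use D in blast, use is_sup_unique in \<open>auto simp: K_def\<close>)
  \<comment> \<open>Three points are wanted so that the middle one separates two suprema in
    \<open>D\<close>.\<close>
  have "\<exists>p0 p1 p2. p0 \<in>\<^sub>M P \<and> p1 \<in>\<^sub>M P \<and> p2 \<in>\<^sub>M P \<and> p0 \<prec> p1 \<and> p1 \<prec> p2"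
  proof -
    have below: "\<exists>a. a \<prec> p" if "p \<in>\<^sub>M P" for p using exists_below PR that by blast
    obtain y where y: "y \<in>\<^sub>M P" "y \<noteq> x0"
      using not_isolated[OF x0] below[OF x0] less_add_one[OF PR[OF x0]] by blast
    obtain p q where pq: "p \<in>\<^sub>M P" "q \<in>\<^sub>M P" "p \<prec> q" using y x0 less_total[OF PR[OF x0] PR[OF y(1)]] by blast
    obtain a where "a \<prec> p" using below pq(1) by blast
    then obtain p' where p': "p' \<in>\<^sub>M P" "p' \<prec> q" "p' \<noteq> p" using not_isolated[OF pq(1) _ pq(3)] by blast
    then show ?thesis using pq less_total[OF PR[OF pq(1)] PR[OF p'(1)]] by blast
  qed
  then obtain p0 p1 p2 where p: "p0 \<in>\<^sub>M P" "p1 \<in>\<^sub>M P" "p2 \<in>\<^sub>M P" "p0 \<prec> p1" "p1 \<prec> p2" by blast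
  obtain n0 d0 where d0: "n0 \<in>\<^sub>M nats" "K n0 d0" "d0 \<prec> p1" using K_between[OF p(1,4)] by blast
  obtain n1 d1 where d1: "n1 \<in>\<^sub>M nats" "K n1 d1" "\<not> d1 \<prec> p1" using K_between[OF p(2,5)] by blast
  have d01: "d0 \<prec> d1" using less_le_trans[of d1 d0 p1] d0(3) d1(3) PR K_P[OF d1(2)] by blast
  have d01D: "d0 \<in>\<^sub>M D" "d1 \<in>\<^sub>M D" using d0 d1 D by blast+
  define E where "E = sep D (\<lambda>y. d0 \<prec> y \<and> y \<prec> d1)"
  have E: "y \<in>\<^sub>M E \<longleftrightarrow> y \<in>\<^sub>M D \<and> d0 \<prec> y \<and> y \<prec> d1" for y
    unfolding E_def by (rule mem_sep) (intro dfn_real)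
  have ED: "E \<subseteq>\<^sub>M D" using E by (simp add: subset_of_def)
  have ER: "E \<subseteq>\<^sub>M R" using E DP PR by (simp add: subset_of_def)
  obtain e0 where e0: "e0 \<in>\<^sub>M E" using dense[OF d01D d01] E by blast
  define Q where "Q = sep R (\<lambda>q. \<exists>n. n \<in>\<^sub>M nats \<and> q = l $ n)"
  have Q: "q \<in>\<^sub>M Q \<longleftrightarrow> q \<in>\<^sub>M R \<and> (\<exists>n. n \<in>\<^sub>M nats \<and> q = l $ n)" for q
    unfolding Q_def by (rule mem_sep) (intro dfn_real)
  have QR: "Q \<subseteq>\<^sub>M R" using Q by (simp add: subset_of_def)
  have "dfn (\<lambda>\<rho>. \<rho> 1 = l $ \<rho> 0)" by (intro dfn_intros)
  then have Q_countable: "countable_set Q"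
    by (rule countable_if_indexed) (use Q in auto)
  have Q_dense: "\<exists>q. q \<in>\<^sub>M Q \<and> u \<prec> q \<and> q \<prec> v" if "u \<prec> v" for u v
    using l_dense[OF that] Q less_mem by blast
  have "\<exists>j. is_function j Q E \<and> (\<forall>x y. x \<in>\<^sub>M Q \<longrightarrow> y \<in>\<^sub>M Q \<longrightarrow> x \<prec> y \<longrightarrow> j $ x \<prec> j $ y)"
  proof (rule embed_countable_in_dense[OF QR Q_countable ER countable_subset[OF D_countable ED] e0])
    show "\<exists>d. d \<in>\<^sub>M E \<and> x \<prec> d \<and> d \<prec> y" if "x \<in>\<^sub>M E" "y \<in>\<^sub>M E" "x \<prec> y" for x y
      using dense[of x y] that less_trans unfolding E by blast
    show "\<exists>d. d \<in>\<^sub>M E \<and> x \<prec> d" if "x \<in>\<^sub>M E" for x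
      using dense[of x d1] that d01D less_trans unfolding E by blast
    show "\<exists>d. d \<in>\<^sub>M E \<and> d \<prec> x" if "x \<in>\<^sub>M E" for x
      using dense[of d0 x] that d01D less_trans unfolding E by blast
  qed
  then obtain j where j: "is_function j Q E"
    and j_mono: "\<And>x y. x \<in>\<^sub>M Q \<Longrightarrow> y \<in>\<^sub>M Q \<Longrightarrow> x \<prec> y \<Longrightarrow> j $ x \<prec> j $ y" by blast
  have jE: "j $ q \<in>\<^sub>M E" if "q \<in>\<^sub>M Q" for q by (rule function_ap_mem[OF j that])
  \<comment> \<open>As with Dedekind cuts, the value at \<open>x\<close> will be the supremum of the
    values of \<open>j\<close> at the rationals below \<open>x\<close>; closedness keeps it in
    \<open>P\<close>.\<close>
  define S where "S x = sep E (\<lambda>y. \<exists>q. q \<in>\<^sub>M Q \<and> q \<prec> x \<and> y = j $ q)" for x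
  have S: "y \<in>\<^sub>M S x \<longleftrightarrow> y \<in>\<^sub>M E \<and> (\<exists>q. q \<in>\<^sub>M Q \<and> q \<prec> x \<and> y = j $ q)" for x y
    unfolding S_def by (rule mem_sep) (intro dfn_real)
  have S_mem: "j $ q \<in>\<^sub>M S x" if "q \<in>\<^sub>M Q" "q \<prec> x" for q x using that jE S by blast
  have Q_below: "\<exists>q. q \<in>\<^sub>M Q \<and> q \<prec> x" if "x \<in>\<^sub>M R" for x
    using exists_below[OF that] Q_dense by blast
  have SP: "y \<in>\<^sub>M P" if "y \<in>\<^sub>M S x" for x y using that S E DP by blast
  have sup_exists: "\<exists>y. y \<in>\<^sub>M P \<and> is_sup (S x) y" if x: "x \<in>\<^sub>M R" for x
  proof -
    obtain q where q: "q \<in>\<^sub>M Q" "q \<prec> x" using Q_below[OF x] by blast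
    have "\<exists>y. is_sup (S x) y"
    proof (rule is_sup_exists)
      show "S x \<subseteq>\<^sub>M R" using SP PR by (simp add: subset_of_def)
      show "j $ q \<in>\<^sub>M S x" by (rule S_mem[OF q])
      show "d1 \<in>\<^sub>M R" using d01 less_mem by blast
      show "\<not> d1 \<prec> y" if "y \<in>\<^sub>M S x" for y using that S E less_asym by blast
    qed
    then show ?thesis using sup_P SP by blast
  qed
  have "\<exists>h. is_function h X X \<and> (\<forall>x. x \<in>\<^sub>M X \<longrightarrow> is_sup (S x) (h $ x))"
  proof (rule function_of_relation)
    show "dfn (\<lambda>\<rho>. is_sup (S (\<rho> 0)) (\<rho> 1))" unfolding S_def by (intro dfn_real dfn_is_sup)
    fix x assume "x \<in>\<^sub>M X"
    then obtain y where "y \<in>\<^sub>M P" "is_sup (S x) y" using sup_exists subset_ofD[OF XR] by blast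
    then show "\<exists>!y. y \<in>\<^sub>M X \<and> is_sup (S x) y"
      using subset_ofD[OF PX] is_sup_unique by (intro ex1I[of _ y]) blast+
  qed
  then obtain h where h: "is_function h X X" "\<And>x. x \<in>\<^sub>M X \<Longrightarrow> is_sup (S x) (h $ x)" by blast
  have hR: "h $ x \<in>\<^sub>M R" if "x \<in>\<^sub>M X" for x using h(2)[OF that] unfolding is_sup_def by blast
  have h_ge: "\<not> h $ x \<prec> j $ q" if "x \<in>\<^sub>M X" "q \<in>\<^sub>M Q" "q \<prec> x" for x q
    using h(2)[OF that(1)] S_mem[OF that(2,3)] unfolding is_sup_def by blast
  have h_le: "\<not> j $ q \<prec> h $ x" if x: "x \<in>\<^sub>M X" and q: "q \<in>\<^sub>M Q" "x \<prec> q" for x q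
  proof -
    have "\<not> j $ q \<prec> y" if y: "y \<in>\<^sub>M S x" for y
    proof -
      obtain q' where q': "q' \<in>\<^sub>M Q" "q' \<prec> x" "y = j $ q'" using y S by blast
      have "q' \<prec> q" using q'(2) q(2) less_trans by blast
      then have "j $ q' \<prec> j $ q" using j_mono q'(1) q(1) by blast
      then show ?thesis using q'(3) less_asym by blast
    qed
    moreover have "j $ q \<in>\<^sub>M R" using jE[OF q(1)] subset_ofD[OF ER] by blast
    ultimately show ?thesis using h(2)[OF x] unfolding is_sup_def by blast
  qed
  have "h $ x \<prec> h $ y" if x: "x \<in>\<^sub>M X" and y: "y \<in>\<^sub>M X" and xy: "x \<prec> y" for x y
  proof -
    \<comment> \<open>Two rationals are inserted because suprema preserve the order only weakly;
      strictness comes from \<open>j\<close> between them.\<close>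
    obtain q where q: "q \<in>\<^sub>M Q" "x \<prec> q" "q \<prec> y" using Q_dense[OF xy] by blast
    obtain q' where q': "q' \<in>\<^sub>M Q" "q \<prec> q'" "q' \<prec> y" using Q_dense[OF q(3)] by blast
    have "h $ x \<prec> j $ q'"
      using le_less_trans[OF hR[OF x] h_le[OF x q(1,2)] j_mono[OF q(1) q'(1,2)]] .
    then show ?thesis using less_le_trans[OF hR[OF y] _ h_ge[OF y q'(1,3)]] by blast
  qed
  moreover have d0X: "d0 \<in>\<^sub>M X" using d01D DP subset_ofD[OF PX] by blast
  moreover have "h $ d0 \<noteq> d0"
  proof -
    \<comment> \<open>All values of \<open>j\<close> lie above \<open>d0\<close>, hence so does
      \<open>h $ d0\<close>.\<close>
    obtain q where q: "q \<in>\<^sub>M Q" "q \<prec> d0" using Q_below d01 less_mem by blast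
    have "d0 \<prec> j $ q" using jE[OF q(1)] E by blast
    then show ?thesis using h_ge[OF d0X q] by auto
  qed
  ultimately show ?thesis unfolding inexact_real_iff[OF XR] using h(1) by blast
qed

lemma inexact_if_perfect_set_property:
  assumes "all_perfect_set_property R lt"
  shows "all_infinite_inexact R lt"
  unfolding all_infinite_inexact_def
proof (intro allI impI)
  fix X assume X: "X \<subseteq>\<^sub>M R" "\<not> finite_set X"
  then consider "countable_set X" | P x where "perfect_set R lt P" "x \<in>\<^sub>M P" "P \<subseteq>\<^sub>M X"
    using assms unfolding all_perfect_set_property_def perfect_set_property_def by blast
  then show "inexact X lt"
    by cases (use countable_infinite_inexact perfect_subset_inexact X in blast)+
qed

end

theorem theorem1p2:
  fixes mem :: "'a \<Rightarrow> 'a \<Rightarrow> bool" and R lt :: 'a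
  assumes "ZF_model mem"
    and "ZF_model.real_line mem R lt"
  shows "(ZF_model.no_uncountable_partition mem R lt \<longleftrightarrow> ZF_model.all_infinite_inexact mem R lt) \<and>
         (ZF_model.all_perfect_set_property mem R lt \<longrightarrow> ZF_model.no_uncountable_partition mem R lt)"
proof -
  interpret ZF_model mem by (rule assms(1))
  obtain pl ml zr one where "complete_ordered_field R lt pl ml zr one"
    using assms(2) unfolding real_line_def by blast
  then interpret real_model mem R lt pl ml zr one by unfold_locales
  \<comment> \<open>The base does not occur in the statements compared, so any one may be
    fixed.\<close>
  obtain l r where "is_function l nats R" "is_function r nats R"
    "\<forall>u x v. less u x \<longrightarrow> less x v \<longrightarrow> (\<exists>n. mem n nats \<and> less u (ap l n) \<and> less (ap l n) x \<and>
      less x (ap r n) \<and> less (ap r n) v)"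
    using countable_base by blast
  then interpret real_base mem R lt pl ml zr one l r by unfold_locales blast+
  show ?thesis
    using no_partition_if_inexact inexact_if_no_partition inexact_if_perfect_set_property by blast
qed

end
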